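(* Let $\alpha\in\mathcal R_c$. The following are equivalent: (1) $L^\alpha(\mathbb T)=\mathcal L^\alpha(\mathbb T)$; (2) $H^\alpha(\mathbb T)=\mathcal H^\alpha(\mathbb T)$; (3) $H^\alpha(\mathbb T)$ is weakly sequentially complete; (4) $L^\alpha(\mathbb T)$ is weakly sequentially complete.
   Context: $\mathbb T$ is the unit circle and $m$ is normalized arc length (Haar measure) on $\mathbb T$; functions equal a.e. are identified. For $w\in\mathbb T$, $f_w(z)=f(\overline wz)$. $\mathcal R_c$ is the set of continuous rotationally symmetric seminorms, i.e. seminorms $\alpha$ on $L^\infty(\mathbb T)$ with $\alpha(1)=1$, $\alpha(|f|)=\alpha(f)$, $\alpha(f_w)=\alpha(f)$ for all $f\in L^\infty(\mathbb T)$, $w\in\mathbb T$, and $\lim_{m(E)\to0^+}\alpha(\chi_E)=0$. For any measurable $f:\mathbb T\to\mathbb C$ put $\alpha(f)=\sup\{\alpha(s):s\text{ a simple function},\ |s|\le|f|\}$. $\mathcal L^\alpha(\mathbb T)$ is the set of measurable $f$ with $\alpha(f)<\infty$, and $L^\alpha(\mathbb T)$ is the $\alpha$-closure of $L^\infty(\mathbb T)$ in $\mathcal L^\alpha(\mathbb T)$. $H^\alpha(\mathbb T)$ is the $\alpha$-closed linear span of $\{1,z,z^2,\ldots\}$, and $\mathcal H^\alpha(\mathbb T)=\mathcal L^\alpha(\mathbb T)\cap H^1(\mathbb T)$. A Banach space is weakly sequentially complete if every weakly Cauchy sequence in it is weakly convergent. *)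

theory Defs
  imports "HOL-Analysis.Analysis" "HOL-Library.Going_To_Filter"
begin

text \<open>
  Functions on the circle are represented by functions \<^typ>\<open>complex \<Rightarrow> complex\<close>, whose values off the
  unit circle are irrelevant. Spaces of classes modulo equality a.e. are represented by sets of
  Borel representatives; every set of functions below that stands for such a space is closed under
  a.e. equality of Borel functions, so equality of these sets is equality of the spaces.
\<close>

definition circle_measure :: "complex measure" where
  "circle_measure =
     distr (uniform_measure lborel {0..2*pi}) (restrict_space borel (sphere 0 1)) cis"

lemma space_circle_measure [simp]: "space circle_measure = sphere 0 1"
  and sets_circle_measure: "sets circle_measure = sets (restrict_space borel (sphere 0 1))"
  by (simp_all add: circle_measure_def space_restrict_space)

lemma emeasure_circle_measure: "emeasure circle_measure (sphere 0 1) = 1"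
proof -
  have "cis \<in> borel_measurable borel"
    by (intro borel_measurable_continuous_onI continuous_intros)
  then have "cis \<in> borel_measurable (uniform_measure lborel {0..2*pi})"
    by (simp cong: measurable_cong_sets)
  then have [measurable]:
    "cis \<in> uniform_measure lborel {0..2*pi} \<rightarrow>\<^sub>M restrict_space borel (sphere 0 1)"
    by (intro measurable_restrict_space2) auto
  have "sphere 0 1 \<in> sets (restrict_space borel (sphere 0 1 :: complex set))"
    by (auto simp: sets_restrict_space)
  moreover have "cis -` sphere 0 1 = UNIV" by auto
  ultimately show ?thesis
    by (simp add: circle_measure_def emeasure_distr ennreal_divide_self)
qed

definition Linfty :: "(complex \<Rightarrow> complex) set" where
  "Linfty = {f \<in> borel_measurable circle_measure. \<exists>C. AE z in circle_measure. norm (f z) \<le> C}"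

text \<open>
  Only the values of \<open>\<alpha>\<close> on \<^const>\<open>Linfty\<close> matter. Invariance under a.e. equality says that \<open>\<alpha>\<close> is
  a function of the class. Nonnegativity follows from subadditivity and homogeneity.
\<close>

definition seminorm_Linfty :: "((complex \<Rightarrow> complex) \<Rightarrow> real) \<Rightarrow> bool" where
  "seminorm_Linfty \<alpha> \<longleftrightarrow>
     (\<forall>f\<in>Linfty. \<forall>g\<in>Linfty. (AE z in circle_measure. f z = g z) \<longrightarrow> \<alpha> f = \<alpha> g) \<and>
     (\<forall>f\<in>Linfty. \<forall>g\<in>Linfty. \<alpha> (\<lambda>z. f z + g z) \<le> \<alpha> f + \<alpha> g) \<and>
     (\<forall>f\<in>Linfty. \<forall>c. \<alpha> (\<lambda>z. c * f z) = norm c * \<alpha> f)"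

definition Rc :: "((complex \<Rightarrow> complex) \<Rightarrow> real) set" where
  "Rc = {\<alpha>. seminorm_Linfty \<alpha> \<and>
     \<alpha> (\<lambda>z. 1) = 1 \<and>
     (\<forall>f\<in>Linfty. \<alpha> (\<lambda>z. of_real (norm (f z))) = \<alpha> f) \<and>
     (\<forall>f\<in>Linfty. \<forall>w\<in>sphere 0 1. \<alpha> (\<lambda>z. f (cnj w * z)) = \<alpha> f) \<and>
     ((\<lambda>E. \<alpha> (indicator E)) \<longlongrightarrow> 0)
       ((measure circle_measure) going_to (at_right 0) within sets circle_measure)}"

definition ext_seminorm ::
    "((complex \<Rightarrow> complex) \<Rightarrow> real) \<Rightarrow> (complex \<Rightarrow> complex) \<Rightarrow> ennreal" where
  "ext_seminorm \<alpha> f =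
     (SUP s \<in> {s. simple_function circle_measure s \<and>
                  (AE z in circle_measure. norm (s z) \<le> norm (f z))}. ennreal (\<alpha> s))"

definition cL_space :: "((complex \<Rightarrow> complex) \<Rightarrow> real) \<Rightarrow> (complex \<Rightarrow> complex) set" where
  "cL_space \<alpha> = {f \<in> borel_measurable circle_measure. ext_seminorm \<alpha> f < \<infinity>}"

definition seminorm_closure ::
    "((complex \<Rightarrow> complex) \<Rightarrow> real) \<Rightarrow> (complex \<Rightarrow> complex) set \<Rightarrow> (complex \<Rightarrow> complex) set" where
  "seminorm_closure \<alpha> S =
     {f \<in> cL_space \<alpha>. \<forall>e>0. \<exists>g\<in>S. ext_seminorm \<alpha> (\<lambda>z. f z - g z) < e}"

definition L_space :: "((complex \<Rightarrow> complex) \<Rightarrow> real) \<Rightarrow> (complex \<Rightarrow> complex) set" where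
  "L_space \<alpha> = seminorm_closure \<alpha> Linfty"

text \<open>The linear span of \<open>1, z, z\<^sup>2, \<dots>\<close>.\<close>

definition analytic_polys :: "(complex \<Rightarrow> complex) set" where
  "analytic_polys = {\<lambda>z. \<Sum>k\<le>n. c k * z ^ k | (n::nat) (c :: nat \<Rightarrow> complex). True}"

definition H_space :: "((complex \<Rightarrow> complex) \<Rightarrow> real) \<Rightarrow> (complex \<Rightarrow> complex) set" where
  "H_space \<alpha> = seminorm_closure \<alpha> analytic_polys"

text \<open>
  The classical Hardy space: the closed linear span of \<open>1, z, z\<^sup>2, \<dots>\<close> in \<open>L\<^sup>1\<close>, i.e. the space
  \<^const>\<open>H_space\<close> of the \<open>L\<^sup>1\<close>-norm.
\<close>

definition H1 :: "(complex \<Rightarrow> complex) set" where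
  "H1 = H_space (\<lambda>f. LINT z|circle_measure. norm (f z))"

definition cH_space :: "((complex \<Rightarrow> complex) \<Rightarrow> real) \<Rightarrow> (complex \<Rightarrow> complex) set" where
  "cH_space \<alpha> = cL_space \<alpha> \<inter> H1"

text \<open>
  Bounded complex linear functionals on a linear space \<open>X\<close> of functions with norm \<open>p\<close>, finite on
  \<open>X\<close>. Boundedness forces \<open>\<phi> f = \<phi> g\<close> whenever \<open>p (f - g) = 0\<close>, so these are exactly the
  bounded functionals on the quotient of \<open>X\<close> by the functions of norm zero.
\<close>

definition dual_space ::
    "(complex \<Rightarrow> complex) set \<Rightarrow> ((complex \<Rightarrow> complex) \<Rightarrow> ennreal) \<Rightarrow>
     ((complex \<Rightarrow> complex) \<Rightarrow> complex) set" where
  "dual_space X p =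
     {\<phi>. (\<forall>f\<in>X. \<forall>g\<in>X. \<phi> (\<lambda>z. f z + g z) = \<phi> f + \<phi> g) \<and>
          (\<forall>c. \<forall>f\<in>X. \<phi> (\<lambda>z. c * f z) = c * \<phi> f) \<and>
          (\<exists>C. \<forall>f\<in>X. norm (\<phi> f) \<le> C * enn2real (p f))}"

definition weakly_Cauchy ::
    "(complex \<Rightarrow> complex) set \<Rightarrow> ((complex \<Rightarrow> complex) \<Rightarrow> ennreal) \<Rightarrow>
     (nat \<Rightarrow> complex \<Rightarrow> complex) \<Rightarrow> bool" where
  "weakly_Cauchy X p x \<longleftrightarrow> (\<forall>\<phi>\<in>dual_space X p. Cauchy (\<lambda>n. \<phi> (x n)))"

definition weakly_convergent_to ::
    "(complex \<Rightarrow> complex) set \<Rightarrow> ((complex \<Rightarrow> complex) \<Rightarrow> ennreal) \<Rightarrow>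
     (nat \<Rightarrow> complex \<Rightarrow> complex) \<Rightarrow> (complex \<Rightarrow> complex) \<Rightarrow> bool" where
  "weakly_convergent_to X p x f \<longleftrightarrow> (\<forall>\<phi>\<in>dual_space X p. (\<lambda>n. \<phi> (x n)) \<longlonglongrightarrow> \<phi> f)"

definition weakly_seq_complete ::
    "(complex \<Rightarrow> complex) set \<Rightarrow> ((complex \<Rightarrow> complex) \<Rightarrow> ennreal) \<Rightarrow> bool" where
  "weakly_seq_complete X p \<longleftrightarrow>
     (\<forall>x. (\<forall>n. x n \<in> X) \<and> weakly_Cauchy X p x \<longrightarrow> (\<exists>f\<in>X. weakly_convergent_to X p x f))"

end

theory Submission
  imports Defs
begin

text \<open>
  Let \<open>p\<close> be the extension of \<open>\<alpha>\<close> to measurable functions. It is a lattice norm with the Fatou property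
  that dominates the \<open>L\<^sup>1\<close>-norm, and continuity of \<open>\<alpha>\<close> makes every bounded functional on \<open>L\<^sup>\<alpha>\<close> an
  integral \<open>\<integral> f g\<close> with \<open>g\<close> in the Koethe dual; by Hahn--Banach the same holds on \<open>H\<^sup>\<alpha>\<close>. A sequence in
  \<open>L\<^sup>\<alpha>\<close> on which all these integrals are Cauchy has, by Vitali--Hahn--Saks, a weak limit that is
  integrable against the whole Koethe dual and hence lies in the large space. So (1) gives (4), and
  also (2) and (3), because Fejer means show that \<open>H\<^sup>\<alpha>\<close> consists of the elements of \<open>L\<^sup>\<alpha>\<close> whose Fourier
  coefficients of negative index vanish. Conversely, the truncations of a function \<open>f\<close> of the large
  space converge to \<open>f\<close> against the whole Koethe dual, so (4) puts \<open>f\<close> into \<open>L\<^sup>\<alpha>\<close>. For (2) and (3) one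
  replaces \<open>f\<close> by an outer function of modulus \<open>1 + |f|\<close> and the truncations by dominated analytic
  polynomials; then \<open>f\<close> lies in \<open>L\<^sup>\<alpha>\<close> because \<open>L\<^sup>\<alpha>\<close> is an ideal.
\<close>

section \<open>Sequences of integrals over sets\<close>

text \<open>Rotation invariance acts through Fejer means: as averages over roots of unity they
  contract \<open>\<alpha>\<close>, which gives the bound by the L1-norm (the mean of order 1 is the
  integral) and later recovers analytic polynomials. Continuity of \<open>\<alpha>\<close> serves as
  a bounded convergence theorem; it yields the Fatou property of \<open>p\<close> and the countable
  additivity of the set functions behind functionals. The obstacle is that in general only the large
  space has the Fatou property. A weak limit is therefore found first in the large space, and
  condition (1) brings it back. Conversely a function of the large space is approximated in general
  only pointwise under a majorant, not in norm; representing functionals by integrals turns this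
  into weak convergence. Truncation destroys analyticity, so the Hardy versions need polynomials
  with a common majorant. The summand 1 in 1 + |f| makes the logarithm nonnegative, and the square
  of the logarithm is at most 4 (1 + |f|), hence integrable. The conjugate function is then built in
  mean square, where an identity for squares of polynomials is enough.\<close>

lemma norm_diff_add_le: "norm (a - b + c) \<le> norm a + norm b + norm (c :: 'a :: real_normed_vector)"
  by (meson add_right_mono norm_triangle_ineq norm_triangle_ineq4 order_trans)

text \<open>Absolute continuity of the integral, by splitting \<open>norm (h x)\<close> into its
  part below \<open>real n\<close> and a tail \<open>?t n\<close> of small integral.\<close>

lemma (in finite_measure) integral_indicator_small:
  fixes h :: "'a \<Rightarrow> 'b::{banach, second_countable_topology}"
  assumes h: "integrable M h" and e: "0 < e"
  obtains d where "0 < d"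
    "\<And>E. E \<in> sets M \<Longrightarrow> measure M E < d \<Longrightarrow> (LINT x|M. norm (indicator E x *\<^sub>R h x)) < e"
proof -
  let ?t = "\<lambda>n x. norm (h x) - min (norm (h x)) (real n)"
  have "(\<lambda>n. LINT x|M. ?t n x) \<longlonglongrightarrow> (LINT x|M. 0)"
  proof (rule integral_dominated_convergence[where w="\<lambda>x. norm (h x)"])
    show "AE x in M. (\<lambda>n. ?t n x) \<longlonglongrightarrow> 0"
    proof (rule AE_I2, rule tendsto_eventually)
      fix x
      show "\<forall>\<^sub>F n in sequentially. ?t n x = 0"
        using eventually_ge_at_top[of "nat \<lceil>norm (h x)\<rceil>"]
        by eventually_elim (auto simp: min_def nat_le_iff ceiling_le_iff)
    qed
  qed (use h in \<open>auto simp: min_def\<close>)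
  then have "\<forall>\<^sub>F n in sequentially. (LINT x|M. ?t n x) < e/2"
    using e by (intro order_tendstoD) auto
  then obtain n where n: "(LINT x|M. ?t n x) < e/2"
    by (auto simp: eventually_sequentially)
  have int: "integrable M (?t n)"
    using h by (intro Bochner_Integration.integrable_diff integrable_min) auto
  show ?thesis
  proof (rule that)
    \<comment> \<open>The part below \<open>real n\<close> contributes at most
      \<open>real n * measure M E\<close>; \<open>real n + 1\<close> keeps the quotient meaningful
      when \<open>n = 0\<close>.\<close>
    show "0 < e / (2 * (real n + 1))" using e by simp
    fix E assume E: "E \<in> sets M" "measure M E < e / (2 * (real n + 1))"
    have "(LINT x|M. norm (indicator E x *\<^sub>R h x)) \<le> (LINT x|M. ?t n x + (real n + 1) * indicator E x)"
      using E h int emeasure_finite[of E]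
      by (intro integral_mono integrable_norm integrable_mult_indicator Bochner_Integration.integrable_add integrable_mult_right)
         (auto split: split_indicator simp: min_def less_top[symmetric])
    also have "\<dots> = (LINT x|M. ?t n x) + (real n + 1) * measure M E"
      using E int by (subst Bochner_Integration.integral_add) (auto simp: less_top[symmetric])
    also have "\<dots> < e/2 + (real n + 1) * (e / (2 * (real n + 1)))"
      using n E by (intro add_strict_mono mult_strict_left_mono) auto
    also have "\<dots> = e" by (simp add: field_simps)
    finally show "(LINT x|M. norm (indicator E x *\<^sub>R h x)) < e" .
  qed
qed

text \<open>The Vitali--Hahn--Saks theorem. A failure of the equicontinuity lets one build a sequence of
  sets that converges in measure to a set on which the sequence of integrals is not Cauchy; this is
  Baire's theorem for the measure algebra, unrolled.\<close>

lemma (in finite_measure) Vitali_Hahn_Saks: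
  fixes h :: "nat \<Rightarrow> 'a \<Rightarrow> 'b::{banach, second_countable_topology}"
  assumes h: "\<And>n. integrable M (h n)"
    and C: "\<And>E. E \<in> sets M \<Longrightarrow> Cauchy (\<lambda>n. LINT x|M. indicator E x *\<^sub>R h n x)"
    and e: "0 < e"
  obtains d where "0 < d"
    "\<And>E n. E \<in> sets M \<Longrightarrow> measure M E < d \<Longrightarrow> norm (LINT x|M. indicator E x *\<^sub>R h n x) < e"
proof -
  define G where "G n E = (LINT x|M. indicator E x *\<^sub>R h n x)" for n E
  define r where "r A B = measure M (sym_diff A B)" for A B
  \<comment> \<open>Sets on which the integrals still oscillate beyond index \<open>N\<close>. They
    are open for the pseudometric \<open>r\<close>; if they were dense for every \<open>N\<close>, a
    Baire construction would produce a set that is bad for all \<open>N\<close>, contradicting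
    \<open>C\<close>.\<close>
  define bad where "bad N E \<longleftrightarrow> (\<exists>m\<ge>N. \<exists>n\<ge>N. norm (G m E - G n E) > e/4)" for N E
  have int: "integrable M (\<lambda>x. indicator E x *\<^sub>R h n x)" if "E \<in> sets M" for n E
    using that h by (rule integrable_mult_indicator)
  have Gdiff: "norm (G n A - G n B) \<le> (LINT x|M. norm (indicator (sym_diff A B) x *\<^sub>R h n x))"
    if "A \<in> sets M" "B \<in> sets M" for n A B
  proof -
    have "G n A - G n B = (LINT x|M. indicator A x *\<^sub>R h n x - indicator B x *\<^sub>R h n x)"
      unfolding G_def using that int by (subst Bochner_Integration.integral_diff) auto
    also have "norm \<dots> \<le> (LINT x|M. norm (indicator A x *\<^sub>R h n x - indicator B x *\<^sub>R h n x))"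
      by (rule integral_norm_bound)
    also have "\<dots> = (LINT x|M. norm (indicator (sym_diff A B) x *\<^sub>R h n x))"
      by (intro Bochner_Integration.integral_cong) (auto split: split_indicator)
    finally show ?thesis .
  qed
  have bad_open: "\<exists>d>0. \<forall>D\<in>sets M. r B D < d \<longrightarrow> bad N D" if bad: "bad N B" and B: "B \<in> sets M" for N B
  proof -
    from bad obtain m n where mn: "m \<ge> N" "n \<ge> N" "norm (G m B - G n B) > e/4"
      by (auto simp: bad_def)
    define s where "s = norm (G m B - G n B) - e/4"
    have s: "s > 0" using mn by (simp add: s_def)
    obtain d1 where d1: "0 < d1" "\<And>E. E \<in> sets M \<Longrightarrow> measure M E < d1 \<Longrightarrow> (LINT x|M. norm (indicator E x *\<^sub>R h m x)) < s/2"
      using integral_indicator_small[OF h] s by (metis half_gt_zero)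
    obtain d2 where d2: "0 < d2" "\<And>E. E \<in> sets M \<Longrightarrow> measure M E < d2 \<Longrightarrow> (LINT x|M. norm (indicator E x *\<^sub>R h n x)) < s/2"
      using integral_indicator_small[OF h] s by (metis half_gt_zero)
    show ?thesis
    proof (intro exI[of _ "min d1 d2"] conjI ballI impI)
      fix D assume D: "D \<in> sets M" "r B D < min d1 d2"
      have "norm (G m B - G m D) < s/2" "norm (G n B - G n D) < s/2"
        using Gdiff[OF B D(1), of m] Gdiff[OF B D(1), of n] d1(2)[of "sym_diff B D"] d2(2)[of "sym_diff B D"] D B
        by (auto simp: r_def)
      moreover have "G m B - G n B = (G m B - G m D) - (G n B - G n D) + (G m D - G n D)" by simp
      then have "norm (G m B - G n B) \<le> norm (G m B - G m D) + norm (G n B - G n D) + norm (G m D - G n D)"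
        using norm_diff_add_le by metis
      ultimately have "norm (G m D - G n D) > e/4" by (simp add: s_def field_simps)
      then show "bad N D" using mn by (auto simp: bad_def)
    qed (use d1 d2 in auto)
  qed
  have "\<exists>N A d. A \<in> sets M \<and> d > 0 \<and> (\<forall>D\<in>sets M. r A D < d \<longrightarrow> \<not> bad N D)"
  proof (rule ccontr)
    assume "\<not> ?thesis"
    then have H: "\<exists>D\<in>sets M. r A D < d \<and> bad N D" if "A \<in> sets M" "d > 0" for N A d
      using that by metis
    define P where "P k Bd \<longleftrightarrow> fst Bd \<in> sets M \<and> snd Bd > 0 \<and> (\<forall>D\<in>sets M. r (fst Bd) D < snd Bd \<longrightarrow> bad k D)" for k :: nat and Bd :: "'a set \<times> real"
    \<comment> \<open>Centres move by less than a quarter of the radius and radii halve, so the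
      limit set stays within \<open>d n / 2\<close> of the centre \<open>B n\<close>, the sum of the
      terms \<open>d n / 4 * (1/2)^k\<close>.\<close>
    define Q where "Q Bd Bd' \<longleftrightarrow> r (fst Bd) (fst Bd') < snd Bd / 4 \<and> snd Bd' \<le> snd Bd / 2" for Bd Bd' :: "'a set \<times> real"
    have ext: "\<exists>Bd'. P k Bd' \<and> Q (A, d) Bd'" if AM: "A \<in> sets M" and "d > 0" for k A d
    proof -
      obtain D where D: "D \<in> sets M" "r A D < d/4" "bad k D" using H[of A "d/4" k] \<open>d > 0\<close> AM by (metis divide_pos_pos zero_less_numeral)
      obtain d' where "d' > 0" "\<forall>E\<in>sets M. r D E < d' \<longrightarrow> bad k E" using bad_open[OF D(3,1)] by auto
      with D \<open>d > 0\<close> show ?thesis by (intro exI[of _ "(D, min d' (d/2))"]) (auto simp: P_def Q_def)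
    qed
    have "\<exists>f. \<forall>n. P n (f n) \<and> Q (f n) (f (Suc n))"
    proof (rule dependent_nat_choice)
      show "\<exists>x. P 0 x" using ext[of "{}" 1 0] by auto
      show "\<exists>y. P (Suc n) y \<and> Q x y" if "P n x" for x n
        using ext[of "fst x" "snd x" "Suc n"] that by (auto simp: P_def)
    qed
    then obtain f where f: "\<And>n. P n (f n)" "\<And>n. Q (f n) (f (Suc n))" by auto
    define B where "B n = fst (f n)" for n
    define d where "d n = snd (f n)" for n
    have B: "B n \<in> sets M" and d0: "d n > 0" and Bbad: "D \<in> sets M \<Longrightarrow> r (B n) D < d n \<Longrightarrow> bad n D" for n D
      using f(1)[of n] by (auto simp: P_def B_def d_def)
    have rB: "r (B n) (B (Suc n)) < d n / 4" and dS: "d (Suc n) \<le> d n / 2" for n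
      using f(2)[of n] by (auto simp: Q_def B_def d_def)
    have dk: "d (n + k) \<le> d n * (1/2)^k" for n k
    proof (induction k)
      case (Suc k)
      have "d (n + Suc k) \<le> d (n + k) / 2" using dS[of "n+k"] by simp
      also have "\<dots> \<le> d n * (1/2)^k / 2" using Suc by simp
      finally show ?case by simp
    qed simp
    \<comment> \<open>The limit inferior of the centres. A point at which \<open>L\<close> and
      \<open>B n\<close> differ lies in the difference of two consecutive later centres, so
      countable subadditivity bounds \<open>r (B n) L\<close>.\<close>
    define L where "L = (\<Union>n. \<Inter>k\<in>{n..}. B k)"
    have L: "L \<in> sets M" unfolding L_def using B by (intro sets.countable_UN sets.countable_INT'') auto
    have "r (B n) L < d n" for n
    proof -
      have sub: "sym_diff (B n) L \<subseteq> (\<Union>k. sym_diff (B (n+k)) (B (n + Suc k)))"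
      proof (rule ccontr)
        assume "\<not> ?thesis"
        then obtain x where x: "x \<in> sym_diff (B n) L" "\<And>k. x \<in> B (n+k) \<longleftrightarrow> x \<in> B (n + Suc k)" by blast
        have "x \<in> B (n+k) \<longleftrightarrow> x \<in> B n" for k
          by (induction k) (use x(2) in auto)
        then have *: "x \<in> B k \<longleftrightarrow> x \<in> B n" if "k \<ge> n" for k using that le_Suc_ex by blast
        have "x \<in> L \<longleftrightarrow> x \<in> B n"
        proof
          assume "x \<in> L"
          then obtain m where "\<forall>k\<ge>m. x \<in> B k" by (auto simp: L_def)
          then have "x \<in> B (max m n)" by simp
          then show "x \<in> B n" using *[of "max m n"] by simp
        next
          assume "x \<in> B n"
          then have "x \<in> (\<Inter>k\<in>{n..}. B k)" using * by blast
          then show "x \<in> L" unfolding L_def by blast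
        qed
        then show False using x(1) by auto
      qed
      have le: "measure M (sym_diff (B (n+k)) (B (n + Suc k))) \<le> d n / 4 * (1/2)^k" for k
        using rB[of "n+k"] dk[of n k] by (simp add: r_def)
      have summ: "summable (\<lambda>k. d n / 4 * (1/2::real)^k)" by (intro summable_mult summable_geometric) auto
      have s2: "summable (\<lambda>k. measure M (sym_diff (B (n+k)) (B (n + Suc k))))"
        by (rule summable_comparison_test'[OF summ]) (use le in auto)
      have "r (B n) L \<le> measure M (\<Union>k. sym_diff (B (n+k)) (B (n + Suc k)))"
        unfolding r_def using sub B by (intro finite_measure_mono) auto
      also have "\<dots> \<le> (\<Sum>k. measure M (sym_diff (B (n+k)) (B (n + Suc k))))"
        using B by (intro finite_measure_subadditive_countably s2) auto
      also have "\<dots> \<le> (\<Sum>k. d n / 4 * (1/2)^k)"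
        using le s2 summ by (intro suminf_le) auto
      also have "\<dots> = d n / 2" by (subst suminf_mult) (auto simp: suminf_geometric)
      finally show ?thesis using d0[of n] by linarith
    qed
    then have bl: "bad n L" for n using Bbad L by auto
    from C[OF L] e obtain N where "\<forall>m\<ge>N. \<forall>n\<ge>N. norm (G m L - G n L) < e/4"
      unfolding Cauchy_def dist_norm G_def by (auto dest!: spec[of _ "e/4"])
    then show False using bl[of N] by (force simp: bad_def)
  qed
  then obtain N A d where A: "A \<in> sets M" "d > 0" "\<And>D. D \<in> sets M \<Longrightarrow> r A D < d \<Longrightarrow> \<not> bad N D"
    by auto
  have ae: "\<exists>d'>0. \<forall>E\<in>sets M. measure M E < d' \<longrightarrow> norm (G n E) < e/4" for n
  proof -
    obtain d' where d': "0 < d'" "\<And>E. E \<in> sets M \<Longrightarrow> measure M E < d' \<Longrightarrow> (LINT x|M. norm (indicator E x *\<^sub>R h n x)) < e/4"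
      using integral_indicator_small[OF h, of "e/4" n] e by auto
    show ?thesis
    proof (intro exI[of _ d'] conjI ballI impI)
      fix E assume "E \<in> sets M" "measure M E < d'"
      then show "norm (G n E) < e/4"
        unfolding G_def by (intro le_less_trans[OF integral_norm_bound] d'(2))
    qed (rule d'(1))
  qed
  then obtain dd where dd: "\<And>n. dd n > 0" "\<And>n E. E \<in> sets M \<Longrightarrow> measure M E < dd n \<Longrightarrow> norm (G n E) < e/4"
    by metis
  \<comment> \<open>The radius \<open>d\<close> serves the indices beyond \<open>N\<close>; the
    finitely many indices up to \<open>N\<close> are covered by absolute continuity of each single
    integral.\<close>
  define d' where "d' = min d (Min (dd ` {..N}))"
  have d': "d' > 0" "d' \<le> d" "\<And>n. n \<le> N \<Longrightarrow> d' \<le> dd n"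
    using A dd by (auto simp: d'_def min.coboundedI2)
  have "norm (G n E) < e" if E: "E \<in> sets M" "measure M E < d'" for n E
  proof (cases "n \<le> N")
    case True then show ?thesis using dd(2)[OF E(1), of n] d'(3)[OF True] E e by auto
  next
    case False
    \<comment> \<open>A small set \<open>E\<close> is the difference of two sets close to
      \<open>A\<close>. This transports the estimate from the ball around \<open>A\<close> to a
      neighbourhood of the empty set.\<close>
    have GE: "G k E = G k (A \<union> E) - G k (A - E)" for k
    proof -
      have "G k (A \<union> E) - G k (A - E) = (LINT x|M. indicator (A \<union> E) x *\<^sub>R h k x - indicator (A - E) x *\<^sub>R h k x)"
        unfolding G_def using A E by (intro Bochner_Integration.integral_diff[symmetric] int) auto
      also have "\<dots> = G k E"
        unfolding G_def by (intro Bochner_Integration.integral_cong) (auto split: split_indicator)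
      finally show ?thesis by simp
    qed
    have rr: "r A (A \<union> E) < d" "r A (A - E) < d"
    proof -
      have "r A (A \<union> E) \<le> measure M E" "r A (A - E) \<le> measure M E"
        unfolding r_def using A E by (auto intro!: finite_measure_mono)
      then show "r A (A \<union> E) < d" "r A (A - E) < d" using E d' by auto
    qed
    have b: "norm (G n D - G N D) \<le> e/4" if "D \<in> sets M" "r A D < d" for D
      using A(3)[OF that] False by (force simp: bad_def not_less)
    have "G n E = (G n (A \<union> E) - G N (A \<union> E)) - (G n (A - E) - G N (A - E)) + G N E"
      by (simp add: GE)
    then have "norm (G n E) \<le> norm (G n (A \<union> E) - G N (A \<union> E)) + norm (G n (A - E) - G N (A - E)) + norm (G N E)"
      using norm_diff_add_le by metis
    moreover have "norm (G N E) < e/4" using dd(2)[OF E(1), of N] d'(3)[of N] E by auto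
    ultimately show ?thesis using b[OF _ rr(1)] b[OF _ rr(2)] A E e by auto
  qed
  then show ?thesis using d'(1) that by (auto simp: G_def)
qed

section \<open>Densities of countably additive set functions\<close>

lemma disjoint_family_UN_Int:
  assumes "disjoint_family A" "I \<inter> J = {}"
  shows "(\<Union>i\<in>I. A i) \<inter> (\<Union>i\<in>J. A i) = {}"
proof -
  have "A i \<inter> A j = {}" if "i \<in> I" "j \<in> J" for i j
    using assms that by (intro disjoint_family_onD[of A UNIV]) auto
  then show ?thesis by blast
qed

lemma (in finite_measure) Radon_Nikodym_nonneg_set_function:
  fixes \<nu> :: "'a set \<Rightarrow> real"
  assumes sums: "\<And>A. range A \<subseteq> sets M \<Longrightarrow> disjoint_family A \<Longrightarrow> (\<lambda>i. \<nu> (A i)) sums \<nu> (\<Union>i. A i)"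
    and null: "\<And>A. A \<in> null_sets M \<Longrightarrow> \<nu> A = 0"
    and nonneg: "\<And>A. A \<in> sets M \<Longrightarrow> 0 \<le> \<nu> A"
  obtains g :: "'a \<Rightarrow> real" where "integrable M g" "\<And>E. E \<in> sets M \<Longrightarrow> (LINT x|M. indicator E x *\<^sub>R g x) = \<nu> E"
proof -
  define N where "N = measure_of (space M) (sets M) (\<lambda>A. ennreal (\<nu> A))"
  have [simp]: "sets N = sets M" by (simp add: N_def)
  have emN: "emeasure N A = ennreal (\<nu> A)" if "A \<in> sets M" for A
    unfolding N_def
  proof (rule emeasure_measure_of_sigma[OF sets.sigma_algebra_axioms _ _ that])
    show "positive (sets M) (\<lambda>A. ennreal (\<nu> A))" using null by (simp add: positive_def)
    show "countably_additive (sets M) (\<lambda>A. ennreal (\<nu> A))"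
    proof (rule countably_additiveI)
      fix A :: "nat \<Rightarrow> 'a set" assume A: "range A \<subseteq> sets M" "disjoint_family A"
      show "(\<Sum>i. ennreal (\<nu> (A i))) = ennreal (\<nu> (\<Union>i. A i))"
        using A by (intro suminf_ennreal_eq[OF nonneg sums]) auto
    qed
  qed
  interpret N: finite_measure N
    by standard (use emN[OF sets.top] sets_eq_imp_space_eq[of N M] in auto)
  have "absolutely_continuous M N"
    using emN null by (auto simp: absolutely_continuous_def null_sets_def)
  then obtain f where f[measurable]: "f \<in> borel_measurable M" "density M f = N"
    using Radon_Nikodym_finite_measure[OF N.finite_measure_axioms] by auto
  have fE: "(\<integral>\<^sup>+x. f x * indicator E x \<partial>M) = ennreal (\<nu> E)" if "E \<in> sets M" for E
    using that emN[OF that] f by (metis emeasure_density)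
  have "(\<integral>\<^sup>+x. f x \<partial>M) = ennreal (\<nu> (space M))"
    using fE[of "space M"] by (simp cong: nn_integral_cong)
  then have fin: "AE x in M. f x \<noteq> \<infinity>"
    by (intro nn_integral_PInf_AE) auto
  define g where "g x = enn2real (f x)" for x
  have [measurable]: "g \<in> borel_measurable M" unfolding g_def by measurable
  have gf: "AE x in M. ennreal (g x) = f x"
    using fin by eventually_elim (simp add: g_def less_top)
  have gE: "(\<integral>\<^sup>+x. ennreal (indicator E x *\<^sub>R g x) \<partial>M) = ennreal (\<nu> E)" if "E \<in> sets M" for E
  proof -
    have "(\<integral>\<^sup>+x. ennreal (indicator E x *\<^sub>R g x) \<partial>M) = (\<integral>\<^sup>+x. f x * indicator E x \<partial>M)"
      using gf by (intro nn_integral_cong_AE, eventually_elim) (auto split: split_indicator)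
    then show ?thesis using fE[OF that] by simp
  qed
  show ?thesis
  proof (rule that)
    have "(\<integral>\<^sup>+x. ennreal (g x) \<partial>M) = ennreal (\<nu> (space M))"
      using gE[of "space M"] by (simp cong: nn_integral_cong)
    then show "integrable M g" by (intro integrableI_nonneg) (auto simp: g_def)
    show "(LINT x|M. indicator E x *\<^sub>R g x) = \<nu> E" if "E \<in> sets M" for E
      using gE[OF that] nonneg[OF that] that by (subst integral_eq_nn_integral) (auto simp: g_def)
  qed
qed

text \<open>Jordan decomposition: the positive variation \<open>pos\<close> is a supremum made
  finite by the upper bound \<open>K\<close>, and \<open>\<nu>\<close> is the difference of the
  nonnegative set functions \<open>pos\<close> and \<open>pos - \<nu>\<close>, each of which has a
  density.\<close>

lemma (in finite_measure) Radon_Nikodym_signed_set_function: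
  fixes \<nu> :: "'a set \<Rightarrow> real"
  assumes sums: "\<And>A. range A \<subseteq> sets M \<Longrightarrow> disjoint_family A \<Longrightarrow> (\<lambda>i. \<nu> (A i)) sums \<nu> (\<Union>i. A i)"
    and null: "\<And>A. A \<in> null_sets M \<Longrightarrow> \<nu> A = 0"
    and bound: "\<And>A. A \<in> sets M \<Longrightarrow> \<nu> A \<le> K"
  obtains g :: "'a \<Rightarrow> real" where "integrable M g" "\<And>E. E \<in> sets M \<Longrightarrow> (LINT x|M. indicator E x *\<^sub>R g x) = \<nu> E"
proof -
  define pos where "pos E = (SUP A\<in>{A\<in>sets M. A \<subseteq> E}. \<nu> A)" for E
  have e0: "\<nu> {} = 0" by (rule null) simp
  have bdd: "bdd_above (\<nu> ` {A \<in> sets M. A \<subseteq> E})" for E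
    using bound by (auto intro!: bdd_aboveI)
  have ub: "\<nu> A \<le> pos E" if "A \<in> sets M" "A \<subseteq> E" for A E
    unfolding pos_def using that by (intro cSUP_upper bdd) auto
  have lub: "pos E \<le> c" if "\<And>A. A \<in> sets M \<Longrightarrow> A \<subseteq> E \<Longrightarrow> \<nu> A \<le> c" for E c
    unfolding pos_def using that by (intro cSUP_least) auto
  have pos0: "0 \<le> pos E" for E using ub[of "{}" E] e0 by auto
  have posK: "pos E \<le> K" for E by (rule lub) (use bound in auto)
  have add: "\<nu> (A \<union> B) = \<nu> A + \<nu> B" if "A \<in> sets M" "B \<in> sets M" "A \<inter> B = {}" for A B
  proof -
    have "(\<lambda>i. \<nu> (binaryset A B i)) sums \<nu> (\<Union>i. binaryset A B i)"
      by (rule sums) (use that in \<open>auto simp: range_binaryset_eq disjoint_family_on_def binaryset_def\<close>)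
    moreover have "(\<lambda>i. \<nu> (binaryset A B i)) sums (\<nu> A + \<nu> B)"
      using binaryset_sums[of \<nu> A B] e0 by simp
    ultimately show ?thesis by (simp add: UN_binaryset_eq sums_iff)
  qed
  \<comment> \<open>Superadditivity bounds the partial sums in \<open>pos_sums\<close> from above;
    the reverse inequality there comes from cutting a competitor along the sets
    \<open>A i\<close>.\<close>
  have super: "pos A + pos B \<le> pos (A \<union> B)" if "A \<inter> B = {}" for A B
  proof -
    have "pos B \<le> pos (A \<union> B) - pos A"
    proof (rule lub)
      fix B' assume B': "B' \<in> sets M" "B' \<subseteq> B"
      have "pos A \<le> pos (A \<union> B) - \<nu> B'"
      proof (rule lub)
        fix A' assume A': "A' \<in> sets M" "A' \<subseteq> A"
        have "\<nu> A' + \<nu> B' = \<nu> (A' \<union> B')"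
          using that A' B' by (subst add) auto
        also have "\<dots> \<le> pos (A \<union> B)" using A' B' by (intro ub) auto
        finally show "\<nu> A' \<le> pos (A \<union> B) - \<nu> B'" by simp
      qed
      then show "\<nu> B' \<le> pos (A \<union> B) - pos A" by simp
    qed
    then show ?thesis by simp
  qed
  have mono: "pos A \<le> pos B" if "A \<subseteq> B" for A B
    by (rule lub) (use that in \<open>auto intro: ub\<close>)
  have pos_sums: "(\<lambda>i. pos (A i)) sums pos (\<Union>i. A i)"
    if A: "range A \<subseteq> sets M" "disjoint_family A" for A :: "nat \<Rightarrow> 'a set"
  proof -
    have fin: "(\<Sum>i<n. pos (A i)) \<le> pos (\<Union>i<n. A i)" for n
    proof (induction n)
      case 0 then show ?case using pos0 by simp
    next
      case (Suc n)
      have "pos (\<Union>i<n. A i) + pos (A n) \<le> pos ((\<Union>i<n. A i) \<union> A n)"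
        using disjoint_family_UN_Int[OF A(2), of "{..<n}" "{n}"] by (intro super) auto
      moreover have "(\<Union>i<n. A i) \<union> A n = (\<Union>i<Suc n. A i)" by (auto simp: less_Suc_eq)
      ultimately show ?case using Suc by simp
    qed
    have le: "(\<Sum>i<n. pos (A i)) \<le> pos (\<Union>i. A i)" for n
      using fin[of n] mono[of "\<Union>i<n. A i" "\<Union>i. A i"] by fastforce
    have summ: "summable (\<lambda>i. pos (A i))"
      using pos0 le by (rule summableI_nonneg_bounded)
    have "pos (\<Union>i. A i) \<le> (\<Sum>i. pos (A i))"
    proof (rule lub)
      fix B assume B: "B \<in> sets M" "B \<subseteq> (\<Union>i. A i)"
      have s: "(\<lambda>i. \<nu> (B \<inter> A i)) sums \<nu> (\<Union>i. B \<inter> A i)"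
        using A B by (intro sums) (auto simp: disjoint_family_on_def)
      have "\<nu> B = (\<Sum>i. \<nu> (B \<inter> A i))"
        using s B by (simp add: sums_iff Int_absorb2 flip: Int_UN_distrib)
      also have "\<dots> \<le> (\<Sum>i. pos (A i))"
        using s summ A B by (intro suminf_le ub) (auto simp: sums_iff)
      finally show "\<nu> B \<le> (\<Sum>i. pos (A i))" .
    qed
    moreover have "(\<Sum>i. pos (A i)) \<le> pos (\<Union>i. A i)"
      using summ le by (rule suminf_le_const)
    ultimately show ?thesis using summ by (simp add: sums_iff)
  qed
  have pos_null: "pos A = 0" if "A \<in> null_sets M" for A
  proof (rule antisym[OF lub pos0])
    fix B assume "B \<in> sets M" "B \<subseteq> A"
    then show "\<nu> B \<le> 0" using null[of B] null_sets_subset[OF that] by auto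
  qed
  obtain g1 where g1: "integrable M g1" "\<And>E. E \<in> sets M \<Longrightarrow> (LINT x|M. indicator E x *\<^sub>R g1 x) = pos E"
    using Radon_Nikodym_nonneg_set_function[of pos] pos_sums pos_null pos0 by blast
  obtain g2 where g2: "integrable M g2" "\<And>E. E \<in> sets M \<Longrightarrow> (LINT x|M. indicator E x *\<^sub>R g2 x) = pos E - \<nu> E"
  proof (rule Radon_Nikodym_nonneg_set_function[of "\<lambda>E. pos E - \<nu> E"])
    show "(\<lambda>i. pos (A i) - \<nu> (A i)) sums (pos (\<Union> (range A)) - \<nu> (\<Union> (range A)))"
      if "range A \<subseteq> sets M" "disjoint_family A" for A :: "nat \<Rightarrow> 'a set"
      using that by (intro sums_diff pos_sums sums)
  qed (use pos_null null ub in auto)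
  show ?thesis
  proof (rule that[of "\<lambda>x. g1 x - g2 x"])
    fix E assume E: "E \<in> sets M"
    show "(LINT x|M. indicator E x *\<^sub>R (g1 x - g2 x)) = \<nu> E"
      unfolding scaleR_diff_right using E g1 g2
      by (subst Bochner_Integration.integral_diff) (auto intro: integrable_mult_indicator simp del: real_scaleR_def)
  qed (use g1 g2 in auto)
qed

lemma (in finite_measure) Radon_Nikodym_complex_set_function:
  fixes \<nu> :: "'a set \<Rightarrow> complex"
  assumes sums: "\<And>A. range A \<subseteq> sets M \<Longrightarrow> disjoint_family A \<Longrightarrow> (\<lambda>i. \<nu> (A i)) sums \<nu> (\<Union>i. A i)"
    and null: "\<And>A. A \<in> null_sets M \<Longrightarrow> \<nu> A = 0"
    and bound: "\<And>A. A \<in> sets M \<Longrightarrow> norm (\<nu> A) \<le> K"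
  obtains g where "integrable M g" "\<And>E. E \<in> sets M \<Longrightarrow> (LINT x|M. indicator E x *\<^sub>R g x) = \<nu> E"
proof -
  obtain a where a: "integrable M a" "\<And>E. E \<in> sets M \<Longrightarrow> (LINT x|M. indicator E x *\<^sub>R a x) = Re (\<nu> E)"
  proof (rule Radon_Nikodym_signed_set_function[of "\<lambda>E. Re (\<nu> E)" K])
    show "Re (\<nu> A) \<le> K" if "A \<in> sets M" for A
      using bound[OF that] complex_Re_le_cmod order_trans by blast
  qed (use sums null in \<open>auto intro: sums_Re\<close>)
  obtain b where b: "integrable M b" "\<And>E. E \<in> sets M \<Longrightarrow> (LINT x|M. indicator E x *\<^sub>R b x) = Im (\<nu> E)"
  proof (rule Radon_Nikodym_signed_set_function[of "\<lambda>E. Im (\<nu> E)" K])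
    show "Im (\<nu> A) \<le> K" if "A \<in> sets M" for A
      using bound[OF that] abs_Im_le_cmod[of "\<nu> A"] by linarith
  qed (use sums null in \<open>auto intro: sums_Im\<close>)
  show ?thesis
  proof (rule that)
    let ?g = "\<lambda>x. of_real (a x) + \<i> * of_real (b x)"
    show int: "integrable M ?g" using a b by auto
    fix E assume E: "E \<in> sets M"
    have "integrable M (\<lambda>x. indicator E x *\<^sub>R ?g x)" using E int by (rule integrable_mult_indicator)
    then show "(LINT x|M. indicator E x *\<^sub>R ?g x) = \<nu> E"
      using a(2)[OF E] b(2)[OF E] by (simp add: complex_eq_iff flip: integral_Re integral_Im)
  qed
qed

text \<open>The factor 4 counts the positive and negative parts of the real and of the imaginary
  part, each of them controlled by one set integral.\<close>

lemma integral_norm_le_of_set_integrals: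
  fixes h :: "'a \<Rightarrow> complex"
  assumes h: "integrable M h"
    and K: "\<And>E. E \<in> sets M \<Longrightarrow> norm (LINT x|M. indicator E x *\<^sub>R h x) \<le> K"
  shows "(LINT x|M. norm (h x)) \<le> 4 * K"
proof -
  have [measurable]: "h \<in> borel_measurable M" using h by simp
  have *: "(LINT x|M. \<bar>g x\<bar>) \<le> 2 * K"
    if g: "integrable M g" and gK: "\<And>E. E \<in> sets M \<Longrightarrow> \<bar>LINT x|M. indicator E x *\<^sub>R g x\<bar> \<le> K" for g :: "'a \<Rightarrow> real"
  proof -
    let ?A = "{x\<in>space M. 0 \<le> g x}" and ?B = "{x\<in>space M. g x < 0}"
    have [measurable]: "g \<in> borel_measurable M" using g by simp
    have AB: "?A \<in> sets M" "?B \<in> sets M" by measurable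
    have "(LINT x|M. \<bar>g x\<bar>) = (LINT x|M. indicator ?A x *\<^sub>R g x - indicator ?B x *\<^sub>R g x)"
      by (intro Bochner_Integration.integral_cong) (auto split: split_indicator)
    also have "\<dots> = (LINT x|M. indicator ?A x *\<^sub>R g x) - (LINT x|M. indicator ?B x *\<^sub>R g x)"
      using g AB by (intro Bochner_Integration.integral_diff integrable_mult_indicator)
    also have "\<dots> \<le> 2 * K" using gK[OF AB(1)] gK[OF AB(2)] by linarith
    finally show ?thesis .
  qed
  have ih: "integrable M (\<lambda>x. indicator E x *\<^sub>R h x)" if "E \<in> sets M" for E
    using that h by (rule integrable_mult_indicator)
  have "\<bar>LINT x|M. indicator E x *\<^sub>R Re (h x)\<bar> \<le> K" "\<bar>LINT x|M. indicator E x *\<^sub>R Im (h x)\<bar> \<le> K"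
    if "E \<in> sets M" for E
    using K[OF that] integral_Re[OF ih[OF that]] integral_Im[OF ih[OF that]]
      abs_Re_le_cmod[of "LINT x|M. indicator E x *\<^sub>R h x"] abs_Im_le_cmod[of "LINT x|M. indicator E x *\<^sub>R h x"]
    by simp_all
  then have "(LINT x|M. \<bar>Re (h x)\<bar>) \<le> 2 * K" "(LINT x|M. \<bar>Im (h x)\<bar>) \<le> 2 * K"
    using h by (auto intro!: *)
  moreover have "(LINT x|M. norm (h x)) \<le> (LINT x|M. \<bar>Re (h x)\<bar> + \<bar>Im (h x)\<bar>)"
    using h by (intro integral_mono) (auto simp: cmod_le)
  ultimately show ?thesis using h by (subst (asm) Bochner_Integration.integral_add) auto
qed

text \<open>Vitali--Hahn--Saks gives a smallness threshold valid for all \<open>n\<close>. Together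
  with \<open>cover\<close> it yields a uniform L1-bound, and it makes the limit set function
  countably additive, so that the limit has a density.\<close>

lemma (in finite_measure) L1_weakly_sequentially_complete:
  fixes h :: "nat \<Rightarrow> 'a \<Rightarrow> complex"
  assumes cover: "\<And>d. 0 < d \<Longrightarrow> \<exists>\<A>. finite \<A> \<and> \<A> \<subseteq> sets M \<and> space M \<subseteq> \<Union>\<A> \<and> (\<forall>A\<in>\<A>. measure M A < d)"
    and h: "\<And>n. integrable M (h n)"
    and C: "\<And>E. E \<in> sets M \<Longrightarrow> Cauchy (\<lambda>n. LINT x|M. indicator E x *\<^sub>R h n x)"
  obtains f K where "integrable M f" 
    "\<And>E. E \<in> sets M \<Longrightarrow> (\<lambda>n. LINT x|M. indicator E x *\<^sub>R h n x) \<longlonglongrightarrow> (LINT x|M. indicator E x *\<^sub>R f x)"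
    "\<And>n. (LINT x|M. norm (h n x)) \<le> K"
proof -
  define G where "G n E = (LINT x|M. indicator E x *\<^sub>R h n x)" for n E
  have int: "integrable M (\<lambda>x. indicator E x *\<^sub>R h n x)" if "E \<in> sets M" for n E
    using that h by (rule integrable_mult_indicator)
  have Gadd: "G n (A \<union> B) = G n A + G n B" if "A \<in> sets M" "B \<in> sets M" "A \<inter> B = {}" for n A B
  proof -
    have "G n A + G n B = (LINT x|M. indicator A x *\<^sub>R h n x + indicator B x *\<^sub>R h n x)"
      unfolding G_def using that by (intro Bochner_Integration.integral_add[symmetric] int)
    also have "\<dots> = G n (A \<union> B)"
      unfolding G_def using that(3) by (intro Bochner_Integration.integral_cong) (auto split: split_indicator)
    finally show ?thesis by simp
  qed
  \<comment> \<open>With tolerance 1 every member of the cover contributes less than 1, so the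
    number of members bounds the integral over any set.\<close>
  obtain d1 where d1: "0 < d1" "\<And>E n. E \<in> sets M \<Longrightarrow> measure M E < d1 \<Longrightarrow> norm (G n E) < 1"
    using Vitali_Hahn_Saks[OF h C, of 1] unfolding G_def by auto
  obtain \<A> where A: "finite \<A>" "\<A> \<subseteq> sets M" "space M \<subseteq> \<Union>\<A>" "\<forall>A\<in>\<A>. measure M A < d1"
    using cover[OF d1(1)] by auto
  have K: "norm (G n E) \<le> card \<A>" if E: "E \<in> sets M" for n E
  proof -
    have "norm (G n (E \<inter> \<Union>\<B>)) \<le> card \<B>" if "finite \<B>" "\<B> \<subseteq> \<A>" for \<B>
      using that
    proof (induction \<B>)
      case empty then show ?case by (simp add: G_def)
    next
      case (insert B \<B>)
      have BS: "B \<in> sets M" "\<B> \<subseteq> sets M" "measure M B < d1" using insert A by auto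
      have US: "\<Union>\<B> \<in> sets M" using BS insert(1) by (intro sets.finite_Union) auto
      have "norm (G n (E \<inter> B - \<Union>\<B>)) < 1"
      proof (rule d1(2))
        show "E \<inter> B - \<Union>\<B> \<in> sets M" using BS US E by auto
        have "measure M (E \<inter> B - \<Union>\<B>) \<le> measure M B"
          using BS by (intro finite_measure_mono) auto
        then show "measure M (E \<inter> B - \<Union>\<B>) < d1" using BS by simp
      qed
      moreover have "G n (E \<inter> \<Union>(insert B \<B>)) = G n (E \<inter> \<Union>\<B>) + G n (E \<inter> B - \<Union>\<B>)"
        using BS US E by (subst Gadd[symmetric]) (auto intro!: arg_cong[where f="G n"])
      moreover have "norm (G n (E \<inter> \<Union>\<B>)) \<le> card \<B>" using insert by auto
      ultimately show ?case using insert(1,2)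
        norm_triangle_ineq[of "G n (E \<inter> \<Union>\<B>)" "G n (E \<inter> B - \<Union>\<B>)"] by auto
    qed
    from this[OF A(1) order_refl] show ?thesis
      using A(3) sets.sets_into_space[OF E] by (simp add: Int_absorb2)
  qed
  define \<nu> where "\<nu> E = lim (\<lambda>n. G n E)" for E
  have lim: "(\<lambda>n. G n E) \<longlonglongrightarrow> \<nu> E" if "E \<in> sets M" for E
    unfolding \<nu>_def using C[OF that] by (simp add: G_def Cauchy_convergent_iff convergent_LIMSEQ_iff)
  have \<nu>add: "\<nu> (A \<union> B) = \<nu> A + \<nu> B" if "A \<in> sets M" "B \<in> sets M" "A \<inter> B = {}" for A B
  proof (rule LIMSEQ_unique)
    show "(\<lambda>n. G n (A \<union> B)) \<longlonglongrightarrow> \<nu> (A \<union> B)" using that by (intro lim) auto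
    show "(\<lambda>n. G n (A \<union> B)) \<longlonglongrightarrow> \<nu> A + \<nu> B"
      unfolding Gadd[OF that] using that by (intro tendsto_add lim)
  qed
  have \<nu>K: "norm (\<nu> E) \<le> card \<A>" if "E \<in> sets M" for E
    using K[OF that] by (intro Lim_bounded[OF tendsto_norm[OF lim[OF that]], of 0]) auto
  have null: "\<nu> E = 0" if "E \<in> null_sets M" for E
  proof (rule LIMSEQ_unique[OF lim])
    have "G n E = 0" for n unfolding G_def
    proof (rule integral_eq_zero_AE)
      show "AE x in M. indicator E x *\<^sub>R h n x = 0"
        using AE_not_in[OF that] by eventually_elim simp
    qed
    then show "(\<lambda>n. G n E) \<longlonglongrightarrow> 0" by simp
  qed (use that in auto)
  have sums: "(\<lambda>i. \<nu> (A i)) sums \<nu> (\<Union>i. A i)" if A: "range A \<subseteq> sets M" "disjoint_family A" for A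
  proof -
    \<comment> \<open>By finite additivity it remains to show that \<open>\<nu>\<close> tends to 0
      on the tails. They decrease to the empty set, and the threshold is uniform in the index of the
      integrals, so it survives the passage to the limit \<open>\<nu>\<close>.\<close>
    let ?T = "\<lambda>n. \<Union>i\<in>{n..}. A i"
    have AM: "A i \<in> sets M" for i using A by auto
    have split: "(\<Sum>i<n. \<nu> (A i)) = \<nu> (\<Union>i<n. A i)" for n
    proof (induction n)
      case 0 then show ?case using null[of "{}"] by simp
    next
      case (Suc n)
      have "\<nu> ((\<Union>i<n. A i) \<union> A n) = \<nu> (\<Union>i<n. A i) + \<nu> (A n)"
        using disjoint_family_UN_Int[OF A(2), of "{..<n}" "{n}"] AM by (intro \<nu>add) auto
      moreover have "(\<Union>i<n. A i) \<union> A n = (\<Union>i<Suc n. A i)" by (auto simp: less_Suc_eq)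
      ultimately show ?case using Suc by simp
    qed
    have tail: "\<nu> (\<Union>i. A i) = (\<Sum>i<n. \<nu> (A i)) + \<nu> (?T n)" for n
    proof -
      have "{..<n} \<union> {n..} = (UNIV :: nat set)" by auto
      then have "(\<Union>i. A i) = (\<Union>i\<in>{..<n} \<union> {n..}. A i)" by simp
      then have "(\<Union>i. A i) = (\<Union>i<n. A i) \<union> ?T n" by (simp only: UN_Un)
      moreover have "\<nu> ((\<Union>i<n. A i) \<union> ?T n) = \<nu> (\<Union>i<n. A i) + \<nu> (?T n)"
        using AM by (intro \<nu>add disjoint_family_UN_Int[OF A(2)]) auto
      ultimately show ?thesis using split by simp
    qed
    have "(\<lambda>n. measure M (?T n)) \<longlonglongrightarrow> measure M (\<Inter>n. ?T n)"
      using AM by (intro finite_Lim_measure_decseq) (auto simp: decseq_def intro: order_trans)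
    moreover have "(\<Inter>n. ?T n) = {}"
    proof -
      have "x \<notin> (\<Inter>n. ?T n)" for x
      proof
        assume x: "x \<in> (\<Inter>n. ?T n)"
        then obtain i where i: "x \<in> A i" by blast
        from x obtain j where "j \<ge> Suc i" "x \<in> A j" by blast
        then show False using i disjoint_family_onD[OF A(2), of i j] by auto
      qed
      then show ?thesis by blast
    qed
    ultimately have mT: "(\<lambda>n. measure M (?T n)) \<longlonglongrightarrow> 0" by simp
    have "(\<lambda>n. \<nu> (?T n)) \<longlonglongrightarrow> 0"
    proof (rule tendstoI)
      fix e :: real assume e: "0 < e"
      obtain d where d: "0 < d" "\<And>E n. E \<in> sets M \<Longrightarrow> measure M E < d \<Longrightarrow> norm (G n E) < e/2"
        using Vitali_Hahn_Saks[OF h C, of "e/2"] e unfolding G_def by auto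
      have "\<forall>\<^sub>F n in sequentially. measure M (?T n) < d"
        using mT d by (intro order_tendstoD)
      then show "\<forall>\<^sub>F n in sequentially. dist (\<nu> (?T n)) 0 < e"
      proof eventually_elim
        case (elim n)
        have TM: "?T n \<in> sets M" using AM by auto
        have "norm (\<nu> (?T n)) \<le> e/2"
          using d(2)[OF TM elim] by (intro Lim_bounded[OF tendsto_norm[OF lim[OF TM]], of 0]) (auto intro: less_imp_le)
        then show ?case using e by simp
      qed
    qed
    then have "(\<lambda>n. \<nu> (\<Union>i. A i) - \<nu> (?T n)) \<longlonglongrightarrow> \<nu> (\<Union>i. A i) - 0"
      by (intro tendsto_diff tendsto_const)
    moreover have "\<nu> (\<Union>i. A i) - \<nu> (?T n) = (\<Sum>i<n. \<nu> (A i))" for n using tail[of n] by simp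
    ultimately show ?thesis by (simp add: sums_def)
  qed
  obtain f where f: "integrable M f" "\<And>E. E \<in> sets M \<Longrightarrow> (LINT x|M. indicator E x *\<^sub>R f x) = \<nu> E"
    using Radon_Nikodym_complex_set_function[OF sums null \<nu>K] by blast
  show ?thesis
  proof (rule that[OF f(1)])
    show "(\<lambda>n. LINT x|M. indicator E x *\<^sub>R h n x) \<longlonglongrightarrow> (LINT x|M. indicator E x *\<^sub>R f x)"
      if "E \<in> sets M" for E using lim[OF that] f(2)[OF that] by (simp add: G_def)
    show "(LINT x|M. norm (h n x)) \<le> 4 * real (card \<A>)" for n
      using K by (intro integral_norm_le_of_set_integrals h) (auto simp: G_def)
  qed
qed

section \<open>The circle and its trigonometric polynomials\<close>

abbreviation \<mu> :: "complex measure" where "\<mu> \<equiv> circle_measure"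

abbreviation circle_borel :: "(complex \<Rightarrow> 'b::topological_space) set" where
  "circle_borel \<equiv> borel_measurable \<mu>"

interpretation circle: finite_measure \<mu>
  by standard (simp add: emeasure_circle_measure)

lemma measure_circle_sphere [simp]: "measure \<mu> (sphere 0 1) = 1"
  by (simp add: measure_def emeasure_circle_measure)

lemma AE_circle: "AE z in \<mu>. z \<in> sphere 0 1"
  using AE_space[of \<mu>] by simp

lemma circle_borelI: "f \<in> borel_measurable borel \<Longrightarrow> f \<in> circle_borel"
  by (simp add: measurable_cong_sets[OF sets_circle_measure refl] measurable_restrict_space1)

lemma circle_borel_continuous: "continuous_on (sphere 0 1) f \<Longrightarrow> f \<in> circle_borel"
  by (simp add: measurable_cong_sets[OF sets_circle_measure refl] borel_measurable_continuous_on_restrict)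

lemma circle_borel_ident: "(\<lambda>z. z) \<in> circle_borel"
  by (rule circle_borelI) simp

lemma sets_circle_Int: "A \<in> sets borel \<Longrightarrow> sphere 0 1 \<inter> A \<in> sets \<mu>"
  by (auto simp: sets_circle_measure sets_restrict_space)

lemma sets_circle_eq: "sets \<mu> = (\<lambda>A. sphere 0 1 \<inter> A) ` sets borel"
  by (simp add: sets_circle_measure sets_restrict_space)

lemma measurable_cis_circle:
  "cis \<in> uniform_measure lborel {0..2*pi} \<rightarrow>\<^sub>M restrict_space borel (sphere 0 1)"
proof -
  have "cis \<in> borel_measurable borel"
    by (intro borel_measurable_continuous_onI continuous_intros)
  then have "cis \<in> borel_measurable (uniform_measure lborel {0..2*pi})"
    by (simp cong: measurable_cong_sets)
  then show ?thesis by (intro measurable_restrict_space2) auto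
qed

lemma integrable_bounded_circle:
  fixes f :: "complex \<Rightarrow> 'b::{banach, second_countable_topology}"
  assumes "f \<in> circle_borel" "AE z in \<mu>. norm (f z) \<le> C"
  shows "integrable \<mu> f"
  using assms circle.integrable_const_bound by blast

lemma integral_circle:
  fixes f :: "complex \<Rightarrow> 'b::euclidean_space"
  assumes "f \<in> borel_measurable borel"
  shows "(LINT z|\<mu>. f z) =
    (LINT t|lborel. indicator {0..2*pi} t *\<^sub>R f (cis t)) /\<^sub>R (2 * pi)"
proof -
  have [measurable]: "(\<lambda>t. f (cis t)) \<in> borel_measurable borel"
    by (intro measurable_compose[OF _ assms] borel_measurable_continuous_onI continuous_intros)
  have "uniform_measure lborel {0..2*pi} =
      density lborel (\<lambda>t. ennreal (indicator {0..2*pi} t / (2*pi)))"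
    unfolding uniform_measure_def
    by (intro arg_cong2[where f=density] ext)
       (auto split: split_indicator simp: divide_ennreal ennreal_1[symmetric] simp del: ennreal_1)
  then have "(LINT z|\<mu>. f z) =
      (LINT t|lborel. (indicator {0..2*pi} t / (2*pi)) *\<^sub>R f (cis t))"
    unfolding circle_measure_def
    by (subst integral_distr[OF measurable_cis_circle])
       (use assms in \<open>auto simp: integral_density measurable_restrict_space1\<close>)
  also have "\<dots> = (LINT t|lborel. (indicator {0..2*pi} t *\<^sub>R f (cis t)) /\<^sub>R (2*pi))"
    by (intro Bochner_Integration.integral_cong) (auto split: split_indicator simp: inverse_eq_divide)
  also have "\<dots> = (LINT t|lborel. indicator {0..2*pi} t *\<^sub>R f (cis t)) /\<^sub>R (2*pi)"
    by (rule integral_scaleR_right)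
  finally show ?thesis .
qed

lemma integral_circle_power:
  assumes "0 < k" shows "(LINT z|\<mu>. z ^ k) = 0"
proof -
  have "(LINT t|lborel. indicator {0..2*pi} t *\<^sub>R cis (real k * t)) =
      cis (real k * (2*pi)) / (\<i> * of_nat k) - cis (real k * 0) / (\<i> * of_nat k)"
  proof (rule integral_FTC_atLeastAtMost)
    fix t :: real
    show "((\<lambda>t. cis (real k * t) / (\<i> * of_nat k)) has_vector_derivative cis (real k * t)) (at t within {0..2*pi})"
    proof -
      have "((\<lambda>w. exp (\<i> * of_nat k * w) / (\<i> * of_nat k)) has_field_derivative exp (\<i> * of_nat k * of_real t)) (at (of_real t))"
        using assms by (auto intro!: derivative_eq_intros)
      from has_vector_derivative_real_field[OF this, of "{0..2*pi}"] show ?thesis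
        by (simp add: cis_conv_exp mult.assoc)
    qed
  qed (auto intro!: continuous_intros)
  also have "\<dots> = 0"
    using cis_multiple_2pi[of "real k"] by (simp add: mult.commute)
  finally show ?thesis
    by (subst integral_circle) (auto simp: Complex.DeMoivre intro: borel_measurable_continuous_onI continuous_intros)
qed

text \<open>Arcs of angle \<open>2 * pi / n\<close> serve; this is the point at which the absence of
  atoms enters.\<close>

lemma circle_cover:
  assumes "0 < d"
  shows "\<exists>\<A>. finite \<A> \<and> \<A> \<subseteq> sets \<mu> \<and> space \<mu> \<subseteq> \<Union>\<A> \<and>
    (\<forall>A\<in>\<A>. measure \<mu> A < d)"
proof -
  obtain n where n: "0 < n" "1 / real n < d"
    using assms by (metis inverse_eq_divide reals_Archimedean zero_less_Suc)
  define I where "I j = {2*pi*real j/real n..2*pi*(real j+1)/real n}" for j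
  have cl: "cis ` I j \<in> sets \<mu>" for j
  proof -
    have "compact (cis ` I j)"
      unfolding I_def by (intro compact_continuous_image continuous_intros compact_Icc)
    then have "sphere 0 1 \<inter> cis ` I j \<in> sets \<mu>"
      by (intro sets_circle_Int borel_compact)
    moreover have "sphere 0 1 \<inter> cis ` I j = cis ` I j" by auto
    ultimately show ?thesis by simp
  qed
  have m: "measure \<mu> (cis ` I j) \<le> 1 / real n" if "j < n" for j
  proof -
    \<comment> \<open>\<open>cis\<close> identifies 0 and \<open>2*pi\<close>, so the preimage of an
      arc through the point 1 may contain the endpoint on the other side; two points are a Lebesgue
      null set.\<close>
    have sub: "{0..2*pi} \<inter> (cis -` (cis ` I j)) \<subseteq> I j \<union> {0, 2*pi}"
    proof
      fix t assume t: "t \<in> {0..2*pi} \<inter> (cis -` (cis ` I j))"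
      then obtain s where s: "s \<in> I j" "cis t = cis s" by auto
      have "(real j + 1) / real n \<le> 1" using n that by (simp add: divide_le_eq)
      then have "2*pi*real j/real n \<ge> 0" "2*pi*(real j+1)/real n \<le> 2*pi"
        using mult_left_mono[of "(real j+1)/real n" 1 "2*pi"] by auto
      moreover have "2*pi*real j/real n \<le> s" "s \<le> 2*pi*(real j+1)/real n"
        using s(1) by (auto simp: I_def)
      ultimately have "s \<in> {0..2*pi}" by (simp only: atLeastAtMost_iff) linarith
      obtain k :: int where k: "t = s + 2 * pi * k"
        using s(2) sin_cos_eq_iff[of t s] by (auto simp: complex_eq_iff)
      have "\<bar>t - s\<bar> \<le> 2 * pi" using t \<open>s \<in> {0..2*pi}\<close> by (auto simp: abs_le_iff)
      moreover have "\<bar>t - s\<bar> = 2 * pi * \<bar>real_of_int k\<bar>" using k by (simp add: abs_mult)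
      ultimately have "2 * pi * \<bar>real_of_int k\<bar> \<le> 2 * pi * 1" by simp
      then have "\<bar>k\<bar> \<le> 1" by (subst (asm) mult_le_cancel_left_pos) auto
      then have "k = 0 \<or> k = 1 \<or> k = -1" by auto
      then show "t \<in> I j \<union> {0, 2*pi}" using k s t \<open>s \<in> {0..2*pi}\<close> by auto
    qed
    have [measurable]: "cis \<in> borel_measurable borel"
      by (intro borel_measurable_continuous_onI continuous_intros)
    have B: "cis ` I j \<in> sets borel"
      unfolding I_def by (intro borel_compact compact_continuous_image continuous_intros compact_Icc)
    have B2: "cis -` (cis ` I j) \<in> sets borel"
      using measurable_sets[OF \<open>cis \<in> borel_measurable borel\<close> B] by simp
    have "emeasure \<mu> (cis ` I j) = emeasure (uniform_measure lborel {0..2*pi}) (cis -` (cis ` I j))"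
      unfolding circle_measure_def using cl[of j]
      by (subst emeasure_distr[OF measurable_cis_circle]) (auto simp: sets_circle_measure)
    also have "\<dots> = emeasure lborel ({0..2*pi} \<inter> (cis -` (cis ` I j))) / ennreal (2*pi)"
      using B2 by (subst emeasure_uniform_measure) auto
    also have "\<dots> \<le> emeasure lborel (I j \<union> {0, 2*pi}) / ennreal (2*pi)"
      using sub by (intro divide_right_mono_ennreal emeasure_mono) (auto simp: I_def)
    also have "emeasure lborel (I j \<union> {0, 2*pi}) = emeasure lborel (I j)"
      by (intro emeasure_Un_null_set) (auto simp: I_def finite_imp_null_set_lborel)
    also have "\<dots> = ennreal (2*pi / real n)"
      using n by (simp add: I_def field_simps)
    also have "\<dots> / ennreal (2*pi) = ennreal (1 / real n)"
      by (subst divide_ennreal) auto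
    finally show ?thesis
      by (simp add: circle.emeasure_eq_measure)
  qed
  show ?thesis
  proof (intro exI[of _ "(\<lambda>j. cis ` I j) ` {..<n}"] conjI ballI)
    show "space \<mu> \<subseteq> (\<Union>j<n. cis ` I j)"
    proof
      fix z assume "z \<in> space \<mu>"
      then have z: "z = cis (Arg2pi z)" using Arg2pi_eq[of z] by (simp add: cis_conv_exp)
      define t where "t = Arg2pi z * real n / (2*pi)"
      have t: "0 \<le> t" "t < real n"
        using Arg2pi[of z] n by (auto simp: t_def field_simps)
      let ?j = "nat \<lfloor>t\<rfloor>"
      have "?j < n" using t by (auto simp: nat_less_iff floor_less_iff)
      moreover have "real ?j \<le> t" "t \<le> real ?j + 1" using t by auto
      then have "Arg2pi z \<in> I ?j"
        using n by (auto simp: I_def t_def field_simps)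
      ultimately show "z \<in> (\<Union>j<n. cis ` I j)" using z by blast
    qed
  qed (use cl m n in \<open>force+\<close>)
qed

text \<open>Trigonometric polynomials are written \<open>z\<^sup>-\<^sup>N P(z)\<close>, with \<open>cnj z\<close> in place of \<open>z\<^sup>-\<^sup>1\<close>.\<close>

definition trig_polys :: "(complex \<Rightarrow> complex) set" where
  "trig_polys = {t. \<exists>N P. \<forall>z\<in>sphere 0 1. t z = cnj z ^ N * poly P z}"

lemma cnj_mult_self_sphere: "z \<in> sphere 0 1 \<Longrightarrow> cnj z * z = 1"
  using complex_norm_square[of z] by (simp add: mult.commute)

lemma cnj_power_cancel:
  assumes "z \<in> sphere 0 1" shows "cnj z ^ (N + K) * z ^ K = cnj z ^ N"
proof -
  have "cnj z ^ (N + K) * z ^ K = cnj z ^ N * (cnj z * z) ^ K"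
    by (simp add: power_add power_mult_distrib)
  then show ?thesis by (simp only: cnj_mult_self_sphere[OF assms]) simp
qed

lemma trig_polysI: "(\<And>z. z \<in> sphere 0 1 \<Longrightarrow> t z = cnj z ^ N * poly P z) \<Longrightarrow> t \<in> trig_polys"
  by (auto simp: trig_polys_def)

lemma trig_polys_const: "(\<lambda>z. c) \<in> trig_polys"
  by (rule trig_polysI[of _ 0 "[:c:]"]) simp

lemma trig_polys_ident: "(\<lambda>z. z) \<in> trig_polys"
  by (rule trig_polysI[of _ 0 "[:0,1:]"]) simp

lemma trig_polys_cnj: "cnj \<in> trig_polys"
  by (rule trig_polysI[of _ 1 "[:1:]"]) simp

lemma trig_polys_mult:
  assumes "f \<in> trig_polys" "g \<in> trig_polys" shows "(\<lambda>z. f z * g z) \<in> trig_polys"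
proof -
  obtain N P N' P' where "\<And>z. z \<in> sphere 0 1 \<Longrightarrow> f z = cnj z ^ N * poly P z"
    "\<And>z. z \<in> sphere 0 1 \<Longrightarrow> g z = cnj z ^ N' * poly P' z"
    using assms unfolding trig_polys_def by blast
  then show ?thesis by (intro trig_polysI[of _ "N + N'" "P * P'"]) (simp add: power_add)
qed

lemma trig_polys_add:
  assumes "f \<in> trig_polys" "g \<in> trig_polys" shows "(\<lambda>z. f z + g z) \<in> trig_polys"
proof -
  obtain N P N' P' where *: "\<And>z. z \<in> sphere 0 1 \<Longrightarrow> f z = cnj z ^ N * poly P z"
    "\<And>z. z \<in> sphere 0 1 \<Longrightarrow> g z = cnj z ^ N' * poly P' z"
    using assms unfolding trig_polys_def by blast
  show ?thesis
  proof (rule trig_polysI[of _ "N + N'" "monom 1 N' * P + monom 1 N * P'"])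
    fix z :: complex assume z: "z \<in> sphere 0 1"
    have "cnj z ^ (N + N') * poly (monom 1 N' * P + monom 1 N * P') z
       = (cnj z ^ (N + N') * z ^ N') * poly P z + (cnj z ^ (N' + N) * z ^ N) * poly P' z"
      by (simp add: poly_monom algebra_simps)
    then show "f z + g z = cnj z ^ (N + N') * poly (monom 1 N' * P + monom 1 N * P') z"
      using *[OF z] by (simp only: cnj_power_cancel[OF z])
  qed
qed

text \<open>Prepares Stone--Weierstrass, which supplies polynomials in real-linear functions. Only
  the linear case needs work: \<open>h z = Re z * h 1 + Im z * h \<i>\<close>, with
  \<open>Re z\<close> and \<open>Im z\<close> expressed through \<open>z\<close> and
  \<open>cnj z\<close>.\<close>

lemma trig_polys_real_polynomial_function:
  "real_polynomial_function g \<Longrightarrow> (\<lambda>z. of_real (g z)) \<in> trig_polys"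
proof (induction g rule: real_polynomial_function.induct)
  case (linear h)
  interpret bounded_linear h by fact
  have "(\<lambda>z. complex_of_real (h z)) =
      (\<lambda>z. of_real (h 1) / 2 * (z + cnj z) + - \<i> * of_real (h \<i>) / 2 * (z + (-1) * cnj z))"
  proof
    fix z
    have "h z = h (Re z *\<^sub>R 1 + Im z *\<^sub>R \<i>)"
      by (rule arg_cong[where f=h]) (simp add: complex_eq_iff)
    also have "\<dots> = Re z * h 1 + Im z * h \<i>" by (simp add: add scaleR)
    finally show "complex_of_real (h z) = of_real (h 1) / 2 * (z + cnj z) + - \<i> * of_real (h \<i>) / 2 * (z + (-1) * cnj z)"
      by (simp add: complex_eq_iff)
  qed
  also have "\<dots> \<in> trig_polys"
    by (intro trig_polys_add trig_polys_mult trig_polys_const trig_polys_ident trig_polys_cnj)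
  finally show ?case .
qed (auto intro: trig_polys_const trig_polys_add trig_polys_mult)

lemma trig_polys_dense_continuous:
  assumes "continuous_on (sphere 0 1) (f :: complex \<Rightarrow> complex)" "0 < e"
  obtains t where "t \<in> trig_polys" "\<And>z. z \<in> sphere 0 1 \<Longrightarrow> norm (f z - t z) < e"
proof -
  obtain g where g: "polynomial_function g" "\<forall>z\<in>sphere 0 1. norm (f z - g z) < e"
    using Stone_Weierstrass_polynomial_function[OF compact_sphere assms] by auto
  have "real_polynomial_function (Re \<circ> g)" "real_polynomial_function (Im \<circ> g)"
    using g(1) by (auto simp: polynomial_function_def bounded_linear_Re bounded_linear_Im)
  from this[THEN trig_polys_real_polynomial_function]
  have "(\<lambda>z. of_real (Re (g z)) + \<i> * of_real (Im (g z))) \<in> trig_polys"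
    by (intro trig_polys_add trig_polys_mult trig_polys_const) (simp_all add: o_def)
  then have "g \<in> trig_polys" by (simp add: complex_eq[symmetric])
  then show ?thesis using g that by blast
qed

lemma trig_polys_continuous:
  assumes "t \<in> trig_polys" shows "continuous_on (sphere 0 1) t"
proof -
  obtain N P where t: "\<And>z. z \<in> sphere 0 1 \<Longrightarrow> t z = cnj z ^ N * poly P z"
    using assms unfolding trig_polys_def by blast
  show ?thesis
    by (subst continuous_on_cong[OF refl t]) (assumption, intro continuous_intros)
qed

section \<open>Density of trigonometric polynomials in L1\<close>

lemma integrable_continuous_circle:
  assumes "continuous_on (sphere 0 1) (f :: complex \<Rightarrow> complex)"
  shows "integrable \<mu> f"
proof -
  have "bounded (f ` sphere 0 1)"
    using assms by (intro compact_imp_bounded compact_continuous_image) auto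
  then obtain C where "\<forall>z\<in>sphere 0 1. norm (f z) \<le> C" by (auto simp: bounded_iff)
  then have "AE z in \<mu>. norm (f z) \<le> C" using AE_circle by auto
  then show ?thesis using assms by (intro integrable_bounded_circle circle_borel_continuous)
qed

text \<open>Inner regularity supplies a compact \<open>K\<close> inside the set and a compact
  \<open>L\<close> inside its complement with little mass missing; a Urysohn function equal to 1 on
  \<open>K\<close> and 0 on \<open>L\<close> errs only on the missing mass.\<close>

lemma continuous_dense_indicator:
  assumes A: "A \<in> sets \<mu>" and e: "0 < e"
  obtains g :: "complex \<Rightarrow> real" where "continuous_on UNIV g"
    "(LINT z|\<mu>. \<bar>indicator A z - g z\<bar>) < e"
proof -
  \<comment> \<open>The push-forward is a Borel measure on the whole plane, as inner regularity
    demands, and carries no mass off the circle.\<close>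
  define D where "D = distr \<mu> borel (\<lambda>z. z)"
  obtain B where B: "B \<in> sets borel" "A = sphere 0 1 \<inter> B"
    using A by (auto simp: sets_circle_eq)
  interpret D: finite_measure D unfolding D_def by (rule circle.finite_measure_distr) (rule circle_borel_ident)
  have D: "measure D E = measure \<mu> (sphere 0 1 \<inter> E)" if "E \<in> sets borel" for E
    unfolding D_def using that circle_borel_ident by (subst measure_distr) (auto simp: Int_commute)
  have inner: "\<exists>K. compact K \<and> K \<subseteq> E \<and> measure D E - measure D K < e/2" if E: "E \<in> sets borel" for E
  proof -
    have sup: "emeasure D E = (SUP K \<in> {K. K \<subseteq> E \<and> compact K}. emeasure D K)"
      using E D.emeasure_finite by (intro inner_regular) (auto simp: D_def)
    show ?thesis
    proof (rule ccontr)
      assume "\<not> ?thesis"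
      then have "\<not> measure D E - measure D K < e/2" if "compact K" "K \<subseteq> E" for K
        using that by blast
      then have *: "measure D K \<le> measure D E - e/2" if "compact K" "K \<subseteq> E" for K
        using that by fastforce
      have "(SUP K \<in> {K. K \<subseteq> E \<and> compact K}. emeasure D K) \<le> ennreal (measure D E - e/2)"
      proof (rule SUP_least)
        fix K assume "K \<in> {K. K \<subseteq> E \<and> compact K}"
        then show "emeasure D K \<le> ennreal (measure D E - e/2)"
          unfolding D.emeasure_eq_measure by (intro ennreal_leI *) auto
      qed
      then have "emeasure D E \<le> ennreal (measure D E - e/2)" by (simp only: sup)
      moreover have "0 \<le> measure D E - e/2" using *[of "{}"] by simp
      ultimately have "measure D E \<le> measure D E - e/2" unfolding D.emeasure_eq_measure by simp
      then show False using e by simp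
    qed
  qed
  obtain K L where K: "compact K" "K \<subseteq> B" "measure D B - measure D K < e/2"
    and L: "compact L" "L \<subseteq> - B" "measure D (-B) - measure D L < e/2"
    using inner[of B] inner[of "-B"] B by auto
  obtain g :: "complex \<Rightarrow> real" where g: "continuous_on UNIV g" "\<And>x. g x \<in> closed_segment 1 0"
    "\<And>x. x \<in> K \<Longrightarrow> g x = 1" "\<And>x. x \<in> L \<Longrightarrow> g x = 0"
  proof (rule Urysohn[of K L 1 "0::real"])
    show "closed K" "closed L" "K \<inter> L = {}" using K L by (auto intro: compact_imp_closed)
  qed blast
  have [measurable]: "K \<in> sets borel" "L \<in> sets borel" "B \<in> sets borel"
    using K L B by (auto intro: borel_compact)
  have gm [measurable]: "g \<in> circle_borel" using g(1) by (intro circle_borelI borel_measurable_continuous_onI)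
  have g01: "0 \<le> g x" "g x \<le> 1" for x using g(2)[of x] by (auto simp: closed_segment_eq_real_ivl)
  let ?E = "(B - K) \<union> (- B - L)"
  have E: "sphere 0 1 \<inter> ?E \<in> sets \<mu>" by (intro sets_circle_Int) auto
  have "(LINT z|\<mu>. \<bar>indicator A z - g z\<bar>) \<le> (LINT z|\<mu>. indicator (sphere 0 1 \<inter> ?E) z)"
  proof (rule integral_mono)
    show "integrable \<mu> (\<lambda>z. \<bar>indicator A z - g z\<bar>)"
      using A g01 by (intro integrable_bounded_circle[of _ 1]) (auto split: split_indicator)
    show "integrable \<mu> (indicator (sphere 0 1 \<inter> ?E) :: complex \<Rightarrow> real)"
      using E by (simp add: less_top[symmetric])
    fix z :: complex assume "z \<in> space \<mu>"
    then show "\<bar>indicator A z - g z\<bar> \<le> indicator (sphere 0 1 \<inter> ?E) z"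
      using g(3)[of z] g(4)[of z] g01[of z] by (auto simp: B(2) split: split_indicator)
  qed
  also have "\<dots> = measure D ?E"
  proof -
    have "sphere 0 1 \<inter> ?E \<inter> sphere 0 1 = sphere 0 1 \<inter> ?E" by blast
    then show ?thesis by (subst D) auto
  qed
  also have "\<dots> \<le> measure D (B - K) + measure D (- B - L)"
    by (intro measure_Un_le) (auto simp: D_def)
  also have "\<dots> = (measure D B - measure D K) + (measure D (- B) - measure D L)"
    using K L by (subst (1 2) D.finite_measure_Diff) (auto simp: D_def)
  also have "\<dots> < e" using K L by linarith
  finally show ?thesis using g(1) that by blast
qed

lemma continuous_dense_integrable:
  fixes f :: "complex \<Rightarrow> complex"
  assumes "integrable \<mu> f" "0 < e"
  shows "\<exists>g. continuous_on UNIV g \<and> (LINT z|\<mu>. norm (f z - g z)) < e"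
  using assms
proof (induction f arbitrary: e rule: integrable_induct)
  case (base A c)
  then have "e / (norm c + 1) > 0" by (auto intro!: divide_pos_pos add_nonneg_pos)
  then obtain g :: "complex \<Rightarrow> real" where g: "continuous_on UNIV g"
    "(LINT z|\<mu>. \<bar>indicator A z - g z\<bar>) < e / (norm c + 1)"
    using continuous_dense_indicator[OF base(1)] by blast
  have "(LINT z|\<mu>. norm (indicator A z *\<^sub>R c - g z *\<^sub>R c))
      = (LINT z|\<mu>. \<bar>indicator A z - g z\<bar>) * norm c"
    by (simp flip: scaleR_diff_left)
  also have "\<dots> \<le> (LINT z|\<mu>. \<bar>indicator A z - g z\<bar>) * (norm c + 1)"
    by (intro mult_left_mono) auto
  also have "\<dots> < e" using g(2) by (simp add: pos_less_divide_eq add_nonneg_pos)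
  finally show ?case using g(1) by (intro exI[of _ "\<lambda>z. g z *\<^sub>R c"]) (auto intro!: continuous_intros)
next
  case (add f g)
  obtain a b where ab: "continuous_on UNIV a" "(LINT z|\<mu>. norm (f z - a z)) < e/2"
    "continuous_on UNIV b" "(LINT z|\<mu>. norm (g z - b z)) < e/2"
    using add.IH[of "e/2"] add.prems by auto
  have i: "integrable \<mu> a" "integrable \<mu> b"
    using ab by (auto intro!: integrable_continuous_circle intro: continuous_on_subset)
  have "(LINT z|\<mu>. norm (f z + g z - (a z + b z))) \<le> (LINT z|\<mu>. norm (f z - a z) + norm (g z - b z))"
    using add.hyps i by (intro integral_mono) (auto intro: norm_diff_triangle_ineq)
  also have "\<dots> < e" using add.hyps i ab by (subst Bochner_Integration.integral_add) auto
  finally show ?case using ab by (intro exI[of _ "\<lambda>z. a z + b z"]) (auto intro!: continuous_intros)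
next
  case (lim f s)
  have "(\<lambda>n. LINT z|\<mu>. norm (f z - s n z)) \<longlonglongrightarrow> (LINT z|\<mu>. 0)"
  \<comment> \<open>The simple functions satisfy \<open>norm (s n z) \<le> 2 * norm (f z)\<close>,
    hence the factor 3.\<close>
  proof (rule integral_dominated_convergence[where w="\<lambda>z. 3 * norm (f z)"])
    show "AE z in \<mu>. (\<lambda>n. norm (f z - s n z)) \<longlonglongrightarrow> 0"
    proof (rule AE_I2)
      fix z assume "z \<in> space \<mu>"
      from tendsto_norm[OF tendsto_diff[OF tendsto_const[of "f z"] lim.hyps(2)[OF this]]]
      show "(\<lambda>n. norm (f z - s n z)) \<longlonglongrightarrow> 0" by simp
    qed
    show "AE z in \<mu>. norm (norm (f z - s n z)) \<le> 3 * norm (f z)" for n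
    proof (rule AE_I2)
      fix z assume "z \<in> space \<mu>"
      from lim.hyps(3)[OF this, of n] norm_triangle_ineq4[of "f z" "s n z"]
      show "norm (norm (f z - s n z)) \<le> 3 * norm (f z)" by simp
    qed
  qed (use lim.hyps in auto)
  then have "\<forall>\<^sub>F n in sequentially. (LINT z|\<mu>. norm (f z - s n z)) < e/2"
    using lim.prems by (intro order_tendstoD) auto
  then obtain n where n: "(LINT z|\<mu>. norm (f z - s n z)) < e/2"
    by (auto simp: eventually_sequentially)
  obtain g where g: "continuous_on UNIV g" "(LINT z|\<mu>. norm (s n z - g z)) < e/2"
    using lim.IH[of "e/2" n] lim.prems by auto
  have i: "integrable \<mu> g"
    using g by (auto intro!: integrable_continuous_circle intro: continuous_on_subset)
  have "(LINT z|\<mu>. norm (f z - g z)) \<le> (LINT z|\<mu>. norm (f z - s n z) + norm (s n z - g z))"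
    using lim.hyps i by (intro integral_mono) (auto intro: norm_triangle_ineq2 order_trans[OF _ norm_triangle_ineq])
  also have "\<dots> < e" using lim.hyps i g n by (subst Bochner_Integration.integral_add) auto
  finally show ?case using g by auto
qed

text \<open>The uniform bound matters as much as the L1-error, because \<open>\<alpha>\<close> is
  controlled by the L1-norm only on uniformly bounded functions.\<close>

lemma trig_polys_dense_bounded:
  fixes f :: "complex \<Rightarrow> complex"
  assumes f: "f \<in> circle_borel" "AE z in \<mu>. norm (f z) \<le> C" and C: "0 \<le> C" and e: "0 < e"
  obtains t where "t \<in> trig_polys" "\<And>z. z \<in> sphere 0 1 \<Longrightarrow> norm (t z) \<le> C + 1"
    "(LINT z|\<mu>. norm (f z - t z)) < e"
proof -
  have int: "integrable \<mu> f" using f by (rule integrable_bounded_circle)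
  obtain g where g: "continuous_on UNIV g" "(LINT z|\<mu>. norm (f z - g z)) < e/2"
    using continuous_dense_integrable[OF int, of "e/2"] e by auto
  \<comment> \<open>Projection onto the disc is 1-Lipschitz and fixes almost all values of
    \<open>f\<close>, so it restores the bound \<open>C\<close> without increasing the error; the
    subsequent uniform approximation adds at most 1 to the bound.\<close>
  define r where "r = closest_point (cball (0::complex) C)"
  have ne: "cball (0::complex) C \<noteq> {}" using C by simp
  have r1: "r w \<in> cball 0 C" for w
    unfolding r_def using ne by (rule closest_point_in_set[OF closed_cball])
  have r2: "dist (r v) (r w) \<le> dist v w" for v w
    unfolding r_def by (rule closest_point_lipschitz[OF convex_cball closed_cball ne])
  have r3: "r w = w" if "w \<in> cball 0 C" for w
    unfolding r_def using that by (rule closest_point_self)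
  have cr: "continuous_on UNIV (\<lambda>z. r (g z))"
    unfolding r_def
    by (rule continuous_on_compose2[OF continuous_on_closest_point[OF convex_cball closed_cball ne] g(1) subset_UNIV])
  obtain t where t: "t \<in> trig_polys" "\<And>z. z \<in> sphere 0 1 \<Longrightarrow> norm (r (g z) - t z) < min 1 (e/2)"
    using trig_polys_dense_continuous[OF continuous_on_subset[OF cr], of "min 1 (e/2)"] e by auto
  have i: "integrable \<mu> g" "integrable \<mu> (\<lambda>z. r (g z))" "integrable \<mu> t"
    by (intro integrable_continuous_circle continuous_on_subset[OF g(1)] continuous_on_subset[OF cr]
        trig_polys_continuous t(1) subset_UNIV)+
  show ?thesis
  proof (rule that[OF t(1)])
    show "norm (t z) \<le> C + 1" if "z \<in> sphere 0 1" for z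
      using t(2)[OF that] r1[of "g z"] norm_triangle_ineq2[of "t z" "r (g z)"] by (simp add: norm_minus_commute)
    have "(LINT z|\<mu>. norm (f z - t z)) \<le> (LINT z|\<mu>. norm (f z - g z) + e/2)"
    proof (rule integral_mono_AE)
      show "AE z in \<mu>. norm (f z - t z) \<le> norm (f z - g z) + e/2"
        using f(2) AE_circle
      proof eventually_elim
        case (elim z)
        have "norm (f z - r (g z)) \<le> norm (f z - g z)"
          using r2[of "f z" "g z"] r3[of "f z"] elim(1) by (simp add: dist_norm)
        moreover have "norm (r (g z) - t z) < e/2" using t(2)[OF elim(2)] by simp
        ultimately show ?case
          using norm_triangle_ineq[of "f z - r (g z)" "r (g z) - t z"] by simp
      qed
    qed (use int i in auto)
    also have "\<dots> < e" using int i g(2) by (subst Bochner_Integration.integral_add) auto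
    finally show "(LINT z|\<mu>. norm (f z - t z)) < e" .
  qed
qed

section \<open>Fejer multipliers\<close>

text \<open>The summands are the powers of an \<open>M\<close>-th root of unity
  \<open>\<rho>\<close>. The hypotheses say that \<open>a\<close> and \<open>b\<close> differ by
  less than \<open>M\<close>, so \<open>\<rho> = 1\<close> only when they are equal.\<close>

lemma sum_roots_of_unity:
  assumes "a < b + M" "b < a + M"
  shows "(\<Sum>j<M. (cis (2*pi/M) ^ j) ^ a * cnj (cis (2*pi/M) ^ j) ^ b) = (if a = b then of_nat M else 0)"
proof -
  define \<rho> where "\<rho> = cis (2*pi*(real a - real b)/M)"
  have M: "0 < M" using assms by auto
  have \<rho>: "cis (2*pi/M) ^ a * cnj (cis (2*pi/M)) ^ b = \<rho>"
    by (simp add: \<rho>_def Complex.DeMoivre cis_cnj cis_mult diff_divide_distrib right_diff_distrib left_diff_distrib mult.commute)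
  have "(cis (2*pi/M) ^ j) ^ a * cnj (cis (2*pi/M) ^ j) ^ b = \<rho> ^ j" for j
    unfolding \<rho>[symmetric] power_mult_distrib complex_cnj_power by (simp add: mult.commute flip: power_mult)
  then have eq: "(\<Sum>j<M. (cis (2*pi/M) ^ j) ^ a * cnj (cis (2*pi/M) ^ j) ^ b) = (\<Sum>j<M. \<rho> ^ j)" by simp
  show ?thesis
  proof (cases "a = b")
    case True then show ?thesis unfolding eq by (simp add: \<rho>_def)
  next
    case False
    have "\<rho> \<noteq> 1"
    proof
      assume "\<rho> = 1"
      then have "cos (2*pi*(real a - real b)/M) = 1" by (simp add: \<rho>_def complex_eq_iff)
      then obtain n :: int where "2*pi*(real a - real b)/M = of_int n * 2 * pi"
        by (auto simp: cos_one_2pi_int)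
      then have "2*pi*(real a - real b) = 2*pi*(of_int n * real M)"
        using M by (simp add: divide_eq_eq mult_ac)
      then have "real a - real b = of_int n * real M" by simp
      then have "int a - int b = n * int M"
      proof -
        have "real_of_int (int a - int b) = of_int (n * int M)"
          using \<open>real a - real b = of_int n * real M\<close> by simp
        then show ?thesis by (simp only: of_int_eq_iff)
      qed
      moreover have "\<bar>int a - int b\<bar> < int M" using assms by auto
      ultimately have "n = 0"
        by (metis abs_mult abs_of_nat less_irrefl mult.commute mult_less_cancel_left2 of_nat_0_le_iff
            zabs_less_one_iff not_less order_le_less_trans zero_le_mult_iff mult_le_cancel_left1 abs_ge_zero int_one_le_iff_zero_less)
      then show False using \<open>int a - int b = n * int M\<close> False by simp
    qed
    moreover have "\<rho> ^ M = 1"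
    proof -
      have "\<rho> ^ M = cis (2*pi*(real_of_int (int a - int b)))"
        using M by (simp add: \<rho>_def Complex.DeMoivre)
      then show ?thesis by (simp add: cis_multiple_2pi)
    qed
    ultimately show ?thesis unfolding eq using False by (simp add: geometric_sum)
  qed
qed

text \<open>For positive \<open>n\<close> this is the classical Fejer weight, the positive part of 1
  - |i - N| / n. Index \<open>i\<close> stands for the frequency i - N, and the count records how
  often this difference of exponents occurs in the kernel.\<close>

definition fejer_coeff :: "nat \<Rightarrow> nat \<Rightarrow> nat \<Rightarrow> real" where
  "fejer_coeff n N i = card {(a, b). a < n \<and> b < n \<and> a + N = b + i} / n"

lemma finite_fejer_set: "finite {(a, b). a < n \<and> b < n \<and> a + N = b + (i::nat)}"
  by (rule finite_subset[of _ "{..<n} \<times> {..<n}"]) auto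

lemma fejer_coeff_nonneg: "0 \<le> fejer_coeff n N i"
  by (simp add: fejer_coeff_def)

lemma fejer_coeff_le_1: "fejer_coeff n N i \<le> 1"
proof -
  have "card {(a, b). a < n \<and> b < n \<and> a + N = b + i} \<le> card {..<n}"
    by (rule card_inj_on_le[of snd]) (auto simp: inj_on_def)
  then show ?thesis by (simp add: fejer_coeff_def divide_le_eq)
qed

lemma fejer_coeff_eq_0: "n + i \<le> N \<Longrightarrow> fejer_coeff n N i = 0"
proof -
  assume "n + i \<le> N"
  then have e: "{(a, b). a < n \<and> b < n \<and> a + N = b + i} = {}" by auto
  show ?thesis unfolding fejer_coeff_def e by simp
qed

lemma fejer_coeff_1: "fejer_coeff 1 N i = (if i = N then 1 else 0)"
proof -
  have "{(a, b). a < 1 \<and> b < 1 \<and> a + N = b + i} = (if i = N then {(0, 0)} else {})" by auto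
  then show ?thesis by (simp add: fejer_coeff_def)
qed

lemma fejer_coeff_diag: "0 < n \<Longrightarrow> fejer_coeff n N N = 1"
proof -
  assume "0 < n"
  have "{(a, b). a < n \<and> b < n \<and> a + N = b + N} = (\<lambda>a. (a, a)) ` {..<n}" by auto
  then have "card {(a, b). a < n \<and> b < n \<and> a + N = b + N} = n"
    by (simp add: card_image inj_on_def)
  then show ?thesis using \<open>0 < n\<close> by (simp add: fejer_coeff_def)
qed

lemma fejer_coeff_ge: "0 < n \<Longrightarrow> 1 - real (N + i) / n \<le> fejer_coeff n N i"
proof -
  assume n: "0 < n"
  have "card {..<n - (N + i)} \<le> card {(a, b). a < n \<and> b < n \<and> a + N = b + i}"
    by (rule card_inj_on_le[of "\<lambda>c. (c + i, c + N)"]) (auto simp: inj_on_def finite_fejer_set)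
  then have "real n - real (N + i) \<le> card {(a, b). a < n \<and> b < n \<and> a + N = b + i}" by simp
  then have "(real n - real (N + i)) / n \<le> fejer_coeff n N i"
    unfolding fejer_coeff_def by (rule divide_right_mono) simp
  then show ?thesis using n by (simp add: diff_divide_distrib)
qed

lemma fejer_coeff_tendsto: "(\<lambda>n. fejer_coeff n N i) \<longlonglongrightarrow> 1"
proof (rule tendsto_sandwich)
  show "\<forall>\<^sub>F n in sequentially. 1 - real (N + i) / n \<le> fejer_coeff n N i"
    using eventually_gt_at_top[of 0] by eventually_elim (rule fejer_coeff_ge)
  have "(\<lambda>n. 1 - real (N + i) / real n) \<longlonglongrightarrow> 1 - 0"
    by (intro tendsto_diff tendsto_const lim_const_over_n)
  then show "(\<lambda>n. 1 - real (N + i) / real n) \<longlonglongrightarrow> 1" by simp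
qed (auto simp: fejer_coeff_le_1)

definition fejer_poly :: "nat \<Rightarrow> nat \<Rightarrow> complex poly \<Rightarrow> complex poly" where
  "fejer_poly n N P = (\<Sum>i\<le>degree P. monom (of_real (fejer_coeff n N i) * coeff P i) i)"

lemma poly_fejer_poly:
  "poly (fejer_poly n N P) z = (\<Sum>i\<le>degree P. of_real (fejer_coeff n N i) * coeff P i * z ^ i)"
  by (simp add: fejer_poly_def poly_sum poly_monom)

text \<open>The squared modulus makes positivity visible; expanding it produces the pairs counted by
  \<open>fejer_coeff\<close>.\<close>

definition fejer_kernel :: "nat \<Rightarrow> complex \<Rightarrow> real" where
  "fejer_kernel n w = (cmod (\<Sum>a<n. w ^ a))\<^sup>2 / n"

text \<open>Averaging over sufficiently many roots of unity is exact on trigonometric polynomials, so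
  the Fejer mean of such a polynomial is a finite convex combination of its rotations.\<close>

lemma fejer_average:
  assumes n: "0 < n" and z: "z \<in> sphere 0 1" and M: "n + N + degree P < M"
  shows "(\<Sum>j<M. of_real (fejer_kernel n (cis (2*pi/M) ^ j) / M) *
            (cnj (cnj (cis (2*pi/M) ^ j) * z) ^ N * poly P (cnj (cis (2*pi/M) ^ j) * z)))
       = cnj z ^ N * poly (fejer_poly n N P) z"
proof -
  define \<omega> where "\<omega> j = cis (2*pi/M) ^ j" for j
  have M0: "0 < M" using M by simp
  have K: "complex_of_real (fejer_kernel n (\<omega> j)) = (\<Sum>a<n. \<Sum>b<n. \<omega> j ^ a * cnj (\<omega> j) ^ b) / n" for j
  proof -
    have "complex_of_real (fejer_kernel n (\<omega> j)) = (\<Sum>a<n. \<omega> j ^ a) * cnj (\<Sum>a<n. \<omega> j ^ a) / n"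
      unfolding fejer_kernel_def of_real_divide complex_norm_square by simp
    then show ?thesis by (simp add: sum_product)
  qed
  have "(\<Sum>j<M. of_real (fejer_kernel n (\<omega> j) / M) * (cnj (cnj (\<omega> j) * z) ^ N * poly P (cnj (\<omega> j) * z)))
     = (\<Sum>j<M. \<Sum>i\<le>degree P. \<Sum>a<n. \<Sum>b<n.
          (coeff P i * z ^ i * cnj z ^ N / (n * M)) * (\<omega> j ^ (a + N) * cnj (\<omega> j) ^ (b + i)))"
    by (simp add: K poly_altdef sum_distrib_left sum_distrib_right sum_divide_distrib power_mult_distrib power_add mult_ac)
  also have "\<dots> = (\<Sum>i\<le>degree P. \<Sum>a<n. \<Sum>b<n. \<Sum>j<M. 
          (coeff P i * z ^ i * cnj z ^ N / (n * M)) * (\<omega> j ^ (a + N) * cnj (\<omega> j) ^ (b + i)))"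
    by (subst sum.swap, rule sum.cong[OF refl], subst sum.swap, rule sum.cong[OF refl], rule sum.swap)
  also have "\<dots> = (\<Sum>i\<le>degree P. \<Sum>a<n. \<Sum>b<n.
          (coeff P i * z ^ i * cnj z ^ N / (n * M)) * (if a + N = b + i then of_nat M else 0))"
  proof (intro sum.cong refl)
    fix i a b assume "i \<in> {..degree P}" "a \<in> {..<n}" "b \<in> {..<n}"
    \<comment> \<open>The lower bound on \<open>M\<close> keeps the two exponents less than
      \<open>M\<close> apart, so distinct frequencies are not confused by the discrete
      average.\<close>
    then have "a + N < b + i + M" "b + i < a + N + M" using M by auto
    from sum_roots_of_unity[OF this]
    show "(\<Sum>j<M. (coeff P i * z ^ i * cnj z ^ N / (n * M)) * (\<omega> j ^ (a + N) * cnj (\<omega> j) ^ (b + i))) =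
      (coeff P i * z ^ i * cnj z ^ N / (n * M)) * (if a + N = b + i then of_nat M else 0)"
      unfolding \<omega>_def sum_distrib_left[symmetric] by (simp only:)
  qed
  also have "\<dots> = (\<Sum>i\<le>degree P. of_real (fejer_coeff n N i) * coeff P i * z ^ i * cnj z ^ N)"
  proof (intro sum.cong refl)
    fix i
    have c: "(\<Sum>a<n. \<Sum>b<n. (if a + N = b + i then 1 else 0)) = complex_of_nat (card {(a, b). a < n \<and> b < n \<and> a + N = b + i})"
    proof -
      have "(\<Sum>a<n. \<Sum>b<n. (if a + N = b + i then 1 else 0)) = (\<Sum>x\<in>{..<n}\<times>{..<n}. if fst x + N = snd x + i then 1 else (0::complex))"
        by (simp add: sum.cartesian_product case_prod_beta)
      also have "\<dots> = complex_of_nat (card ({..<n}\<times>{..<n} \<inter> {x. fst x + N = snd x + i}))"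
        by (subst sum.If_cases) auto
      also have "{..<n}\<times>{..<n} \<inter> {x. fst x + N = snd x + i} = {(a, b). a < n \<and> b < n \<and> a + N = b + i}"
        by auto
      finally show ?thesis .
    qed
    have "(\<Sum>a<n. \<Sum>b<n. (coeff P i * z ^ i * cnj z ^ N / (n * M)) * (if a + N = b + i then of_nat M else 0))
       = (\<Sum>a<n. \<Sum>b<n. (coeff P i * z ^ i * cnj z ^ N / n) * (if a + N = b + i then 1 else 0))"
      using M0 by (intro sum.cong refl) auto
    also have "\<dots> = (coeff P i * z ^ i * cnj z ^ N / n) * (\<Sum>a<n. \<Sum>b<n. (if a + N = b + i then 1 else 0))"
      by (simp only: sum_distrib_left)
    finally show "(\<Sum>a<n. \<Sum>b<n. (coeff P i * z ^ i * cnj z ^ N / (n * M)) * (if a + N = b + i then of_nat M else 0))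
       = of_real (fejer_coeff n N i) * coeff P i * z ^ i * cnj z ^ N"
      unfolding c by (simp add: fejer_coeff_def)
  qed
  also have "\<dots> = cnj z ^ N * poly (fejer_poly n N P) z"
    by (simp add: poly_fejer_poly sum_distrib_left mult_ac)
  finally show ?thesis unfolding \<omega>_def .
qed

lemma fejer_kernel_nonneg: "0 \<le> fejer_kernel n w"
  by (simp add: fejer_kernel_def)

text \<open>The weights sum to the Fejer mean of the constant 1, evaluated at the point 1.\<close>

lemma sum_fejer_kernel:
  assumes "0 < n" "n < M"
  shows "(\<Sum>j<M. fejer_kernel n (cis (2*pi/M) ^ j) / M) = 1"
proof -
  have "(\<Sum>j<M. complex_of_real (fejer_kernel n (cis (2*pi/M) ^ j) / M)) = 1"
    using fejer_average[of n 1 0 1 M] assms by (simp add: poly_fejer_poly fejer_coeff_diag)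
  then have "complex_of_real (\<Sum>j<M. fejer_kernel n (cis (2*pi/M) ^ j) / M) = of_real 1" by simp
  then show ?thesis by (simp only: of_real_eq_iff)
qed

lemma integral_circle_monomial:
  "(LINT z|\<mu>. cnj z ^ N * z ^ i) = (if i = N then 1 else 0)"
proof -
  have *: "(LINT z|\<mu>. cnj z ^ N * z ^ (N + k)) = (LINT z|\<mu>. z ^ k)"
    "(LINT z|\<mu>. cnj z ^ (N + k) * z ^ N) = (LINT z|\<mu>. cnj z ^ k)" for N k
  proof -
    show "(LINT z|\<mu>. cnj z ^ (N + k) * z ^ N) = (LINT z|\<mu>. cnj z ^ k)"
      by (rule Bochner_Integration.integral_cong) (simp_all add: cnj_power_cancel[of _ k N] add.commute[of N k])
    show "(LINT z|\<mu>. cnj z ^ N * z ^ (N + k)) = (LINT z|\<mu>. z ^ k)"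
    proof (rule Bochner_Integration.integral_cong)
      fix z assume "z \<in> space \<mu>"
      then show "cnj z ^ N * z ^ (N + k) = z ^ k"
        using cnj_power_cancel[of z 0 N] by (simp add: power_add flip: mult.assoc)
    qed simp
  qed
  consider "i = N" | k where "0 < k" "i = N + k" | k where "0 < k" "N = i + k"
    by (metis less_imp_add_positive linorder_less_linear)
  then show ?thesis
  proof cases
    case 1 then show ?thesis using *(1)[of N 0] by simp
  next
    case 2 then show ?thesis using *(1)[of N k] integral_circle_power[of k] by simp
  next
    case 3
    have "(LINT z|\<mu>. cnj z ^ k) = cnj (LINT z|\<mu>. z ^ k)"
      using Bochner_Integration.integral_cnj[of \<mu> "\<lambda>z. z ^ k"] by simp
    then show ?thesis using 3 *(2)[of i k] integral_circle_power[of k] by simp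
  qed
qed

text \<open>Orthogonality reads off a single coefficient; the case distinction guards the truncated
  subtraction of natural numbers.\<close>

lemma integral_circle_trig_poly:
  "(LINT z|\<mu>. cnj z ^ N * poly P z * cnj z ^ a * z ^ b) = (if N + a < b then 0 else coeff P (N + a - b))"
proof -
  have "(LINT z|\<mu>. cnj z ^ N * poly P z * cnj z ^ a * z ^ b)
      = (LINT z|\<mu>. (\<Sum>i\<le>degree P. coeff P i * (cnj z ^ (N + a) * z ^ (i + b))))"
    by (simp add: poly_altdef sum_distrib_left sum_distrib_right power_add mult_ac)
  also have "\<dots> = (\<Sum>i\<le>degree P. LINT z|\<mu>. coeff P i * (cnj z ^ (N + a) * z ^ (i + b)))"
    by (intro Bochner_Integration.integral_sum integrable_continuous_circle continuous_intros)
  also have "\<dots> = (\<Sum>i\<le>degree P. coeff P i * (if i + b = N + a then 1 else 0))"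
    by (simp only: integral_mult_right_zero integral_circle_monomial)
  also have "\<dots> = (if N + a < b then 0 else coeff P (N + a - b))"
  proof (cases "N + a < b")
    case False
    then have "(i + b = N + a) = (i = N + a - b)" for i by auto
    then show ?thesis using False by (auto simp: sum.delta if_distrib coeff_eq_0 cong: if_cong)
  qed (auto intro!: sum.neutral)
  finally show ?thesis .
qed

section \<open>Rotationally symmetric seminorms\<close>

lemma LinftyI:
  "f \<in> circle_borel \<Longrightarrow> AE z in \<mu>. norm (f z) \<le> C \<Longrightarrow> f \<in> Linfty"
  by (auto simp: Linfty_def)

lemma LinftyD:
  assumes "f \<in> Linfty"
  obtains C where "f \<in> circle_borel" "0 \<le> C" "AE z in \<mu>. norm (f z) \<le> C"
proof -
  obtain C where C: "f \<in> circle_borel" "AE z in \<mu>. norm (f z) \<le> C"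
    using assms by (auto simp: Linfty_def)
  from C(2) have "AE z in \<mu>. norm (f z) \<le> max C 0" by eventually_elim simp
  with C that[of "max C 0"] show ?thesis by simp
qed

lemma Linfty_borel [measurable_dest]: "f \<in> Linfty \<Longrightarrow> f \<in> circle_borel"
  by (simp add: Linfty_def)

lemma Linfty_const: "(\<lambda>z. c) \<in> Linfty"
  by (rule LinftyI[of _ "norm c"]) auto

lemma Linfty_add:
  assumes "f \<in> Linfty" "g \<in> Linfty" shows "(\<lambda>z. f z + g z) \<in> Linfty"
proof -
  obtain C D where "AE z in \<mu>. norm (f z) \<le> C" "AE z in \<mu>. norm (g z) \<le> D"
    using assms by (auto simp: Linfty_def)
  then have "AE z in \<mu>. norm (f z + g z) \<le> C + D"
    by eventually_elim (rule norm_triangle_mono)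
  then show ?thesis using assms by (intro LinftyI) (auto simp: Linfty_borel)
qed

lemma Linfty_mult:
  assumes "f \<in> Linfty" "g \<in> Linfty" shows "(\<lambda>z. f z * g z) \<in> Linfty"
proof -
  obtain C where C: "0 \<le> C" "AE z in \<mu>. norm (f z) \<le> C" using LinftyD[OF assms(1)] by metis
  obtain D where D: "0 \<le> D" "AE z in \<mu>. norm (g z) \<le> D" using LinftyD[OF assms(2)] by metis
  from C(2) D(2) have "AE z in \<mu>. norm (f z * g z) \<le> C * D"
    by eventually_elim (use C(1) in \<open>auto simp: norm_mult intro!: mult_mono\<close>)
  moreover have "(\<lambda>z. f z * g z) \<in> circle_borel" using assms by measurable
  ultimately show ?thesis by (intro LinftyI)
qed

lemma Linfty_cmult: "f \<in> Linfty \<Longrightarrow> (\<lambda>z. c * f z) \<in> Linfty"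
  by (rule Linfty_mult[OF Linfty_const])

lemma Linfty_diff: "f \<in> Linfty \<Longrightarrow> g \<in> Linfty \<Longrightarrow> (\<lambda>z. f z - g z) \<in> Linfty"
  using Linfty_add[of f "\<lambda>z. (-1) * g z"] Linfty_cmult[of g "-1"] by simp

lemma Linfty_norm: "f \<in> Linfty \<Longrightarrow> (\<lambda>z. of_real (norm (f z))) \<in> Linfty"
  by (auto simp: Linfty_def)

lemma Linfty_indicator: "A \<in> sets \<mu> \<Longrightarrow> indicator A \<in> Linfty"
  by (rule LinftyI[of _ 1]) (auto split: split_indicator)

lemma Linfty_continuous:
  assumes "continuous_on (sphere 0 1) f" shows "f \<in> Linfty"
proof -
  have "bounded (f ` sphere 0 1)"
    using assms by (intro compact_imp_bounded compact_continuous_image) auto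
  then obtain C where "\<forall>z\<in>sphere 0 1. norm (f z) \<le> C" by (auto simp: bounded_iff)
  then have "AE z in \<mu>. norm (f z) \<le> C" using AE_circle by auto
  then show ?thesis using assms by (intro LinftyI circle_borel_continuous)
qed

lemma Linfty_simple: 
  assumes "simple_function \<mu> s" shows "s \<in> Linfty"
proof -
  have "finite (norm ` s ` space \<mu>)"
    using simple_functionD(1)[OF assms] by simp
  then have "AE z in \<mu>. norm (s z) \<le> Max (norm ` s ` space \<mu>)"
    by (intro AE_I2 Max_ge) auto
  then show ?thesis using assms by (intro LinftyI borel_measurable_simple_function)
qed

lemma Linfty_integrable: "f \<in> Linfty \<Longrightarrow> integrable \<mu> f"
  using LinftyD integrable_bounded_circle by metis

locale rotational_seminorm =
  fixes \<alpha> :: "(complex \<Rightarrow> complex) \<Rightarrow> real"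
  assumes Rc: "\<alpha> \<in> Rc"
begin

lemma alpha_cong: "f \<in> Linfty \<Longrightarrow> g \<in> Linfty \<Longrightarrow> AE z in \<mu>. f z = g z \<Longrightarrow> \<alpha> f = \<alpha> g"
  using Rc unfolding Rc_def seminorm_Linfty_def by blast

lemma alpha_add: "f \<in> Linfty \<Longrightarrow> g \<in> Linfty \<Longrightarrow> \<alpha> (\<lambda>z. f z + g z) \<le> \<alpha> f + \<alpha> g"
  using Rc unfolding Rc_def seminorm_Linfty_def by blast

lemma alpha_cmult: "f \<in> Linfty \<Longrightarrow> \<alpha> (\<lambda>z. c * f z) = norm c * \<alpha> f"
  using Rc unfolding Rc_def seminorm_Linfty_def by blast

lemma alpha_one: "\<alpha> (\<lambda>z. 1) = 1"
  using Rc unfolding Rc_def by blast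

lemma alpha_norm: "f \<in> Linfty \<Longrightarrow> \<alpha> (\<lambda>z. of_real (norm (f z))) = \<alpha> f"
  using Rc unfolding Rc_def by blast

lemma alpha_rotate: "f \<in> Linfty \<Longrightarrow> w \<in> sphere 0 1 \<Longrightarrow> \<alpha> (\<lambda>z. f (cnj w * z)) = \<alpha> f"
  using Rc unfolding Rc_def by blast

lemma alpha_const: "\<alpha> (\<lambda>z. c) = norm c"
  using alpha_cmult[OF Linfty_const, of c 1] alpha_one by simp

lemma alpha_nonneg: assumes "f \<in> Linfty" shows "0 \<le> \<alpha> f"
proof -
  have "\<alpha> (\<lambda>z. f z + (-1) * f z) \<le> \<alpha> f + \<alpha> (\<lambda>z. (-1) * f z)"
    by (intro alpha_add Linfty_cmult assms)
  then show ?thesis using alpha_cmult[OF assms, of "-1"] alpha_const[of 0] by simp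
qed

lemma alpha_triangle: 
  assumes "f \<in> Linfty" "g \<in> Linfty" shows "\<alpha> f \<le> \<alpha> g + \<alpha> (\<lambda>z. f z - g z)"
  using alpha_add[OF assms(2) Linfty_diff[OF assms]] by simp

lemma alpha_sum:
  assumes "finite J" "\<And>j. j \<in> J \<Longrightarrow> f j \<in> Linfty"
  shows "(\<lambda>z. \<Sum>j\<in>J. f j z) \<in> Linfty \<and> \<alpha> (\<lambda>z. \<Sum>j\<in>J. f j z) \<le> (\<Sum>j\<in>J. \<alpha> (f j))"
  using assms
proof (induction J)
  case empty then show ?case using alpha_const[of 0] Linfty_const[of 0] by simp
next
  case (insert j J)
  then have "\<alpha> (\<lambda>z. f j z + (\<Sum>j\<in>J. f j z)) \<le> \<alpha> (f j) + \<alpha> (\<lambda>z. \<Sum>j\<in>J. f j z)"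
    by (intro alpha_add) auto
  then show ?case using insert by (auto intro: Linfty_add)
qed

text \<open>\<open>|f|\<close> is the mean of two functions \<open>|f| \<plusminus> i (|g|\<^sup>2 - |f|\<^sup>2)\<^sup>1\<^sup>/\<^sup>2\<close> of modulus \<open>|g|\<close>.\<close>

lemma alpha_mono:
  assumes f: "f \<in> Linfty" and g: "g \<in> Linfty" and le: "AE z in \<mu>. norm (f z) \<le> norm (g z)"
  shows "\<alpha> f \<le> \<alpha> g"
proof -
  define s where "s z = sqrt ((norm (g z))\<^sup>2 - (norm (f z))\<^sup>2)" for z
  have [measurable]: "f \<in> circle_borel" "g \<in> circle_borel" using f g by (auto simp: Linfty_borel)
  have [measurable]: "s \<in> circle_borel" unfolding s_def by measurable
  define h where "h c z = of_real (norm (f z)) + c * of_real (s z)" for c :: complex and z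
  have [measurable]: "h c \<in> circle_borel" for c unfolding h_def by measurable
  have nh: "AE z in \<mu>. norm (h c z) = norm (g z)" if "c = \<i> \<or> c = -\<i>" for c
    using le
  proof eventually_elim
    case (elim z)
    have "(norm (h c z))\<^sup>2 = (norm (f z))\<^sup>2 + (s z)\<^sup>2"
      using that by (auto simp: h_def cmod_power2)
    also have "(s z)\<^sup>2 = (norm (g z))\<^sup>2 - (norm (f z))\<^sup>2"
      unfolding s_def using elim by (intro real_sqrt_pow2) (simp add: power_mono)
    finally have "(norm (h c z))\<^sup>2 = (norm (g z))\<^sup>2" by simp
    then show ?case by (simp add: power2_eq_iff_nonneg)
  qed
  have hL: "h c \<in> Linfty" if "c = \<i> \<or> c = -\<i>" for c
  proof -
    obtain C where "AE z in \<mu>. norm (g z) \<le> C" using LinftyD[OF g] by metis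
    with nh[OF that] have "AE z in \<mu>. norm (h c z) \<le> C" by eventually_elim simp
    then show ?thesis by (intro LinftyI) auto
  qed
  have ah: "\<alpha> (h c) = \<alpha> g" if "c = \<i> \<or> c = -\<i>" for c
  proof -
    have "\<alpha> (\<lambda>z. of_real (norm (h c z))) = \<alpha> (\<lambda>z. of_real (norm (g z)))"
    proof (rule alpha_cong)
      show "AE z in \<mu>. complex_of_real (norm (h c z)) = of_real (norm (g z))"
        using nh[OF that] by eventually_elim simp
    qed (use hL[OF that] g in \<open>auto intro: Linfty_norm\<close>)
    then show ?thesis using hL[OF that] g by (simp add: alpha_norm)
  qed
  have "\<alpha> f = \<alpha> (\<lambda>z. (1/2) * (h \<i> z + h (-\<i>) z))"
    using f by (simp add: h_def flip: alpha_norm)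
  also have "\<dots> = 1/2 * \<alpha> (\<lambda>z. h \<i> z + h (-\<i>) z)"
    by (subst alpha_cmult) (auto intro: Linfty_add hL)
  also have "\<dots> \<le> 1/2 * (\<alpha> (h \<i>) + \<alpha> (h (-\<i>)))"
    by (intro mult_left_mono alpha_add hL) auto
  finally show ?thesis by (simp add: ah)
qed

lemma alpha_le:
  assumes "f \<in> circle_borel" "AE z in \<mu>. norm (f z) \<le> C" "0 \<le> C"
  shows "\<alpha> f \<le> C"
  using alpha_mono[of f "\<lambda>z. of_real C"] assms LinftyI[OF assms(1,2)] alpha_const[of "of_real C"] Linfty_const
  by simp

lemma alpha_indicator_small:
  assumes "0 < e"
  obtains d where "0 < d" "\<And>E. E \<in> sets \<mu> \<Longrightarrow> measure \<mu> E < d \<Longrightarrow> \<alpha> (indicator E) < e"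
proof -
  have "((\<lambda>E. \<alpha> (indicator E)) \<longlongrightarrow> 0)
       ((measure \<mu>) going_to (at_right 0) within sets \<mu>)"
    using Rc unfolding Rc_def by blast
  then have "\<forall>\<^sub>F E in (measure \<mu>) going_to (at_right 0) within sets \<mu>. \<alpha> (indicator E) < e"
    using assms by (intro order_tendstoD)
  then obtain d where d: "0 < d" "\<And>E. E \<in> sets \<mu> \<Longrightarrow> 0 < measure \<mu> E \<Longrightarrow>
      measure \<mu> E < d \<Longrightarrow> \<alpha> (indicator E) < e"
    unfolding going_to_within_def eventually_inf_principal eventually_filtercomap eventually_at_right_field
    by blast
  show ?thesis
  proof (rule that[OF d(1)])
    fix E assume E: "E \<in> sets \<mu>" "measure \<mu> E < d"
    show "\<alpha> (indicator E) < e"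
    \<comment> \<open>The filter \<open>at_right 0\<close> says nothing about null sets; there the
      seminorm vanishes by monotonicity.\<close>
    proof (cases "measure \<mu> E = 0")
      case True
      then have "E \<in> null_sets \<mu>" using E by (auto simp: null_sets_def circle.emeasure_eq_measure)
      then have "AE z in \<mu>. norm (indicator E z :: complex) \<le> 0"
        by (rule AE_mp[OF AE_not_in]) auto
      then have "\<alpha> (indicator E) \<le> 0" using E by (intro alpha_le) auto
      then show ?thesis using assms by simp
    next
      case False
      then show ?thesis using d(2)[OF E(1) _ E(2)] by (simp add: zero_less_measure_iff)
    qed
  qed
qed

text \<open>Markov's inequality makes the set where \<open>e/2 \<le> norm (f z)\<close> small;
  \<open>f\<close> is dominated by \<open>e/2\<close> off this set and by \<open>C\<close> on it.
  Continuity of \<open>\<alpha>\<close> on indicators thus becomes continuity on uniformly bounded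
  functions with respect to the L1-norm.\<close>

lemma alpha_small:
  assumes e: "0 < e" and C: "0 \<le> C"
  obtains d where "0 < d"
    "\<And>f. f \<in> circle_borel \<Longrightarrow> AE z in \<mu>. norm (f z) \<le> C \<Longrightarrow>
       (LINT z|\<mu>. norm (f z)) < d \<Longrightarrow> \<alpha> f < e"
proof -
  \<comment> \<open>The tolerance for indicators is divided by \<open>C + 1\<close>, since the
    indicator will be multiplied by \<open>C\<close>; the summand 1 covers
    \<open>C = 0\<close>.\<close>
  obtain d where d: "0 < d" "\<And>E. E \<in> sets \<mu> \<Longrightarrow> measure \<mu> E < d \<Longrightarrow> \<alpha> (indicator E) < e / (2 * (C + 1))"
    using alpha_indicator_small[of "e / (2 * (C + 1))"] e C by auto
  show ?thesis
  proof (rule that)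
    show "0 < d * (e/2)" using d e by simp
    fix f :: "complex \<Rightarrow> complex"
    assume f[measurable]: "f \<in> circle_borel" and fC: "AE z in \<mu>. norm (f z) \<le> C"
      and small: "(LINT z|\<mu>. norm (f z)) < d * (e/2)"
    let ?E = "{z\<in>space \<mu>. e/2 \<le> norm (f z)}"
    have E: "?E \<in> sets \<mu>" by measurable
    have "integrable \<mu> (\<lambda>z. norm (f z))" using integrable_bounded_circle[OF f fC] by simp
    then have "measure \<mu> ?E \<le> (LINT z|\<mu>. norm (f z)) / (e/2)"
      using e by (intro integral_Markov_inequality_measure[where A="{}"]) auto
    also have "\<dots> < d" using small e by (subst pos_divide_less_eq) auto
    finally have aE: "\<alpha> (indicator ?E) < e / (2 * (C + 1))" using E by (intro d(2)) 
    have "\<alpha> f \<le> \<alpha> (\<lambda>z. of_real (e/2) + of_real C * indicator ?E z)"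
    proof (rule alpha_mono)
      show "f \<in> Linfty" using f fC by (rule LinftyI)
      show "(\<lambda>z. of_real (e/2) + of_real C * indicator ?E z) \<in> Linfty"
        using E by (intro Linfty_add Linfty_cmult Linfty_const Linfty_indicator)
      show "AE z in \<mu>. norm (f z) \<le> norm (complex_of_real (e/2) + of_real C * indicator ?E z)"
        using fC AE_space
      proof eventually_elim
        case (elim z)
        have "norm (complex_of_real (e/2) + of_real C * indicator ?E z) = e/2 + C * indicator ?E z"
          using e C by (auto split: split_indicator simp flip: of_real_add simp del: of_real_divide)
        then show ?case using elim e C by (auto split: split_indicator)
      qed
    qed
    also have "\<dots> \<le> e/2 + C * \<alpha> (indicator ?E)"
      using alpha_add[OF Linfty_const Linfty_cmult[OF Linfty_indicator[OF E]], of "of_real (e/2)" "of_real C"]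
        alpha_const[of "of_real (e/2)"] alpha_cmult[OF Linfty_indicator[OF E], of "of_real C"] e C
      by simp
    also have "\<dots> \<le> e/2 + (C + 1) * \<alpha> (indicator ?E)"
      using alpha_nonneg[OF Linfty_indicator[OF E]] by (simp add: algebra_simps)
    also have "\<dots> < e/2 + (C + 1) * (e / (2 * (C + 1)))"
      using aE C by (intro add_strict_left_mono mult_strict_left_mono) auto
    also have "(C + 1) * (e / (2 * (C + 1))) = e/2" using C by (simp add: divide_simps)
    finally show "\<alpha> f < e" by simp
  qed
qed

lemma alpha_minus_commute:
  assumes "f \<in> Linfty" "g \<in> Linfty" shows "\<alpha> (\<lambda>z. f z - g z) = \<alpha> (\<lambda>z. g z - f z)"
  using alpha_cmult[OF Linfty_diff[OF assms], of "-1"] by simp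

lemma alpha_abs_diff:
  assumes "f \<in> Linfty" "g \<in> Linfty" shows "\<bar>\<alpha> f - \<alpha> g\<bar> \<le> \<alpha> (\<lambda>z. f z - g z)"
  using alpha_triangle[OF assms] alpha_triangle[OF assms(2,1)] alpha_minus_commute[OF assms] by linarith

text \<open>Continuity of \<open>\<alpha>\<close> in its working form: dominated convergence makes
  the L1-distance tend to 0, and \<open>alpha_small\<close> turns this into convergence of the
  seminorms.\<close>

lemma alpha_bounded_convergence:
  assumes u: "\<And>n. u n \<in> circle_borel" "\<And>n. AE z in \<mu>. norm (u n z) \<le> C"
    and f: "f \<in> circle_borel" and lim: "AE z in \<mu>. (\<lambda>n. u n z) \<longlonglongrightarrow> f z"
  shows "(\<lambda>n. \<alpha> (u n)) \<longlonglongrightarrow> \<alpha> f"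
proof (rule tendstoI)
  fix e :: real assume e: "0 < e"
  define D where "D = max C 0"
  note [measurable] = u(1) f
  have uD: "AE z in \<mu>. norm (u n z) \<le> D" for n
    using u(2)[of n] by eventually_elim (simp add: D_def)
  then have "AE z in \<mu>. \<forall>n. norm (u n z) \<le> D" by (simp add: AE_all_countable)
  then have fD: "AE z in \<mu>. norm (f z) \<le> D"
    using lim
  proof eventually_elim
    case (elim z)
    then show ?case by (intro Lim_bounded[OF tendsto_norm[OF elim(2)], of 0]) auto
  qed
  have diff: "AE z in \<mu>. norm (u n z - f z) \<le> 2 * D" for n
    using uD[of n] fD
  proof eventually_elim
    case (elim z) then show ?case using norm_triangle_ineq4[of "u n z" "f z"] by simp
  qed
  obtain d where d: "0 < d"
    "\<And>f. f \<in> circle_borel \<Longrightarrow> AE z in \<mu>. norm (f z) \<le> 2 * D \<Longrightarrow>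
       (LINT z|\<mu>. norm (f z)) < d \<Longrightarrow> \<alpha> f < e"
    using alpha_small[OF e, of "2 * D"] by (auto simp: D_def)
  have "(\<lambda>n. LINT z|\<mu>. norm (u n z - f z)) \<longlonglongrightarrow> (LINT z|\<mu>. 0)"
  proof (rule integral_dominated_convergence[where w="\<lambda>z. 2 * D"])
    show "AE z in \<mu>. (\<lambda>n. norm (u n z - f z)) \<longlonglongrightarrow> 0"
      using lim by eventually_elim (metis LIM_zero tendsto_norm_zero)
  qed (use diff in auto)
  then have "\<forall>\<^sub>F n in sequentially. (LINT z|\<mu>. norm (u n z - f z)) < d"
    using d(1) by (intro order_tendstoD) auto
  then show "\<forall>\<^sub>F n in sequentially. dist (\<alpha> (u n)) (\<alpha> f) < e"
  proof eventually_elim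
    case (elim n)
    have "\<alpha> (\<lambda>z. u n z - f z) < e" using elim diff by (intro d(2)) auto
    then show ?case
      using alpha_abs_diff[OF LinftyI[OF u(1) uD] LinftyI[OF f fD], of n] by (simp add: dist_real_def)
  qed
qed

lemma Linfty_trig_poly: "(\<lambda>z. cnj z ^ N * poly P z) \<in> Linfty"
  by (intro Linfty_continuous continuous_intros)

text \<open>By \<open>fejer_average\<close> the Fejer mean is a convex combination of rotations, and
  all rotations have the same seminorm.\<close>

lemma alpha_fejer:
  assumes n: "0 < n"
  shows "\<alpha> (\<lambda>z. cnj z ^ N * poly (fejer_poly n N P) z) \<le> \<alpha> (\<lambda>z. cnj z ^ N * poly P z)"
proof -
  define M where "M = Suc (n + N + degree P)"
  define t where "t z = cnj z ^ N * poly P z" for z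
  define \<omega> where "\<omega> j = cis (2*pi/M) ^ j" for j
  define c where "c j = fejer_kernel n (\<omega> j) / M" for j
  have t: "t \<in> Linfty" unfolding t_def by (rule Linfty_trig_poly)
  have w: "\<omega> j \<in> sphere 0 1" for j by (simp add: \<omega>_def norm_power)
  have tr: "(\<lambda>z. t (cnj (\<omega> j) * z)) \<in> Linfty" for j
    unfolding t_def by (intro Linfty_continuous continuous_intros)
  have L: "(\<lambda>z. of_real (c j) * t (cnj (\<omega> j) * z)) \<in> Linfty" for j
    by (intro Linfty_cmult tr)
  have c0: "0 \<le> c j" for j by (simp add: c_def fejer_kernel_nonneg)
  have "\<alpha> (\<lambda>z. cnj z ^ N * poly (fejer_poly n N P) z) = \<alpha> (\<lambda>z. \<Sum>j<M. of_real (c j) * t (cnj (\<omega> j) * z))"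
  proof (rule alpha_cong[OF Linfty_trig_poly])
    show "(\<lambda>z. \<Sum>j<M. of_real (c j) * t (cnj (\<omega> j) * z)) \<in> Linfty"
      using alpha_sum[of "{..<M}" "\<lambda>j z. of_real (c j) * t (cnj (\<omega> j) * z)"] L by simp
    show "AE z in \<mu>. cnj z ^ N * poly (fejer_poly n N P) z = (\<Sum>j<M. of_real (c j) * t (cnj (\<omega> j) * z))"
      using AE_circle
    proof eventually_elim
      case (elim z)
      then show ?case
        using fejer_average[OF n elim, of N P M] by (simp add: c_def t_def \<omega>_def M_def)
    qed
  qed
  also have "\<dots> \<le> (\<Sum>j<M. \<alpha> (\<lambda>z. of_real (c j) * t (cnj (\<omega> j) * z)))"
    using alpha_sum[of "{..<M}" "\<lambda>j z. of_real (c j) * t (cnj (\<omega> j) * z)"] L by simp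
  also have "\<dots> = (\<Sum>j<M. c j * \<alpha> t)"
    using c0 by (simp add: alpha_cmult[OF tr] alpha_rotate[OF t w])
  also have "\<dots> = \<alpha> t"
  proof -
    have "n < M" by (simp add: M_def)
    then have "(\<Sum>j<M. c j) = 1" unfolding c_def \<omega>_def by (rule sum_fejer_kernel[OF n])
    then show ?thesis by (simp flip: sum_distrib_right)
  qed
  finally show ?thesis by (simp add: t_def[abs_def])
qed

text \<open>The Fejer mean of order 1 retains only the constant Fourier coefficient, which is the
  integral; contractivity then gives the bound.\<close>

lemma alpha_ge_integral_trig_poly:
  assumes "t \<in> trig_polys" shows "norm (LINT z|\<mu>. t z) \<le> \<alpha> t"
proof -
  obtain N P where t: "\<And>z. z \<in> sphere 0 1 \<Longrightarrow> t z = cnj z ^ N * poly P z"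
    using assms unfolding trig_polys_def by blast
  have "(LINT z|\<mu>. t z) = (LINT z|\<mu>. cnj z ^ N * poly P z * cnj z ^ 0 * z ^ 0)"
    using t by (intro Bochner_Integration.integral_cong) auto
  also have "\<dots> = coeff P N" by (subst integral_circle_trig_poly) simp
  finally have I: "(LINT z|\<mu>. t z) = coeff P N" .
  have p1: "poly (fejer_poly 1 N P) z = coeff P N * z ^ N" for z
  proof -
    have "poly (fejer_poly 1 N P) z = (\<Sum>i\<le>degree P. if i = N then coeff P i * z ^ i else 0)"
      unfolding poly_fejer_poly fejer_coeff_1 by (intro sum.cong) auto
    also have "\<dots> = coeff P N * z ^ N" by (auto simp: coeff_eq_0)
    finally show ?thesis .
  qed
  have "norm (coeff P N) = \<alpha> (\<lambda>z. cnj z ^ N * poly (fejer_poly 1 N P) z)"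
    unfolding alpha_const[symmetric]
  proof (rule alpha_cong[OF Linfty_const Linfty_trig_poly])
    show "AE z in \<mu>. coeff P N = cnj z ^ N * poly (fejer_poly 1 N P) z"
      using AE_circle
    proof eventually_elim
      case (elim z)
      then show ?case using cnj_power_cancel[OF elim, of 0 N] by (simp add: p1[unfolded One_nat_def] mult_ac)
    qed
  qed
  also have "\<dots> \<le> \<alpha> (\<lambda>z. cnj z ^ N * poly P z)" by (rule alpha_fejer) simp
  also have "\<dots> = \<alpha> t"
  proof (rule alpha_cong[OF Linfty_trig_poly])
    show "t \<in> Linfty" by (intro Linfty_continuous trig_polys_continuous assms)
    show "AE z in \<mu>. cnj z ^ N * poly P z = t z"
      using AE_circle by eventually_elim (simp add: t)
  qed
  finally show ?thesis by (simp add: I)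
qed

text \<open>The integral of the modulus is the integral of \<open>g\<close>, and \<open>g\<close> is
  approximated by trigonometric polynomials in L1 and, being bounded together with them, also in
  \<open>\<alpha>\<close>.\<close>

lemma alpha_ge_L1:
  assumes f: "f \<in> Linfty" shows "(LINT z|\<mu>. norm (f z)) \<le> \<alpha> f"
proof (rule field_le_epsilon)
  fix e :: real assume e: "0 < e"
  obtain C where C: "f \<in> circle_borel" "0 \<le> C" "AE z in \<mu>. norm (f z) \<le> C"
    using LinftyD[OF f] .
  define g where "g z = complex_of_real (norm (f z))" for z
  have g: "g \<in> Linfty" unfolding g_def by (rule Linfty_norm[OF f])
  \<comment> \<open>\<open>2 * C + 1\<close> bounds the difference between \<open>g\<close>, of size
    at most \<open>C\<close>, and an approximant of size at most \<open>C + 1\<close>.\<close>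
  obtain d where d: "0 < d"
    "\<And>f. f \<in> circle_borel \<Longrightarrow> AE z in \<mu>. norm (f z) \<le> 2 * C + 1 \<Longrightarrow>
       (LINT z|\<mu>. norm (f z)) < d \<Longrightarrow> \<alpha> f < e/2"
    using alpha_small[of "e/2" "2 * C + 1"] e C by auto
  have gC: "AE z in \<mu>. norm (g z) \<le> C" using C(3) by eventually_elim (simp add: g_def)
  obtain t where t: "t \<in> trig_polys" "\<And>z. z \<in> sphere 0 1 \<Longrightarrow> norm (t z) \<le> C + 1"
    "(LINT z|\<mu>. norm (g z - t z)) < min d (e/2)"
    using trig_polys_dense_bounded[OF Linfty_borel[OF g] gC C(2), of "min d (e/2)"] d e by auto
  have tL: "t \<in> Linfty" by (intro Linfty_continuous trig_polys_continuous t)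
  have "\<alpha> (\<lambda>z. g z - t z) < e/2"
  proof (rule d(2))
    show "AE z in \<mu>. norm (g z - t z) \<le> 2 * C + 1"
      using gC AE_circle
    proof eventually_elim
      case (elim z) then show ?case using norm_triangle_ineq4[of "g z" "t z"] t(2)[OF elim(2)] by simp
    qed
  qed (use g tL t in \<open>auto simp: Linfty_borel\<close>)
  then have at: "\<alpha> t \<le> \<alpha> f + e/2"
    using alpha_triangle[OF tL g] alpha_minus_commute[OF tL g] alpha_norm[OF f] by (simp add: g_def[abs_def])
  have "(LINT z|\<mu>. norm (f z)) = norm (LINT z|\<mu>. g z)"
    by (simp add: g_def)
  also have "\<dots> \<le> norm (LINT z|\<mu>. t z) + norm (LINT z|\<mu>. g z - t z)"
    using Linfty_integrable[OF g] Linfty_integrable[OF tL] norm_triangle_sub[of "LINT z|\<mu>. g z" "LINT z|\<mu>. t z"]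
    by (simp add: Bochner_Integration.integral_diff)
  also have "\<dots> \<le> \<alpha> t + (LINT z|\<mu>. norm (g z - t z))"
    by (intro add_mono alpha_ge_integral_trig_poly t integral_norm_bound)
  also have "\<dots> \<le> \<alpha> f + e" using at t(3) by simp
  finally show "(LINT z|\<mu>. norm (f z)) \<le> \<alpha> f + e" .
qed

end

section \<open>The extension of the seminorm to measurable functions\<close>

lemma simple_approx_norm:
  assumes f: "f \<in> circle_borel"
  obtains s :: "nat \<Rightarrow> complex \<Rightarrow> complex" where
    "\<And>n. simple_function \<mu> (s n)" "\<And>n z. norm (s n z) \<le> norm (f z)"
    "\<And>z. (\<lambda>n. s n z) \<longlonglongrightarrow> of_real (norm (f z))"
proof -
  have "(\<lambda>z. norm (f z)) \<in> borel_measurable \<mu>" using f by simp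
  then obtain u where u: "incseq u" "\<And>i. simple_function \<mu> (u i)"
    "\<And>z. bdd_above (range (\<lambda>i. u i z))" "\<And>i z. 0 \<le> u i z" "(\<lambda>z. norm (f z)) = (SUP i. u i)"
    using borel_measurable_implies_simple_function_sequence_real[of "\<lambda>z. norm (f z)" \<mu>] by auto
  have sup: "norm (f z) = (SUP i. u i z)" for z
    using fun_cong[OF u(5), of z] by (simp add: Sup_fun_def image_image)
  show ?thesis
  proof (rule that[of "\<lambda>n z. of_real (u n z)"])
    show "simple_function \<mu> (\<lambda>z. complex_of_real (u n z))" for n
      by (rule simple_function_compose1[OF u(2)])
    show "norm (complex_of_real (u n z)) \<le> norm (f z)" for n z
      unfolding sup using u(3,4) by (auto intro: cSUP_upper)
    have "(\<lambda>n. u n z) \<longlonglongrightarrow> norm (f z)" for z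
      unfolding sup using u(1,3) by (intro LIMSEQ_incseq_SUP) (auto simp: incseq_def le_fun_def)
    then show "(\<lambda>n. complex_of_real (u n z)) \<longlonglongrightarrow> of_real (norm (f z))" for z
      by (intro tendsto_of_real)
  qed
qed

text \<open>Large values are replaced by 0, so each point sees \<open>f\<close> itself from some
  index on.\<close>

definition trunc :: "nat \<Rightarrow> (complex \<Rightarrow> complex) \<Rightarrow> complex \<Rightarrow> complex" where
  "trunc n f z = (if norm (f z) \<le> real n then f z else 0)"

lemma trunc_borel [measurable]:
  assumes [measurable]: "f \<in> circle_borel" shows "trunc n f \<in> circle_borel"
  unfolding trunc_def[abs_def] by measurable

lemma norm_trunc_le: "norm (trunc n f z) \<le> norm (f z)" "norm (trunc n f z) \<le> real n"
  by (auto simp: trunc_def)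

lemma trunc_Linfty: "f \<in> circle_borel \<Longrightarrow> trunc n f \<in> Linfty"
  by (rule LinftyI[of _ "real n"]) (auto simp: norm_trunc_le trunc_borel)

lemma trunc_tendsto: "(\<lambda>n. trunc n f z) \<longlonglongrightarrow> f z"
proof (rule tendsto_eventually)
  show "\<forall>\<^sub>F n in sequentially. trunc n f z = f z"
    using eventually_ge_at_top[of "nat \<lceil>norm (f z)\<rceil>"]
    by eventually_elim (auto simp: trunc_def nat_le_iff ceiling_le_iff)
qed

text \<open>Radial projection onto the disc of radius \<open>C\<close>: it gives the value closest
  to \<open>f z\<close> among all those of modulus at most \<open>C\<close>, which replacement by 0
  does not.\<close>

definition clip :: "real \<Rightarrow> (complex \<Rightarrow> complex) \<Rightarrow> complex \<Rightarrow> complex" where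
  "clip C f z = (if norm (f z) \<le> C then f z else of_real (C / norm (f z)) * f z)"

lemma clip_borel [measurable]:
  assumes [measurable]: "f \<in> circle_borel" shows "clip C f \<in> circle_borel"
  unfolding clip_def[abs_def] by measurable

lemma norm_clip:
  assumes "0 \<le> C"
  shows "norm (clip C f z) \<le> C" "norm (clip C f z) \<le> norm (f z)"
    "norm (f z - clip C f z) = max 0 (norm (f z) - C)"
proof -
  show "norm (clip C f z) \<le> C" "norm (clip C f z) \<le> norm (f z)"
    using assms by (auto simp: clip_def norm_mult norm_divide divide_le_eq)
  show "norm (f z - clip C f z) = max 0 (norm (f z) - C)"
  proof (cases "norm (f z) \<le> C")
    case False
    then have pos: "0 < norm (f z)" using assms by linarith
    have "f z - clip C f z = of_real (1 - C / norm (f z)) * f z"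
      using False by (simp add: clip_def algebra_simps)
    also have "norm \<dots> = (1 - C / norm (f z)) * norm (f z)"
      using False pos by (simp add: norm_mult divide_le_eq del: of_real_diff of_real_divide)
    also have "\<dots> = norm (f z) - C" using pos by (simp add: field_simps)
    finally show ?thesis using False by simp
  qed (simp add: clip_def)
qed

lemma clip_Linfty: "f \<in> circle_borel \<Longrightarrow> 0 \<le> C \<Longrightarrow> clip C f \<in> Linfty"
  by (rule LinftyI[of _ C]) (auto simp: norm_clip clip_borel)

context rotational_seminorm
begin

abbreviation p :: "(complex \<Rightarrow> complex) \<Rightarrow> ennreal" where "p \<equiv> ext_seminorm \<alpha>"

lemma p_mono:
  assumes "AE z in \<mu>. norm (f z) \<le> norm (g z)" shows "p f \<le> p g"
  unfolding ext_seminorm_def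
proof (rule SUP_subset_mono[OF subsetI order_refl])
  fix s :: "complex \<Rightarrow> complex"
  assume s: "s \<in> {s. simple_function \<mu> s \<and> (AE z in \<mu>. norm (s z) \<le> norm (f z))}"
  then have "AE z in \<mu>. norm (s z) \<le> norm (f z)" by simp
  then have "AE z in \<mu>. norm (s z) \<le> norm (g z)" using assms by eventually_elim simp
  then show "s \<in> {s. simple_function \<mu> s \<and> (AE z in \<mu>. norm (s z) \<le> norm (g z))}"
    using s by simp
qed

lemma p_cong: "AE z in \<mu>. norm (f z) = norm (g z) \<Longrightarrow> p f = p g"
  by (intro antisym p_mono) (auto elim: eventually_mono)

text \<open>The extension is consistent because simple functions below \<open>norm (f z)\<close>
  converge to it and \<open>\<alpha>\<close> obeys bounded convergence.\<close>

lemma p_Linfty: assumes f: "f \<in> Linfty" shows "p f = ennreal (\<alpha> f)"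
proof (rule antisym)
  show "p f \<le> ennreal (\<alpha> f)" unfolding ext_seminorm_def
    by (rule SUP_least) (auto intro!: ennreal_leI alpha_mono f Linfty_simple)
  obtain C where C: "f \<in> circle_borel" "0 \<le> C" "AE z in \<mu>. norm (f z) \<le> C"
    using LinftyD[OF f] .
  obtain s :: "nat \<Rightarrow> complex \<Rightarrow> complex" where
    s: "\<And>n. simple_function \<mu> (s n)" "\<And>n z. norm (s n z) \<le> norm (f z)"
    "\<And>z. (\<lambda>n. s n z) \<longlonglongrightarrow> of_real (norm (f z))"
    using simple_approx_norm[OF C(1)] by blast
  have "(\<lambda>n. \<alpha> (s n)) \<longlonglongrightarrow> \<alpha> (\<lambda>z. of_real (norm (f z)))"
  proof (rule alpha_bounded_convergence)
    show "AE z in \<mu>. norm (s n z) \<le> C" for n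
      using C(3) by eventually_elim (rule order_trans[OF s(2)])
  qed (use s C in \<open>auto intro: borel_measurable_simple_function\<close>)
  then have "(\<lambda>n. ennreal (\<alpha> (s n))) \<longlonglongrightarrow> ennreal (\<alpha> f)"
    using alpha_norm[OF f] by (intro tendsto_ennrealI) simp
  moreover have "ennreal (\<alpha> (s n)) \<le> p f" for n
    unfolding ext_seminorm_def by (rule SUP_upper) (auto simp: s)
  ultimately show "ennreal (\<alpha> f) \<le> p f" by (intro Lim_bounded[of _ _ 0]) auto
qed

text \<open>For a simple \<open>s\<close> below \<open>f\<close>, the functions
  \<open>min (norm (s z)) (norm (u n z))\<close> are bounded and tend to \<open>norm (s z)\<close>,
  so bounded convergence applies to them.\<close>

lemma p_Fatou:
  assumes u: "\<And>n. u n \<in> circle_borel" "\<And>n. p (u n) \<le> c"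
    and lim: "AE z in \<mu>. (\<lambda>n. u n z) \<longlonglongrightarrow> f z"
  shows "p f \<le> c"
  unfolding ext_seminorm_def
proof (rule SUP_least, clarify)
  fix s :: "complex \<Rightarrow> complex"
  assume s: "simple_function \<mu> s" and le: "AE z in \<mu>. norm (s z) \<le> norm (f z)"
  note [measurable] = u(1) borel_measurable_simple_function[OF s]
  define t where "t n z = complex_of_real (min (norm (s z)) (norm (u n z)))" for n z
  have [measurable]: "t n \<in> circle_borel" for n unfolding t_def by measurable
  obtain C where C: "0 \<le> C" "AE z in \<mu>. norm (s z) \<le> C" using LinftyD[OF Linfty_simple[OF s]] by metis
  have tC: "AE z in \<mu>. norm (t n z) \<le> C" for n
    using C(2) by eventually_elim (simp add: t_def min_le_iff_disj)
  have "(\<lambda>n. \<alpha> (t n)) \<longlonglongrightarrow> \<alpha> (\<lambda>z. of_real (norm (s z)))"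
  proof (rule alpha_bounded_convergence[OF _ tC])
    show "AE z in \<mu>. (\<lambda>n. t n z) \<longlonglongrightarrow> of_real (norm (s z))"
      using lim le
    proof eventually_elim
      case (elim z)
      have "(\<lambda>n. t n z) \<longlonglongrightarrow> of_real (min (norm (s z)) (norm (f z)))"
        unfolding t_def by (intro tendsto_intros elim)
      then show ?case using elim by simp
    qed
  qed measurable
  then have "(\<lambda>n. ennreal (\<alpha> (t n))) \<longlonglongrightarrow> ennreal (\<alpha> s)"
    using alpha_norm[OF Linfty_simple[OF s]] by (intro tendsto_ennrealI) simp
  moreover have "ennreal (\<alpha> (t n)) \<le> c" for n
  proof -
    have "ennreal (\<alpha> (t n)) = p (t n)" using tC by (intro p_Linfty[symmetric] LinftyI) auto
    also have "\<dots> \<le> p (u n)" by (rule p_mono) (simp add: t_def)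
    finally show ?thesis using u(2) order_trans by blast
  qed
  ultimately show "ennreal (\<alpha> s) \<le> c" by (intro Lim_bounded[of _ _ 0]) auto
qed

lemma p_trunc_le: "p (trunc n f) \<le> p f"
  by (rule p_mono) (simp add: norm_trunc_le)

text \<open>A simple function below the sum does not split into simple functions below the summands;
  truncations reduce the claim to \<open>\<alpha>\<close>, and Fatou removes them.\<close>

lemma p_add:
  assumes [measurable]: "f \<in> circle_borel" "g \<in> circle_borel"
  shows "p (\<lambda>z. f z + g z) \<le> p f + p g"
proof (rule p_Fatou[where u="\<lambda>n z. trunc n f z + trunc n g z"])
  fix n
  have L: "trunc n f \<in> Linfty" "trunc n g \<in> Linfty" by (auto intro: trunc_Linfty)
  have "p (\<lambda>z. trunc n f z + trunc n g z) = ennreal (\<alpha> (\<lambda>z. trunc n f z + trunc n g z))"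
    by (intro p_Linfty Linfty_add L)
  also have "\<dots> \<le> ennreal (\<alpha> (trunc n f) + \<alpha> (trunc n g))" by (intro ennreal_leI alpha_add L)
  also have "\<dots> = p (trunc n f) + p (trunc n g)" using L by (simp add: p_Linfty alpha_nonneg)
  also have "\<dots> \<le> p f + p g" by (intro add_mono p_trunc_le)
  finally show "p (\<lambda>z. trunc n f z + trunc n g z) \<le> p f + p g" .
  show "(\<lambda>z. trunc n f z + trunc n g z) \<in> circle_borel" by measurable
  show "AE z in \<mu>. (\<lambda>n. trunc n f z + trunc n g z) \<longlonglongrightarrow> f z + g z"
    by (rule AE_I2) (rule tendsto_add[OF trunc_tendsto trunc_tendsto])
qed

lemma p_zero: "p (\<lambda>z. 0) = 0"
  using p_Linfty[OF Linfty_const, of 0] alpha_const[of 0] by simp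

lemma p_cmult:
  assumes f: "f \<in> circle_borel"
  shows "p (\<lambda>z. c * f z) = ennreal (norm c) * p f"
proof -
  have le: "p (\<lambda>z. c * f z) \<le> ennreal (norm c) * p f" if f: "f \<in> circle_borel" for c f
  proof (rule p_Fatou[where u="\<lambda>n z. c * trunc n f z"])
    fix n
    have L: "trunc n f \<in> Linfty" using f by (rule trunc_Linfty)
    have "p (\<lambda>z. c * trunc n f z) = ennreal (norm c) * p (trunc n f)"
      using L by (simp add: p_Linfty Linfty_cmult alpha_cmult ennreal_mult alpha_nonneg)
    also have "\<dots> \<le> ennreal (norm c) * p f" by (intro mult_left_mono p_trunc_le) simp
    finally show "p (\<lambda>z. c * trunc n f z) \<le> ennreal (norm c) * p f" .
    show "(\<lambda>z. c * trunc n f z) \<in> circle_borel" using f by measurable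
    show "AE z in \<mu>. (\<lambda>n. c * trunc n f z) \<longlonglongrightarrow> c * f z"
      by (rule AE_I2) (rule tendsto_mult[OF tendsto_const trunc_tendsto])
  qed
  show ?thesis
  proof (cases "c = 0")
    case True then show ?thesis by (simp add: p_zero)
  next
    case False
    have "ennreal (norm c) * p (\<lambda>z. inverse c * (c * f z)) \<le> ennreal (norm c) * (ennreal (norm (inverse c)) * p (\<lambda>z. c * f z))"
      using f by (intro mult_left_mono le) auto
    also have "\<dots> = p (\<lambda>z. c * f z)"
      using False by (simp add: mult.assoc[symmetric] ennreal_mult[symmetric] norm_inverse)
    finally have "ennreal (norm c) * p f \<le> p (\<lambda>z. c * f z)"
      using False by (simp add: mult.assoc[symmetric])
    then show ?thesis using le[OF f, of c] by (rule antisym[rotated])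
  qed
qed

lemma p_minus_commute: "p (\<lambda>z. f z - g z) = p (\<lambda>z. g z - f z)"
  by (rule p_cong) (simp add: norm_minus_commute)

lemma p_triangle:
  assumes "f \<in> circle_borel" "g \<in> circle_borel" "h \<in> circle_borel"
  shows "p (\<lambda>z. f z - h z) \<le> p (\<lambda>z. f z - g z) + p (\<lambda>z. g z - h z)"
  using p_add[of "\<lambda>z. f z - g z" "\<lambda>z. g z - h z"] assms by simp

lemma nn_integral_le_p:
  assumes f: "f \<in> circle_borel"
  shows "(\<integral>\<^sup>+z. ennreal (norm (f z)) \<partial>\<mu>) \<le> p f"
proof -
  have le: "(\<integral>\<^sup>+z. ennreal (norm (trunc n f z)) \<partial>\<mu>) \<le> p f" for n
  proof -
    have L: "trunc n f \<in> Linfty" using f by (rule trunc_Linfty)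
    have "(\<integral>\<^sup>+z. ennreal (norm (trunc n f z)) \<partial>\<mu>) = ennreal (LINT z|\<mu>. norm (trunc n f z))"
      using Linfty_integrable[OF L] by (intro nn_integral_eq_integral) auto
    also have "\<dots> \<le> ennreal (\<alpha> (trunc n f))" by (intro ennreal_leI alpha_ge_L1 L)
    also have "\<dots> \<le> p f" using L p_trunc_le by (simp flip: p_Linfty)
    finally show ?thesis .
  qed
  have "(\<integral>\<^sup>+z. ennreal (norm (f z)) \<partial>\<mu>)
      = (\<integral>\<^sup>+z. liminf (\<lambda>n. ennreal (norm (trunc n f z))) \<partial>\<mu>)"
  proof (rule nn_integral_cong)
    fix z
    have "(\<lambda>n. ennreal (norm (trunc n f z))) \<longlonglongrightarrow> ennreal (norm (f z))"
      by (intro tendsto_ennrealI tendsto_norm trunc_tendsto)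
    then show "ennreal (norm (f z)) = liminf (\<lambda>n. ennreal (norm (trunc n f z)))"
      by (rule lim_imp_Liminf[OF sequentially_bot, symmetric])
  qed
  also have "\<dots> \<le> liminf (\<lambda>n. \<integral>\<^sup>+z. ennreal (norm (trunc n f z)) \<partial>\<mu>)"
    using f by (intro nn_integral_liminf) measurable
  also have "\<dots> \<le> p f" using le by (intro Liminf_le) auto
  finally show ?thesis .
qed

section \<open>The large space and the closure of the bounded functions\<close>

lemma cL_spaceI: "f \<in> circle_borel \<Longrightarrow> p f < \<infinity> \<Longrightarrow> f \<in> cL_space \<alpha>"
  by (simp add: cL_space_def)

lemma cL_borel [measurable_dest]: "f \<in> cL_space \<alpha> \<Longrightarrow> f \<in> circle_borel"
  by (simp add: cL_space_def)

lemma cL_finite: "f \<in> cL_space \<alpha> \<Longrightarrow> p f < \<infinity>"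
  by (simp add: cL_space_def)

lemma cL_integrable:
  assumes "f \<in> cL_space \<alpha>" shows "integrable \<mu> f"
  using nn_integral_le_p[OF cL_borel[OF assms]] cL_finite[OF assms] cL_borel[OF assms]
  by (auto simp: integrable_iff_bounded intro: le_less_trans)

lemma integral_norm_le_p:
  assumes "f \<in> cL_space \<alpha>" shows "(LINT z|\<mu>. norm (f z)) \<le> enn2real (p f)"
proof -
  have "ennreal (LINT z|\<mu>. norm (f z)) = (\<integral>\<^sup>+z. ennreal (norm (f z)) \<partial>\<mu>)"
    using cL_integrable[OF assms] by (intro nn_integral_eq_integral[symmetric]) auto
  also have "\<dots> \<le> p f" by (rule nn_integral_le_p[OF cL_borel[OF assms]])
  also have "\<dots> = ennreal (enn2real (p f))" using cL_finite[OF assms] by (simp add: less_top)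
  finally show ?thesis by simp
qed

lemma cL_mono:
  assumes "g \<in> cL_space \<alpha>" "f \<in> circle_borel" "AE z in \<mu>. norm (f z) \<le> norm (g z)"
  shows "f \<in> cL_space \<alpha>"
  using p_mono[OF assms(3)] cL_finite[OF assms(1)] by (intro cL_spaceI assms(2)) (rule le_less_trans)

lemma Linfty_cL: "f \<in> Linfty \<Longrightarrow> f \<in> cL_space \<alpha>"
  by (intro cL_spaceI) (auto simp: p_Linfty Linfty_borel)

lemma cL_add: "f \<in> cL_space \<alpha> \<Longrightarrow> g \<in> cL_space \<alpha> \<Longrightarrow> (\<lambda>z. f z + g z) \<in> cL_space \<alpha>"
  using p_add[of f g] by (intro cL_spaceI) (auto simp: cL_space_def intro: le_less_trans)

lemma cL_cmult: "f \<in> cL_space \<alpha> \<Longrightarrow> (\<lambda>z. c * f z) \<in> cL_space \<alpha>"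
  using p_cmult[of f c] by (intro cL_spaceI) (auto simp: cL_space_def ennreal_mult_less_top)

lemma cL_diff: "f \<in> cL_space \<alpha> \<Longrightarrow> g \<in> cL_space \<alpha> \<Longrightarrow> (\<lambda>z. f z - g z) \<in> cL_space \<alpha>"
  using cL_add[of f "\<lambda>z. (-1) * g z"] cL_cmult[of g "-1"] by simp

lemma seminorm_closureI:
  assumes "f \<in> cL_space \<alpha>" "\<And>e::real. 0 < e \<Longrightarrow> \<exists>g\<in>S. p (\<lambda>z. f z - g z) < ennreal e"
  shows "f \<in> seminorm_closure \<alpha> S"
  unfolding seminorm_closure_def
proof (intro CollectI conjI allI impI assms(1))
  fix e :: ennreal assume e: "0 < e"
  then obtain r :: real where "0 < r" "ennreal r \<le> e"
    by (cases e) (auto simp: intro: that[of 1])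
  then show "\<exists>g\<in>S. p (\<lambda>z. f z - g z) < e" using assms(2)[of r] by (meson less_le_trans)
qed

lemma seminorm_closureD:
  assumes "f \<in> seminorm_closure \<alpha> S"
  shows "f \<in> cL_space \<alpha>" "0 < e \<Longrightarrow> \<exists>g\<in>S. p (\<lambda>z. f z - g z) < ennreal e"
  using assms by (auto simp: seminorm_closure_def)

lemma seminorm_closure_mono: "S \<subseteq> T \<Longrightarrow> seminorm_closure \<alpha> S \<subseteq> seminorm_closure \<alpha> T"
  by (auto simp: seminorm_closure_def) blast

lemma seminorm_closure_base:
  assumes "f \<in> cL_space \<alpha>" "f \<in> S" shows "f \<in> seminorm_closure \<alpha> S"
  using assms by (intro seminorm_closureI bexI[of _ f]) (auto simp: p_zero)

lemma seminorm_closure_add: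
  assumes S: "S \<subseteq> circle_borel" "\<And>f g. f \<in> S \<Longrightarrow> g \<in> S \<Longrightarrow> (\<lambda>z. f z + g z) \<in> S"
    and fg: "f \<in> seminorm_closure \<alpha> S" "g \<in> seminorm_closure \<alpha> S"
  shows "(\<lambda>z. f z + g z) \<in> seminorm_closure \<alpha> S"
proof (rule seminorm_closureI)
  show "(\<lambda>z. f z + g z) \<in> cL_space \<alpha>" by (intro cL_add seminorm_closureD(1)[OF fg(1)] seminorm_closureD(1)[OF fg(2)])
  fix e :: real assume e: "0 < e"
  obtain a b where ab: "a \<in> S" "p (\<lambda>z. f z - a z) < ennreal (e/2)" "b \<in> S" "p (\<lambda>z. g z - b z) < ennreal (e/2)"
    using seminorm_closureD(2)[OF fg(1), of "e/2"] seminorm_closureD(2)[OF fg(2), of "e/2"] e by auto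
  have [measurable]: "a \<in> circle_borel" "b \<in> circle_borel" "f \<in> circle_borel" "g \<in> circle_borel"
    using ab S fg seminorm_closureD(1) cL_borel by blast+
  have "p (\<lambda>z. (f z - a z) + (g z - b z)) \<le> p (\<lambda>z. f z - a z) + p (\<lambda>z. g z - b z)"
    by (intro p_add) measurable
  also have "\<dots> < ennreal (e/2) + ennreal (e/2)" using ab by (intro add_strict_mono)
  also have "\<dots> = ennreal e" using e by (simp flip: ennreal_plus)
  finally show "\<exists>h\<in>S. p (\<lambda>z. f z + g z - h z) < ennreal e"
    using S(2)[OF ab(1,3)] by (intro bexI[of _ "\<lambda>z. a z + b z"]) (simp_all add: algebra_simps)
qed

lemma seminorm_closure_cmult:
  assumes S: "S \<subseteq> circle_borel" "\<And>f. f \<in> S \<Longrightarrow> (\<lambda>z. c * f z) \<in> S"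
    and f: "f \<in> seminorm_closure \<alpha> S"
  shows "(\<lambda>z. c * f z) \<in> seminorm_closure \<alpha> S"
proof (rule seminorm_closureI)
  show "(\<lambda>z. c * f z) \<in> cL_space \<alpha>" by (intro cL_cmult seminorm_closureD(1)[OF f])
  fix e :: real assume e: "0 < e"
  obtain a where a: "a \<in> S" "p (\<lambda>z. f z - a z) < ennreal (e / (norm c + 1))"
    using seminorm_closureD(2)[OF f, of "e / (norm c + 1)"] e by (auto simp: add_nonneg_pos)
  have [measurable]: "a \<in> circle_borel" "f \<in> circle_borel"
    using a S f seminorm_closureD(1) cL_borel by blast+
  have "p (\<lambda>z. c * (f z - a z)) = ennreal (norm c) * p (\<lambda>z. f z - a z)"
    by (intro p_cmult) measurable
  also have "\<dots> \<le> ennreal (norm c) * ennreal (e / (norm c + 1))" using a by (intro mult_left_mono) auto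
  also have "\<dots> = ennreal (norm c * (e / (norm c + 1)))" using e by (subst ennreal_mult) auto
  also have "\<dots> < ennreal e"
  proof (rule ennreal_lessI[OF e])
    have "norm c * e < e * (norm c + 1)" using e by (simp add: algebra_simps)
    then show "norm c * (e / (norm c + 1)) < e" by (simp add: pos_divide_less_eq add_nonneg_pos)
  qed
  finally show "\<exists>h\<in>S. p (\<lambda>z. c * f z - h z) < ennreal e"
    using S(2)[OF a(1)] by (intro bexI[of _ "\<lambda>z. c * a z"]) (simp_all add: algebra_simps)
qed

lemma L_cL: "f \<in> L_space \<alpha> \<Longrightarrow> f \<in> cL_space \<alpha>"
  unfolding L_space_def by (rule seminorm_closureD)

lemma L_borel [measurable_dest]: "f \<in> L_space \<alpha> \<Longrightarrow> f \<in> circle_borel"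
  by (intro cL_borel L_cL)

lemma Linfty_L: "f \<in> Linfty \<Longrightarrow> f \<in> L_space \<alpha>"
  unfolding L_space_def by (intro seminorm_closure_base Linfty_cL)

lemma L_add: "f \<in> L_space \<alpha> \<Longrightarrow> g \<in> L_space \<alpha> \<Longrightarrow> (\<lambda>z. f z + g z) \<in> L_space \<alpha>"
  unfolding L_space_def by (rule seminorm_closure_add) (auto intro: Linfty_add Linfty_borel)

lemma L_cmult: "f \<in> L_space \<alpha> \<Longrightarrow> (\<lambda>z. c * f z) \<in> L_space \<alpha>"
  unfolding L_space_def by (rule seminorm_closure_cmult) (auto intro: Linfty_cmult Linfty_borel)

lemma L_diff: "f \<in> L_space \<alpha> \<Longrightarrow> g \<in> L_space \<alpha> \<Longrightarrow> (\<lambda>z. f z - g z) \<in> L_space \<alpha>"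
  using L_add[of f "\<lambda>z. (-1) * g z"] L_cmult[of g "-1"] by simp

text \<open>Clipping at height \<open>C\<close> is at least as good an approximation as any function bounded by \<open>C\<close>,
  also for a smaller function.\<close>

lemma L_clip:
  assumes g: "g \<in> L_space \<alpha>" and f: "f \<in> circle_borel"
    and le: "AE z in \<mu>. norm (f z) \<le> norm (g z)" and e: "0 < e"
  obtains C where "0 \<le> C" "p (\<lambda>z. f z - clip C f z) < ennreal e"
proof -
  obtain b where b: "b \<in> Linfty" "p (\<lambda>z. g z - b z) < ennreal e"
    using seminorm_closureD(2)[OF g[unfolded L_space_def] e] by auto
  obtain C where C: "0 \<le> C" "AE z in \<mu>. norm (b z) \<le> C"
    using LinftyD[OF b(1)] by metis
  have "p (\<lambda>z. f z - clip C f z) \<le> p (\<lambda>z. g z - b z)"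
  proof (rule p_mono)
    show "AE z in \<mu>. norm (f z - clip C f z) \<le> norm (g z - b z)"
      using le C(2)
    proof eventually_elim
      case (elim z)
      then show ?case
        using norm_triangle_ineq2[of "g z" "b z"] norm_ge_zero[of "g z - b z"]
        unfolding norm_clip(3)[OF C(1)] by linarith
    qed
  qed
  then show ?thesis using b C by (intro that) auto
qed

text \<open>The clips of \<open>f\<close> are bounded and approximate it as well as bounded
  functions approximate \<open>g\<close>. Only moduli enter, which later lets an analytic function
  stand in for \<open>f\<close>.\<close>

lemma L_ideal:
  assumes g: "g \<in> L_space \<alpha>" and f: "f \<in> circle_borel"
    and le: "AE z in \<mu>. norm (f z) \<le> norm (g z)"
  shows "f \<in> L_space \<alpha>"
  unfolding L_space_def
proof (rule seminorm_closureI)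
  show "f \<in> cL_space \<alpha>" by (rule cL_mono[OF L_cL[OF g] f le])
  fix e :: real assume "0 < e"
  from L_clip[OF g f le this] show "\<exists>g\<in>Linfty. p (\<lambda>z. f z - g z) < ennreal e"
    using clip_Linfty[OF f] by metis
qed

end

section \<open>The Hahn--Banach theorem\<close>

definition function_subspace :: "('a \<Rightarrow> complex) set \<Rightarrow> bool" where
  "function_subspace X \<longleftrightarrow> (\<lambda>z. 0) \<in> X \<and> (\<forall>f\<in>X. \<forall>g\<in>X. (\<lambda>z. f z + g z) \<in> X) \<and>
     (\<forall>c. \<forall>f\<in>X. (\<lambda>z. c * f z) \<in> X)"

lemma function_subspaceD:
  assumes "function_subspace X"
  shows "(\<lambda>z. 0) \<in> X" "f \<in> X \<Longrightarrow> g \<in> X \<Longrightarrow> (\<lambda>z. f z + g z) \<in> X" "f \<in> X \<Longrightarrow> (\<lambda>z. c * f z) \<in> X"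
  using assms by (auto simp: function_subspace_def)

text \<open>A real-linear functional dominated by \<open>q\<close> is treated as its graph. A graph closed under
  the linear operations and dominated by \<open>q\<close> is single-valued, since \<open>q 0 = 0\<close>.\<close>

lemma Hahn_Banach_real:
  fixes q :: "('a \<Rightarrow> complex) \<Rightarrow> real"
  assumes X: "function_subspace X"
    and q_add: "\<And>f g. f \<in> X \<Longrightarrow> g \<in> X \<Longrightarrow> q (\<lambda>z. f z + g z) \<le> q f + q g"
    and q_scale: "\<And>f r. f \<in> X \<Longrightarrow> 0 \<le> r \<Longrightarrow> q (\<lambda>z. of_real r * f z) = r * q f"
    and Y: "Y \<subseteq> X" "function_subspace Y"
    and u_add: "\<And>f g. f \<in> Y \<Longrightarrow> g \<in> Y \<Longrightarrow> u (\<lambda>z. f z + g z) = u f + u g"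
    and u_scale: "\<And>f r. f \<in> Y \<Longrightarrow> u (\<lambda>z. of_real r * f z) = r * u f"
    and u_le: "\<And>f. f \<in> Y \<Longrightarrow> u f \<le> q f"
  obtains U :: "('a \<Rightarrow> complex) \<Rightarrow> real" where
    "\<And>f g. f \<in> X \<Longrightarrow> g \<in> X \<Longrightarrow> U (\<lambda>z. f z + g z) = U f + U g"
    "\<And>f r. f \<in> X \<Longrightarrow> U (\<lambda>z. of_real r * f z) = r * U f"
    "\<And>f. f \<in> X \<Longrightarrow> U f \<le> q f" "\<And>f. f \<in> Y \<Longrightarrow> U f = u f"
proof -
  define good :: "(('a \<Rightarrow> complex) \<times> real) set \<Rightarrow> bool" where
    "good G \<longleftrightarrow> (\<forall>f\<in>Y. (f, u f) \<in> G) \<and> (\<forall>f a. (f, a) \<in> G \<longrightarrow> f \<in> X \<and> a \<le> q f) \<and>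
      (\<forall>f a g b. (f, a) \<in> G \<longrightarrow> (g, b) \<in> G \<longrightarrow> ((\<lambda>z. f z + g z), a + b) \<in> G) \<and>
      (\<forall>f a r. (f, a) \<in> G \<longrightarrow> ((\<lambda>z. of_real r * f z), r * a) \<in> G)" for G
  have goodD: "f \<in> Y \<Longrightarrow> (f, u f) \<in> G" "(f, a) \<in> G \<Longrightarrow> f \<in> X" "(f, a) \<in> G \<Longrightarrow> a \<le> q f"
    "(f, a) \<in> G \<Longrightarrow> (g, b) \<in> G \<Longrightarrow> ((\<lambda>z. f z + g z), a + b) \<in> G"
    "(f, a) \<in> G \<Longrightarrow> ((\<lambda>z. of_real r * f z), r * a) \<in> G" if "good G" for G f a g b r
    using that unfolding good_def by blast+
  have X0: "(\<lambda>z. 0) \<in> X" using function_subspaceD(1)[OF X] .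
  have q0: "q (\<lambda>z. 0) = 0" using q_scale[OF X0, of 0] by simp
  have "\<exists>M\<in>Collect good. \<forall>G\<in>Collect good. M \<subseteq> G \<longrightarrow> G = M"
  proof (rule subset_Zorn_nonempty)
    have "good {(f, u f) |f. f \<in> Y}"
      unfolding good_def using Y u_add u_scale u_le function_subspaceD(2,3)[OF Y(2)] by auto
    then show "Collect good \<noteq> {}" by blast
  next
    fix \<C> assume ne: "\<C> \<noteq> {}" and ch: "subset.chain (Collect good) \<C>"
    have g: "good G" if "G \<in> \<C>" for G using ch that by (auto simp: subset.chain_def)
    have add: "((\<lambda>z. f z + g z), a + b) \<in> \<Union>\<C>" if fg: "(f, a) \<in> \<Union>\<C>" "(g, b) \<in> \<Union>\<C>" for f a g b
    proof -
      obtain G H where GH: "G \<in> \<C>" "H \<in> \<C>" "(f, a) \<in> G" "(g, b) \<in> H" using fg by blast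
      then have "G \<subseteq> H \<or> H \<subseteq> G" using ch by (auto simp: subset.chain_def)
      then show ?thesis using GH goodD(4)[OF g] by blast
    qed
    have "good (\<Union>\<C>)"
      unfolding good_def
    proof (intro conjI ballI allI impI)
      show "(f, u f) \<in> \<Union>\<C>" if "f \<in> Y" for f using ne goodD(1)[OF g that] by blast
      show "f \<in> X" "a \<le> q f" if "(f, a) \<in> \<Union>\<C>" for f a using that goodD(2,3)[OF g] by blast+
      show "((\<lambda>z. of_real r * f z), r * a) \<in> \<Union>\<C>" if "(f, a) \<in> \<Union>\<C>" for f a r
        using that goodD(5)[OF g] by blast
    qed (rule add)
    then show "\<Union>\<C> \<in> Collect good" by simp
  qed
  then obtain M where M: "good M" and max: "\<And>G. good G \<Longrightarrow> M \<subseteq> G \<Longrightarrow> G = M" by blast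
  note MD = goodD[OF M]
  have uniq: "a = b" if ab: "(f, a) \<in> M" "(f, b) \<in> M" for f a b
  proof -
    have *: "a - b \<le> 0" if "(f, a) \<in> M" "(f, b) \<in> M" for a b
      using MD(3)[OF MD(4)[OF that(1) MD(5)[OF that(2), of "-1"]]] q0 by simp
    show ?thesis using *[OF ab] *[OF ab(2,1)] by simp
  qed
  have dom: "\<exists>a. (x, a) \<in> M" if x: "x \<in> X" for x
  proof (rule ccontr)
    assume nx: "\<nexists>a. (x, a) \<in> M"
    have sX: "(\<lambda>z. f z + of_real t * x z) \<in> X" if "f \<in> X" for f t
      by (rule function_subspaceD(2)[OF X that function_subspaceD(3)[OF X x]])
    have sep: "a - q (\<lambda>z. f z + of_real (-1) * x z) \<le> q (\<lambda>z. g z + of_real 1 * x z) - b"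
      if "(f, a) \<in> M" "(g, b) \<in> M" for f a g b
    proof -
      have "a + b \<le> q (\<lambda>z. f z + g z)" using MD(3)[OF MD(4)[OF that]] .
      also have "(\<lambda>z. f z + g z) = (\<lambda>z. (f z + of_real (-1) * x z) + (g z + of_real 1 * x z))" by auto
      also have "q \<dots> \<le> q (\<lambda>z. f z + of_real (-1) * x z) + q (\<lambda>z. g z + of_real 1 * x z)"
        using that MD(2) by (intro q_add sX) auto
      finally show ?thesis by simp
    qed
    have 0: "((\<lambda>z. 0), u (\<lambda>z. 0)) \<in> M" using function_subspaceD(1)[OF Y(2)] MD(1) by blast
    \<comment> \<open>An admissible value of the extension at \<open>x\<close> must lie between
      these lower bounds and the upper bounds of \<open>sep\<close>; the supremum does.\<close>
    define c where "c = (SUP (f, a)\<in>M. a - q (\<lambda>z. f z + of_real (-1) * x z))"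
    have bdd: "bdd_above ((\<lambda>(f, a). a - q (\<lambda>z. f z + of_real (-1) * x z)) ` M)"
      using sep[OF _ 0] by (auto intro!: bdd_aboveI2)
    have c1: "a - q (\<lambda>z. f z + of_real (-1) * x z) \<le> c" if "(f, a) \<in> M" for f a
      unfolding c_def using cSUP_upper[OF that bdd] by simp
    have c2: "c \<le> q (\<lambda>z. g z + of_real 1 * x z) - b" if "(g, b) \<in> M" for g b
      unfolding c_def using 0 sep that by (intro cSUP_least) auto
    define G where "G = {((\<lambda>z. f z + of_real t * x z), a + t * c) |f a t. (f, a) \<in> M}"
    have GI: "h \<in> G" if "(f, a) \<in> M" "h = ((\<lambda>z. f z + of_real t * x z), a + t * c)" for h f a t
      unfolding G_def using that by blast
    have MG: "M \<subseteq> G"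
    proof
      fix h assume "h \<in> M" then show "h \<in> G" by (intro GI[of "fst h" "snd h" h 0]) (auto simp: prod_eq_iff)
    qed
    \<comment> \<open>Homogeneity of \<open>q\<close> reduces \<open>t > 0\<close> to the upper
      bound on \<open>c\<close> and \<open>t < 0\<close> to the lower bound.\<close>
    have dominated: "a + t * c \<le> q (\<lambda>z. f z + of_real t * x z)" if fa: "(f, a) \<in> M" for f a t
    proof -
      consider "t = 0" | "t > 0" | "t < 0" by linarith
      then show ?thesis
      proof cases
        case 1 then show ?thesis using MD(3)[OF fa] by simp
      next
        case 2
        have "a + t * c = t * ((1/t) * a + c)" using 2 by (simp add: field_simps)
        also have "\<dots> \<le> t * q (\<lambda>z. of_real (1/t) * f z + of_real 1 * x z)"
          using c2[OF MD(5)[OF fa, of "1/t"]] 2 by (intro mult_left_mono) auto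
        also have "\<dots> = q (\<lambda>z. of_real t * (of_real (1/t) * f z + of_real 1 * x z))"
          using 2 by (intro q_scale[symmetric] sX MD(2)[OF MD(5)[OF fa]]) simp
        also have "(\<lambda>z. of_real t * (of_real (1/t) * f z + of_real 1 * x z)) = (\<lambda>z. f z + of_real t * x z)"
          using 2 by (auto simp: algebra_simps)
        finally show ?thesis .
      next
        case 3
        define s where "s = - t"
        have s: "s > 0" using 3 by (simp add: s_def)
        have "a + t * c = s * ((1/s) * a - c)" using s by (simp add: field_simps s_def)
        also have "\<dots> \<le> s * q (\<lambda>z. of_real (1/s) * f z + of_real (-1) * x z)"
          using c1[OF MD(5)[OF fa, of "1/s"]] s by (intro mult_left_mono) auto
        also have "\<dots> = q (\<lambda>z. of_real s * (of_real (1/s) * f z + of_real (-1) * x z))"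
          using s by (intro q_scale[symmetric] sX MD(2)[OF MD(5)[OF fa]]) simp
        also have "(\<lambda>z. of_real s * (of_real (1/s) * f z + of_real (-1) * x z)) = (\<lambda>z. f z + of_real t * x z)"
          using s by (auto simp: algebra_simps s_def)
        finally show ?thesis .
      qed
    qed
    have "good G"
      unfolding good_def
    proof (intro conjI ballI allI impI)
      show "(f, u f) \<in> G" if "f \<in> Y" for f using MD(1)[OF that] MG by blast
      show "f \<in> X" "a \<le> q f" if "(f, a) \<in> G" for f a
        using that sX MD(2) dominated unfolding G_def by blast+
      show "((\<lambda>z. f z + g z), a + b) \<in> G" if "(f, a) \<in> G" "(g, b) \<in> G" for f a g b
      proof -
        obtain f' a' t g' b' s where *: "(f', a') \<in> M" "f = (\<lambda>z. f' z + of_real t * x z)" "a = a' + t * c"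
          "(g', b') \<in> M" "g = (\<lambda>z. g' z + of_real s * x z)" "b = b' + s * c"
          using \<open>(f, a) \<in> G\<close> \<open>(g, b) \<in> G\<close> unfolding G_def by blast
        show ?thesis
          by (rule GI[OF MD(4)[OF *(1,4)], of _ "t + s"]) (simp add: * algebra_simps)
      qed
      show "((\<lambda>z. of_real r * f z), r * a) \<in> G" if fa: "(f, a) \<in> G" for f a r
      proof -
        obtain f' a' t where *: "(f', a') \<in> M" "f = (\<lambda>z. f' z + of_real t * x z)" "a = a' + t * c"
          using fa unfolding G_def by blast
        show ?thesis
          by (rule GI[OF MD(5)[OF *(1), of r], of _ "r * t"]) (simp add: * algebra_simps)
      qed
    qed
    then have "G = M" using MG by (rule max)
    moreover have "(x, u (\<lambda>z. 0) + 1 * c) \<in> G" by (rule GI[OF 0, of _ 1]) simp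
    ultimately show False using nx by blast
  qed
  define U where "U f = (THE a. (f, a) \<in> M)" for f
  have UM: "(f, U f) \<in> M" if "f \<in> X" for f
    unfolding U_def using dom[OF that] uniq by (metis (mono_tags, lifting) theI)
  have UI: "U f = a" if "(f, a) \<in> M" for f a
    using UM[OF MD(2)[OF that]] that by (rule uniq)
  show ?thesis
  proof (rule that[of U])
    show "U (\<lambda>z. f z + g z) = U f + U g" if "f \<in> X" "g \<in> X" for f g
      by (rule UI[OF MD(4)[OF UM UM]]) (rule that)+
    show "U (\<lambda>z. of_real r * f z) = r * U f" if "f \<in> X" for f r
      by (rule UI[OF MD(5)[OF UM]]) (rule that)
    show "U f \<le> q f" if "f \<in> X" for f by (rule MD(3)[OF UM[OF that]])
    show "U f = u f" if "f \<in> Y" for f by (rule UI[OF MD(1)[OF that]])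
  qed
qed

text \<open>A complex-linear functional is determined by its real part \<open>V\<close> as f -> V f
  - i V (i f). Multiplying \<open>f\<close> by a unimodular scalar that makes the value real and
  nonnegative transfers the bound from the real part to the modulus.\<close>

lemma Hahn_Banach_complex:
  fixes q :: "('a \<Rightarrow> complex) \<Rightarrow> real"
  assumes X: "function_subspace X"
    and q_add: "\<And>f g. f \<in> X \<Longrightarrow> g \<in> X \<Longrightarrow> q (\<lambda>z. f z + g z) \<le> q f + q g"
    and q_scale: "\<And>f c. f \<in> X \<Longrightarrow> q (\<lambda>z. c * f z) = norm c * q f"
    and Y: "Y \<subseteq> X" "function_subspace Y"
    and u_add: "\<And>f g. f \<in> Y \<Longrightarrow> g \<in> Y \<Longrightarrow> u (\<lambda>z. f z + g z) = u f + u g"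
    and u_scale: "\<And>f c. f \<in> Y \<Longrightarrow> u (\<lambda>z. c * f z) = c * u f"
    and u_le: "\<And>f. f \<in> Y \<Longrightarrow> norm (u f) \<le> q f"
  obtains U :: "('a \<Rightarrow> complex) \<Rightarrow> complex" where
    "\<And>f g. f \<in> X \<Longrightarrow> g \<in> X \<Longrightarrow> U (\<lambda>z. f z + g z) = U f + U g"
    "\<And>f c. f \<in> X \<Longrightarrow> U (\<lambda>z. c * f z) = c * U f"
    "\<And>f. f \<in> X \<Longrightarrow> norm (U f) \<le> q f" "\<And>f. f \<in> Y \<Longrightarrow> U f = u f"
proof -
  obtain V :: "('a \<Rightarrow> complex) \<Rightarrow> real" where V_add: "\<And>f g. f \<in> X \<Longrightarrow> g \<in> X \<Longrightarrow> V (\<lambda>z. f z + g z) = V f + V g"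
    and V_scale: "\<And>f r. f \<in> X \<Longrightarrow> V (\<lambda>z. of_real r * f z) = r * V f"
    and V_le: "\<And>f. f \<in> X \<Longrightarrow> V f \<le> q f" and V_Y: "\<And>f. f \<in> Y \<Longrightarrow> V f = Re (u f)"
  proof (rule Hahn_Banach_real[OF X q_add _ Y, where u="\<lambda>f. Re (u f)"])
    show "Re (u f) \<le> q f" if "f \<in> Y" for f using u_le[OF that] complex_Re_le_cmod order_trans by blast
  qed (use q_scale u_add u_scale in auto)
  have cX: "(\<lambda>z. c * f z) \<in> X" if "f \<in> X" for c f using function_subspaceD(3)[OF X that] .
  define U where "U f = Complex (V f) (- V (\<lambda>z. \<i> * f z))" for f
  have Vc: "V (\<lambda>z. c * f z) = Re c * V f + Im c * V (\<lambda>z. \<i> * f z)" if f: "f \<in> X" for c f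
  proof -
    have "(\<lambda>z. c * f z) = (\<lambda>z. of_real (Re c) * f z + of_real (Im c) * (\<i> * f z))"
    proof
      fix z
      have "c * f z = (of_real (Re c) + \<i> * of_real (Im c)) * f z" by (simp only: complex_eq[symmetric])
      then show "c * f z = of_real (Re c) * f z + of_real (Im c) * (\<i> * f z)" by (simp add: algebra_simps)
    qed
    then have "V (\<lambda>z. c * f z) = V (\<lambda>z. of_real (Re c) * f z) + V (\<lambda>z. of_real (Im c) * (\<i> * f z))"
      using V_add[OF cX[OF f] cX[OF cX[OF f]]] by simp
    then show ?thesis by (simp only: V_scale[OF f] V_scale[OF cX[OF f]])
  qed
  have U_add: "U (\<lambda>z. f z + g z) = U f + U g" if "f \<in> X" "g \<in> X" for f g
    unfolding U_def using V_add[OF that] V_add[OF cX[OF that(1)] cX[OF that(2)], of \<i> \<i>]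
    by (simp add: complex_eq_iff distrib_left)
  have U_scale: "U (\<lambda>z. c * f z) = c * U f" if f: "f \<in> X" for f c
    unfolding U_def using Vc[OF f, of c] Vc[OF f, of "\<i> * c"] by (simp add: complex_eq_iff mult.assoc)
  have U_le: "norm (U f) \<le> q f" if f: "f \<in> X" for f
  proof (cases "U f = 0")
    case True
    have "q (\<lambda>z. 0 * f z) = 0" using q_scale[OF f, of 0] by simp
    moreover have "q (\<lambda>z. f z + (-1) * f z) \<le> q f + q (\<lambda>z. (-1) * f z)" using f by (intro q_add cX)
    ultimately have "0 \<le> q f" using q_scale[OF f, of "-1"] by simp
    then show ?thesis using True by simp
  next
    case False
    define w where "w = cnj (U f) / norm (U f)"
    have "norm w = 1" using False by (simp add: w_def norm_divide)
    moreover have "w * U f = of_real (norm (U f))"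
      using False complex_norm_square[of "U f"]
      by (simp add: w_def power2_eq_square mult.commute nonzero_divide_eq_eq)
    ultimately have w: "norm w = 1" "w * U f = of_real (norm (U f))" .
    have "norm (U f) = Re (U (\<lambda>z. w * f z))" using w(2) by (simp add: U_scale[OF f])
    also have "\<dots> = V (\<lambda>z. w * f z)" by (simp add: U_def)
    also have "\<dots> \<le> q (\<lambda>z. w * f z)" by (intro V_le cX f)
    also have "\<dots> = q f" using q_scale[OF f, of w] w(1) by simp
    finally show ?thesis .
  qed
  have "U f = u f" if f: "f \<in> Y" for f
    using V_Y[OF f] V_Y[OF function_subspaceD(3)[OF Y(2) f], of \<i>] u_scale[OF f, of \<i>]
    by (simp add: U_def complex_eq_iff)
  then show ?thesis using that U_add U_scale U_le by blast
qed

section \<open>The Koethe dual\<close>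

context rotational_seminorm
begin

lemma L_subspace: "function_subspace (L_space \<alpha>)"
  unfolding function_subspace_def using L_add L_cmult Linfty_L[OF Linfty_const[of 0]] by blast

lemma real_p_add:
  assumes "f \<in> cL_space \<alpha>" "g \<in> cL_space \<alpha>"
  shows "enn2real (p (\<lambda>z. f z + g z)) \<le> enn2real (p f) + enn2real (p g)"
proof -
  have "enn2real (p (\<lambda>z. f z + g z)) \<le> enn2real (p f + p g)"
    using p_add[OF cL_borel[OF assms(1)] cL_borel[OF assms(2)]] cL_finite[OF assms(1)] cL_finite[OF assms(2)]
    by (intro enn2real_mono) auto
  then show ?thesis using cL_finite[OF assms(1)] cL_finite[OF assms(2)] by (simp add: enn2real_plus)
qed

lemma real_p_cmult: "f \<in> cL_space \<alpha> \<Longrightarrow> enn2real (p (\<lambda>z. c * f z)) = norm c * enn2real (p f)"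
  by (simp add: p_cmult cL_borel enn2real_mult)

lemma dual_extension:
  assumes Y: "Y \<subseteq> L_space \<alpha>" "function_subspace Y" and \<phi>: "\<phi> \<in> dual_space Y p"
  obtains \<psi> where "\<psi> \<in> dual_space (L_space \<alpha>) p" "\<And>f. f \<in> Y \<Longrightarrow> \<psi> f = \<phi> f"
proof -
  obtain C where C: "\<And>f. f \<in> Y \<Longrightarrow> norm (\<phi> f) \<le> C * enn2real (p f)"
    using \<phi> unfolding dual_space_def by blast
  \<comment> \<open>When \<open>p\<close> vanishes on \<open>Y\<close> the constant may be negative,
    and then it would not give a sublinear majorant on the whole space.\<close>
  have C': "norm (\<phi> f) \<le> \<bar>C\<bar> * enn2real (p f)" if "f \<in> Y" for f
    using C[OF that] by (rule order_trans) (intro mult_right_mono, auto)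
  obtain \<psi> where "\<And>f g. f \<in> L_space \<alpha> \<Longrightarrow> g \<in> L_space \<alpha> \<Longrightarrow> \<psi> (\<lambda>z. f z + g z) = \<psi> f + \<psi> g"
    "\<And>f c. f \<in> L_space \<alpha> \<Longrightarrow> \<psi> (\<lambda>z. c * f z) = c * \<psi> f"
    "\<And>f. f \<in> L_space \<alpha> \<Longrightarrow> norm (\<psi> f) \<le> \<bar>C\<bar> * enn2real (p f)" "\<And>f. f \<in> Y \<Longrightarrow> \<psi> f = \<phi> f"
  proof (rule Hahn_Banach_complex[OF L_subspace _ _ Y, where u=\<phi> and q="\<lambda>f. \<bar>C\<bar> * enn2real (p f)"])
    show "\<bar>C\<bar> * enn2real (p (\<lambda>z. f z + g z)) \<le> \<bar>C\<bar> * enn2real (p f) + \<bar>C\<bar> * enn2real (p g)"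
      if "f \<in> L_space \<alpha>" "g \<in> L_space \<alpha>" for f g
      using mult_left_mono[OF real_p_add[OF that[THEN L_cL]], of "\<bar>C\<bar>"] by (simp add: distrib_left)
  qed (use \<phi> C' in \<open>auto simp: dual_space_def real_p_cmult L_cL\<close>)
  then show ?thesis using that[of \<psi>] unfolding dual_space_def by blast
qed

text \<open>Hahn--Banach applied to the line spanned by \<open>b\<close>. Its elements are genuine
  functions and not classes, so the scalar can be read off at a point where \<open>b\<close> does
  not vanish.\<close>

lemma norming_functional:
  assumes b: "b \<in> Linfty"
  obtains \<psi> where "\<psi> \<in> dual_space (L_space \<alpha>) p" "\<And>f. f \<in> L_space \<alpha> \<Longrightarrow> norm (\<psi> f) \<le> enn2real (p f)"
    "\<psi> b = \<alpha> b"
proof (cases "b = (\<lambda>z. 0)")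
  case True
  then have "\<alpha> b = 0" using alpha_const[of 0] by simp
  then show ?thesis by (intro that[of "\<lambda>f. 0"]) (auto simp: dual_space_def intro: exI[of _ 0])
next
  case False
  then obtain z0 where z0: "b z0 \<noteq> 0" by auto
  define Y where "Y = range (\<lambda>c z. c * b z)"
  have Y: "Y \<subseteq> L_space \<alpha>" using b by (auto simp: Y_def intro: Linfty_L Linfty_cmult)
  have Ys: "function_subspace Y"
    unfolding function_subspace_def
  proof (intro conjI ballI allI)
    show "(\<lambda>z. 0) \<in> Y" unfolding Y_def by (rule image_eqI[of _ _ 0]) auto
    show "(\<lambda>z. f z + g z) \<in> Y" if "f \<in> Y" "g \<in> Y" for f g
    proof -
      obtain c d where "f = (\<lambda>z. c * b z)" "g = (\<lambda>z. d * b z)" using \<open>f \<in> Y\<close> \<open>g \<in> Y\<close> by (auto simp: Y_def)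
      then show ?thesis unfolding Y_def by (intro image_eqI[of _ _ "c + d"]) (auto simp: distrib_right)
    qed
    show "(\<lambda>z. c * f z) \<in> Y" if fY: "f \<in> Y" for c f
    proof -
      obtain d where "f = (\<lambda>z. d * b z)" using fY by (auto simp: Y_def)
      then show ?thesis unfolding Y_def by (intro image_eqI[of _ _ "c * d"]) (auto simp: mult.assoc)
    qed
  qed
  define u where "u f = f z0 / b z0 * of_real (\<alpha> b)" for f :: "complex \<Rightarrow> complex"
  obtain \<psi> where \<psi>: "\<And>f g. f \<in> L_space \<alpha> \<Longrightarrow> g \<in> L_space \<alpha> \<Longrightarrow> \<psi> (\<lambda>z. f z + g z) = \<psi> f + \<psi> g"
    "\<And>f c. f \<in> L_space \<alpha> \<Longrightarrow> \<psi> (\<lambda>z. c * f z) = c * \<psi> f"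
    "\<And>f. f \<in> L_space \<alpha> \<Longrightarrow> norm (\<psi> f) \<le> enn2real (p f)" "\<And>f. f \<in> Y \<Longrightarrow> \<psi> f = u f"
  proof (rule Hahn_Banach_complex[OF L_subspace _ _ Y Ys, where u=u and q="\<lambda>f. enn2real (p f)"])
    show "norm (u f) \<le> enn2real (p f)" if "f \<in> Y" for f
    proof -
      obtain c where "f = (\<lambda>z. c * b z)" using \<open>f \<in> Y\<close> by (auto simp: Y_def)
      then show ?thesis
        using z0 b alpha_nonneg[OF b] by (simp add: u_def norm_mult p_Linfty Linfty_cmult alpha_cmult)
    qed
  qed (auto simp: u_def real_p_cmult L_cL add_divide_distrib distrib_right intro: real_p_add)
  have "b \<in> Y" unfolding Y_def by (rule image_eqI[of _ _ 1]) auto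
  then have "\<psi> b = \<alpha> b" using \<psi>(4) z0 by (simp add: u_def)
  then show ?thesis using \<psi>(1,2,3) by (intro that[of \<psi>]) (auto simp: dual_space_def intro!: exI[of _ 1])
qed

text \<open>\<open>C\<close> bounds the norm of \<open>g\<close> as a functional. All measurable
  \<open>f\<close> are tested, so the pairing is available on the large space and not merely on the
  closure of the bounded functions.\<close>

definition koethe :: "real \<Rightarrow> (complex \<Rightarrow> complex) \<Rightarrow> bool" where
  "koethe C g \<longleftrightarrow> g \<in> circle_borel \<and>
    (\<forall>f\<in>circle_borel. (\<integral>\<^sup>+z. ennreal (norm (f z * g z)) \<partial>\<mu>) \<le> ennreal C * p f)"

lemma koethe_integrable:
  assumes g: "koethe C g" and f: "f \<in> cL_space \<alpha>"
  shows "integrable \<mu> (\<lambda>z. f z * g z)"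
proof -
  have "(\<integral>\<^sup>+z. ennreal (norm (f z * g z)) \<partial>\<mu>) \<le> ennreal C * p f"
    using g f cL_borel by (auto simp: koethe_def)
  also have "\<dots> < \<infinity>" using cL_finite[OF f] by (auto simp: ennreal_mult_less_top)
  finally show ?thesis using g f cL_borel by (auto simp: integrable_iff_bounded koethe_def)
qed

lemma koethe_integral_le:
  assumes g: "koethe C g" and C: "0 \<le> C" and f: "f \<in> cL_space \<alpha>"
  shows "(LINT z|\<mu>. norm (f z * g z)) \<le> C * enn2real (p f)"
proof -
  have "ennreal (LINT z|\<mu>. norm (f z * g z)) = (\<integral>\<^sup>+z. ennreal (norm (f z * g z)) \<partial>\<mu>)"
    using koethe_integrable[OF g f] by (intro nn_integral_eq_integral[symmetric]) auto
  also have "\<dots> \<le> ennreal C * p f" using g f cL_borel by (auto simp: koethe_def)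
  also have "\<dots> = ennreal (C * enn2real (p f))" using C cL_finite[OF f] by (simp add: ennreal_mult less_top)
  finally show ?thesis using C by (simp add: mult_nonneg_nonneg)
qed

lemma koethe_dual:
  assumes g: "koethe C g" and C: "0 \<le> C" and X: "X \<subseteq> cL_space \<alpha>"
  shows "(\<lambda>f. LINT z|\<mu>. f z * g z) \<in> dual_space X p"
  unfolding dual_space_def
proof (intro CollectI conjI ballI allI exI[of _ C])
  fix f h assume "f \<in> X" "h \<in> X"
  then show "(LINT z|\<mu>. (f z + h z) * g z) = (LINT z|\<mu>. f z * g z) + (LINT z|\<mu>. h z * g z)"
    using koethe_integrable[OF g] X unfolding distrib_right by (intro Bochner_Integration.integral_add) auto
next
  fix f assume "f \<in> X"
  then show "norm (LINT z|\<mu>. f z * g z) \<le> C * enn2real (p f)"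
    using koethe_integral_le[OF g C] X by (intro order_trans[OF integral_norm_bound]) auto
qed (simp add: mult.assoc)

lemma koethe_indicator:
  assumes "E \<in> sets \<mu>" shows "koethe 1 (\<lambda>z. of_real (indicator E z))"
  unfolding koethe_def
proof (intro conjI ballI)
  fix f :: "complex \<Rightarrow> complex" assume "f \<in> circle_borel"
  then have "(\<integral>\<^sup>+z. ennreal (norm (f z)) \<partial>\<mu>) \<le> ennreal 1 * p f"
    using nn_integral_le_p by simp
  moreover have "(\<integral>\<^sup>+z. ennreal (norm (f z * of_real (indicator E z))) \<partial>\<mu>) \<le> (\<integral>\<^sup>+z. ennreal (norm (f z)) \<partial>\<mu>)"
    by (intro nn_integral_mono) (auto split: split_indicator)
  ultimately show "(\<integral>\<^sup>+z. ennreal (norm (f z * of_real (indicator E z))) \<partial>\<mu>) \<le> ennreal 1 * p f"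
    by (rule order_trans[rotated])
qed (use assms in measurable)

lemma koethe_norm_mono:
  assumes g: "koethe C g" and h: "h \<in> circle_borel" "\<And>z. norm (h z) \<le> norm (g z)"
  shows "koethe C h"
  unfolding koethe_def
proof (intro conjI ballI h(1))
  fix f :: "complex \<Rightarrow> complex" assume f: "f \<in> circle_borel"
  have "(\<integral>\<^sup>+z. ennreal (norm (f z * h z)) \<partial>\<mu>) \<le> (\<integral>\<^sup>+z. ennreal (norm (f z * g z)) \<partial>\<mu>)"
    using h(2) by (intro nn_integral_mono ennreal_leI) (auto simp: norm_mult intro: mult_left_mono)
  then show "(\<integral>\<^sup>+z. ennreal (norm (f z * h z)) \<partial>\<mu>) \<le> ennreal C * p f"
    using g f unfolding koethe_def by (elim conjE) (drule (1) bspec, rule order_trans)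
qed

text \<open>The set function \<open>\<nu>\<close> of values on indicators is countably additive
  because \<open>\<alpha>\<close> is continuous, and \<open>g\<close> is its density. The
  representation passes from simple to bounded functions by bounded convergence, and to the closure
  once the Koethe bound for \<open>g\<close> is known.\<close>

lemma dual_L_koethe:
  assumes \<phi>: "\<phi> \<in> dual_space (L_space \<alpha>) p"
    and C: "0 \<le> C" "\<And>f. f \<in> L_space \<alpha> \<Longrightarrow> norm (\<phi> f) \<le> C * enn2real (p f)"
  obtains g where "koethe C g" "\<And>f. f \<in> L_space \<alpha> \<Longrightarrow> \<phi> f = (LINT z|\<mu>. f z * g z)"
proof -
  have \<phi>_add: "\<phi> (\<lambda>z. f z + g z) = \<phi> f + \<phi> g" if "f \<in> L_space \<alpha>" "g \<in> L_space \<alpha>" for f g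
    using \<phi> that unfolding dual_space_def by blast
  have \<phi>_cmult: "\<phi> (\<lambda>z. c * f z) = c * \<phi> f" if "f \<in> L_space \<alpha>" for f c
    using \<phi> that unfolding dual_space_def by blast
  have \<phi>_diff: "\<phi> (\<lambda>z. f z - g z) = \<phi> f - \<phi> g" if "f \<in> L_space \<alpha>" "g \<in> L_space \<alpha>" for f g
    using \<phi>_add[OF that(1) L_cmult[OF that(2)], of "-1"] \<phi>_cmult[OF that(2), of "-1"] by simp
  have \<phi>_Linfty: "norm (\<phi> f) \<le> C * \<alpha> f" if "f \<in> Linfty" for f
    using C(2)[OF Linfty_L[OF that]] that by (simp add: p_Linfty alpha_nonneg)
  have \<phi>_sum: "\<phi> (\<lambda>z. \<Sum>j\<in>J. f j z) = (\<Sum>j\<in>J. \<phi> (f j))" if "finite J" "\<And>j. j \<in> J \<Longrightarrow> f j \<in> Linfty" for J and f :: "complex \<Rightarrow> complex \<Rightarrow> complex"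
    using that
  proof (induction J)
    case empty then show ?case using \<phi>_cmult[OF Linfty_L[OF Linfty_const], of 0 0] by simp
  next
    case (insert j J)
    then show ?case
      using \<phi>_add[OF Linfty_L[of "f j"] Linfty_L, of "\<lambda>z. \<Sum>j\<in>J. f j z"] alpha_sum[of J f] by simp
  qed
  define \<nu> where "\<nu> E = \<phi> (indicator E)" for E
  have \<nu>_add: "\<nu> (A \<union> B) = \<nu> A + \<nu> B" if "A \<in> sets \<mu>" "B \<in> sets \<mu>" "A \<inter> B = {}" for A B
  proof -
    have "(indicator (A \<union> B) :: complex \<Rightarrow> complex) = (\<lambda>z. indicator A z + indicator B z)"
      using that(3) by (intro ext) (auto split: split_indicator)
    then show ?thesis unfolding \<nu>_def using that by (simp add: \<phi>_add Linfty_L Linfty_indicator)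
  qed
  have \<nu>_empty: "\<nu> {} = 0"
    using \<nu>_add[of "{}" "{}"] by simp
  have \<nu>_sums: "(\<lambda>i. \<nu> (A i)) sums \<nu> (\<Union>i. A i)" if A: "range A \<subseteq> sets \<mu>" "disjoint_family A" for A
  proof -
    let ?U = "\<Union>i. A i" and ?V = "\<lambda>n. \<Union>i<n. A i"
    have AM: "A i \<in> sets \<mu>" for i using A by auto
    have fin: "(\<Sum>i<n. \<nu> (A i)) = \<nu> (?V n)" for n
    proof (induction n)
      case 0 then show ?case by (simp add: \<nu>_empty)
    next
      case (Suc n)
      have "\<nu> (?V n \<union> A n) = \<nu> (?V n) + \<nu> (A n)"
        using disjoint_family_UN_Int[OF A(2), of "{..<n}" "{n}"] AM by (intro \<nu>_add) auto
      moreover have "?V n \<union> A n = ?V (Suc n)" by (auto simp: less_Suc_eq)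
      ultimately show ?case using Suc by simp
    qed
    have VM: "?V n \<in> sets \<mu>" and UM: "?U \<in> sets \<mu>" for n
      using AM by auto
    have DM: "?U - ?V n \<in> sets \<mu>" for n by (rule sets.Diff[OF UM VM])
    \<comment> \<open>The remainders decrease to the empty set, so their indicators converge
      boundedly to 0.\<close>
    have "(\<lambda>n. \<alpha> (indicator (?U - ?V n))) \<longlonglongrightarrow> \<alpha> (\<lambda>z. 0)"
    proof (rule alpha_bounded_convergence[where C=1])
      show "indicator (?U - ?V n) \<in> circle_borel" for n by (rule borel_measurable_indicator[OF DM])
      show "AE z in \<mu>. norm (indicator (?U - ?V n) z :: complex) \<le> 1" for n
        by (rule AE_I2) (simp add: indicator_def)
      show "AE z in \<mu>. (\<lambda>n. indicator (?U - ?V n) z :: complex) \<longlonglongrightarrow> 0"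
      proof (rule AE_I2, rule tendsto_eventually)
        fix z
        show "\<forall>\<^sub>F n in sequentially. (indicator (?U - ?V n) z :: complex) = 0"
        proof (cases "z \<in> ?U")
          case True
          then obtain i where i: "z \<in> A i" by blast
          have "indicator (?U - ?V n) z = (0::complex)" if "i < n" for n
            using i that by (auto simp: indicator_def)
          then show ?thesis unfolding eventually_sequentially by (intro exI[of _ "Suc i"]) auto
        qed simp
      qed
    qed simp
    then have "(\<lambda>n. C * \<alpha> (indicator (?U - ?V n))) \<longlonglongrightarrow> C * \<alpha> (\<lambda>z. 0)"
      by (rule tendsto_mult[OF tendsto_const])
    then have lim: "(\<lambda>n. C * \<alpha> (indicator (?U - ?V n))) \<longlonglongrightarrow> 0"
      by (simp only: alpha_const norm_zero mult_zero_right)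
    have le: "norm ((\<Sum>i<n. \<nu> (A i)) - \<nu> ?U) \<le> C * \<alpha> (indicator (?U - ?V n))" for n
    proof -
      have "\<nu> ((?U - ?V n) \<union> ?V n) = \<nu> (?U - ?V n) + \<nu> (?V n)" by (intro \<nu>_add DM VM) blast
      moreover have "(?U - ?V n) \<union> ?V n = ?U" by blast
      ultimately have "\<nu> ?U = \<nu> (?U - ?V n) + \<nu> (?V n)" by (simp only:)
      then have "norm ((\<Sum>i<n. \<nu> (A i)) - \<nu> ?U) = norm (\<nu> (?U - ?V n))"
        unfolding fin by (metis add_diff_cancel_right' norm_minus_commute)
      also have "\<dots> \<le> C * \<alpha> (indicator (?U - ?V n))"
        unfolding \<nu>_def by (intro \<phi>_Linfty Linfty_indicator DM)
      finally show ?thesis .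
    qed
    have "(\<lambda>n. (\<Sum>i<n. \<nu> (A i)) - \<nu> ?U) \<longlonglongrightarrow> 0"
      by (rule Lim_null_comparison[OF always_eventually[OF allI[OF le]] lim])
    then show ?thesis unfolding sums_def by (rule LIM_zero_cancel)
  qed
  have \<nu>_null: "\<nu> A = 0" if "A \<in> null_sets \<mu>" for A
  proof -
    have AM: "A \<in> sets \<mu>" using that by auto
    have "AE z in \<mu>. norm (indicator A z :: complex) \<le> 0"
      using AE_not_in[OF that] by eventually_elim simp
    then have "\<alpha> (indicator A) \<le> 0" using AM by (intro alpha_le) auto
    then have "C * \<alpha> (indicator A) \<le> 0" using C(1) by (simp add: mult_nonneg_nonpos)
    then show ?thesis using \<phi>_Linfty[OF Linfty_indicator[OF AM]] norm_ge_zero[of "\<nu> A"]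
      unfolding \<nu>_def by (metis norm_le_zero_iff order_trans)
  qed
  have \<nu>_bound: "norm (\<nu> A) \<le> C" if "A \<in> sets \<mu>" for A
  proof -
    have "\<alpha> (indicator A) \<le> 1" using that by (intro alpha_le) (auto split: split_indicator)
    then have "C * \<alpha> (indicator A) \<le> C * 1" using C(1) by (rule mult_left_mono)
    then show ?thesis using \<phi>_Linfty[OF Linfty_indicator[OF that]] unfolding \<nu>_def by simp
  qed
  obtain g where g: "integrable \<mu> g"
    "\<And>E. E \<in> sets \<mu> \<Longrightarrow> (LINT z|\<mu>. indicator E z *\<^sub>R g z) = \<nu> E"
    using circle.Radon_Nikodym_complex_set_function[OF \<nu>_sums \<nu>_null \<nu>_bound] by blast
  have [measurable]: "g \<in> circle_borel" using g(1) by simp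
  have simple: "\<phi> s = (LINT z|\<mu>. s z * g z)" if s: "simple_function \<mu> s" for s
  proof -
    let ?J = "s ` space \<mu>"
    let ?E = "\<lambda>y. s -` {y} \<inter> space \<mu>"
    have fin: "finite ?J" using s by (rule simple_functionD)
    have E: "?E y \<in> sets \<mu>" for y using s by (rule simple_functionD)
    have L: "(\<lambda>z. y * indicator (?E y) z) \<in> Linfty" for y by (intro Linfty_cmult Linfty_indicator E)
    define t where "t z = (\<Sum>y\<in>?J. y * indicator (?E y) z)" for z
    have tL: "t \<in> Linfty" unfolding t_def by (rule conjunct1[OF alpha_sum[OF fin]]) (rule L)
    have rep: "s z = t z" if "z \<in> space \<mu>" for z
      unfolding t_def
      by (rule trans[OF simple_function_indicator_representation_banach[OF s that]], rule sum.cong[OF refl])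
         (simp add: indicator_def)
    \<comment> \<open>\<open>s\<close> and \<open>t\<close> agree on the circle but perhaps not
      elsewhere; \<open>\<phi>\<close> identifies them only through its bound.\<close>
    have "\<alpha> (\<lambda>z. s z - t z) = \<alpha> (\<lambda>z. 0)"
    proof (rule alpha_cong[OF Linfty_diff[OF Linfty_simple[OF s] tL] Linfty_const])
      show "AE z in \<mu>. s z - t z = 0" by (rule AE_I2) (simp only: rep diff_self)
    qed
    then have "norm (\<phi> s - \<phi> t) \<le> C * \<alpha> (\<lambda>z. 0)"
      using \<phi>_Linfty[OF Linfty_diff[OF Linfty_simple[OF s] tL]]
      by (simp only: \<phi>_diff[OF Linfty_L[OF Linfty_simple[OF s]] Linfty_L[OF tL]])
    then have "\<phi> s = \<phi> t" by (simp add: alpha_const)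
    also have "\<dots> = (\<Sum>y\<in>?J. \<phi> (\<lambda>z. y * indicator (?E y) z))"
      unfolding t_def by (rule \<phi>_sum[OF fin]) (rule L)
    also have "\<dots> = (\<Sum>y\<in>?J. LINT z|\<mu>. y * (indicator (?E y) z *\<^sub>R g z))"
    proof (rule sum.cong[OF refl])
      fix y
      have "\<phi> (\<lambda>z. y * indicator (?E y) z) = y * \<nu> (?E y)"
        unfolding \<nu>_def by (rule \<phi>_cmult[OF Linfty_L[OF Linfty_indicator[OF E]]])
      then show "\<phi> (\<lambda>z. y * indicator (?E y) z) = (LINT z|\<mu>. y * (indicator (?E y) z *\<^sub>R g z))"
        by (simp only: integral_mult_right_zero g(2)[OF E])
    qed
    also have "\<dots> = (LINT z|\<mu>. (\<Sum>y\<in>?J. y * (indicator (?E y) z *\<^sub>R g z)))"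
      by (intro Bochner_Integration.integral_sum[symmetric] integrable_mult_right integrable_mult_indicator E g(1))
    also have "\<dots> = (LINT z|\<mu>. s z * g z)"
    proof (rule Bochner_Integration.integral_cong[OF refl])
      fix z assume z: "z \<in> space \<mu>"
      show "(\<Sum>y\<in>?J. y * (indicator (?E y) z *\<^sub>R g z)) = s z * g z"
        unfolding rep[OF z] t_def sum_distrib_right by (rule sum.cong[OF refl]) (simp add: indicator_def)
    qed
    finally show ?thesis .
  qed
  have bounded: "\<phi> f = (LINT z|\<mu>. f z * g z)" if f: "f \<in> Linfty" for f
  proof -
    obtain D where D: "f \<in> circle_borel" "0 \<le> D" "AE z in \<mu>. norm (f z) \<le> D"
      using LinftyD[OF f] .
    obtain s where s: "\<forall>i. simple_function \<mu> (s i)"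
      "\<forall>z\<in>space \<mu>. (\<lambda>i. s i z) \<longlonglongrightarrow> f z"
      "\<forall>i. \<forall>z\<in>space \<mu>. dist (s i z) 0 \<le> 2 * dist (f z) 0"
      using borel_measurable_implies_sequence_metric[OF D(1), of 0] by blast
    note s = s(1)[rule_format] s(2)[rule_format] s(3)[rule_format, folded norm_conv_dist]
    have [measurable]: "s i \<in> circle_borel" "f \<in> circle_borel" for i
      using s(1) D(1) by (auto intro: borel_measurable_simple_function)
    have sD: "AE z in \<mu>. norm (s i z) \<le> 2 * D" for i
      using D(3) AE_space
    proof eventually_elim
      case (elim z) then show ?case using s(3)[OF elim(2), of i] by simp
    qed
    have "(\<lambda>i. \<alpha> (\<lambda>z. s i z - f z)) \<longlonglongrightarrow> \<alpha> (\<lambda>z. 0)"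
    proof (rule alpha_bounded_convergence)
      show "AE z in \<mu>. norm (s i z - f z) \<le> 3 * D" for i
        using sD[of i] D(3)
      proof eventually_elim
        case (elim z) then show ?case using norm_triangle_ineq4[of "s i z" "f z"] by simp
      qed
      show "AE z in \<mu>. (\<lambda>i. s i z - f z) \<longlonglongrightarrow> 0"
        by (rule AE_I2) (rule LIM_zero[OF s(2)])
      show "(\<lambda>z. s i z - f z) \<in> circle_borel" for i by measurable
    qed simp
    then have "(\<lambda>i. C * \<alpha> (\<lambda>z. s i z - f z)) \<longlonglongrightarrow> C * \<alpha> (\<lambda>z. 0)"
      by (rule tendsto_mult[OF tendsto_const])
    then have lim: "(\<lambda>i. C * \<alpha> (\<lambda>z. s i z - f z)) \<longlonglongrightarrow> 0"
      by (simp only: alpha_const norm_zero mult_zero_right)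
    have le: "norm (\<phi> (s i) - \<phi> f) \<le> C * \<alpha> (\<lambda>z. s i z - f z)" for i
      using \<phi>_Linfty[OF Linfty_diff[OF Linfty_simple[OF s(1)] f]]
      by (simp only: \<phi>_diff[OF Linfty_L[OF Linfty_simple[OF s(1)]] Linfty_L[OF f]])
    have "(\<lambda>i. \<phi> (s i) - \<phi> f) \<longlonglongrightarrow> 0"
      by (rule Lim_null_comparison[OF always_eventually[OF allI[OF le]] lim])
    then have "(\<lambda>i. \<phi> (s i)) \<longlonglongrightarrow> \<phi> f" by (rule LIM_zero_cancel)
    moreover have "(\<lambda>i. LINT z|\<mu>. s i z * g z) \<longlonglongrightarrow> (LINT z|\<mu>. f z * g z)"
    proof (rule integral_dominated_convergence[where w="\<lambda>z. 2 * D * norm (g z)"])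
      show "AE z in \<mu>. (\<lambda>i. s i z * g z) \<longlonglongrightarrow> f z * g z"
        by (rule AE_I2) (rule tendsto_mult[OF s(2) tendsto_const])
      show "AE z in \<mu>. norm (s i z * g z) \<le> 2 * D * norm (g z)" for i
        using sD[of i] by eventually_elim (simp only: norm_mult, intro mult_right_mono norm_ge_zero)
      show "integrable \<mu> (\<lambda>z. 2 * D * norm (g z))"
        by (rule integrable_mult_right[OF integrable_norm[OF g(1)]])
      show "(\<lambda>z. s i z * g z) \<in> circle_borel" for i
        by (rule borel_measurable_times) measurable
      show "(\<lambda>z. f z * g z) \<in> circle_borel"
        by (rule borel_measurable_times) measurable
    qed
    ultimately show ?thesis unfolding simple[OF s(1)] by (rule LIMSEQ_unique)
  qed
  have kg: "koethe C g"
    unfolding koethe_def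
  proof (intro conjI ballI)
    fix f :: "complex \<Rightarrow> complex" assume f[measurable]: "f \<in> circle_borel"
    have le: "(\<integral>\<^sup>+z. ennreal (norm (trunc n f z * g z)) \<partial>\<mu>) \<le> ennreal C * p f" for n
    proof -
      \<comment> \<open>The conjugate phase of \<open>g\<close> turns \<open>\<phi> k\<close> into
        an integral of moduli. Where \<open>g\<close> vanishes, division by zero makes the phase 0,
        which does no harm.\<close>
      define k where "k z = of_real (norm (trunc n f z)) * (cnj (g z) / of_real (norm (g z)))" for z
      have [measurable]: "(\<lambda>z. cnj (g z)) \<in> circle_borel"
        by (rule measurable_compose[OF _ borel_measurable_continuous_onI[OF continuous_on_cnj[OF continuous_on_id]]]) measurable
      have [measurable]: "k \<in> circle_borel" unfolding k_def by measurable
      have kn: "norm (k z) \<le> norm (trunc n f z)" for z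
        by (cases "g z = 0") (auto simp: k_def norm_mult norm_divide)
      have kL: "k \<in> Linfty" by (rule LinftyI[of _ "real n"]) (auto intro: order_trans[OF kn norm_trunc_le(2)])
      have kg: "k z * g z = of_real (norm (trunc n f z * g z))" for z
        using complex_norm_square[of "g z"]
        by (cases "g z = 0") (auto simp: k_def norm_mult power2_eq_square mult.commute mult.left_commute nonzero_divide_eq_eq)
      have int: "integrable \<mu> (\<lambda>z. norm (trunc n f z * g z))"
      proof (rule Bochner_Integration.integrable_bound[where f="\<lambda>z. real n * norm (g z)"])
        show "AE z in \<mu>. norm (norm (trunc n f z * g z)) \<le> norm (real n * norm (g z))"
          by (auto simp: norm_mult abs_mult intro!: mult_right_mono norm_trunc_le)
      qed (use g(1) in auto)
      have "\<phi> k = of_real (LINT z|\<mu>. norm (trunc n f z * g z))"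
        by (simp add: bounded[OF kL] kg)
      then have "(LINT z|\<mu>. norm (trunc n f z * g z)) = norm (\<phi> k)" by simp
      also have "\<dots> \<le> C * \<alpha> k" using kL by (rule \<phi>_Linfty)
      finally have "ennreal (LINT z|\<mu>. norm (trunc n f z * g z)) \<le> ennreal (C * \<alpha> k)" by (rule ennreal_leI)
      also have "\<dots> = ennreal C * p k" using C(1) kL by (simp add: p_Linfty ennreal_mult alpha_nonneg)
      also have "\<dots> \<le> ennreal C * p f"
        by (intro mult_left_mono p_mono AE_I2) (auto intro: order_trans[OF kn norm_trunc_le(1)])
      finally show ?thesis using int by (subst nn_integral_eq_integral) auto
    qed
    have "(\<integral>\<^sup>+z. ennreal (norm (f z * g z)) \<partial>\<mu>)
      = (\<integral>\<^sup>+z. liminf (\<lambda>n. ennreal (norm (trunc n f z * g z))) \<partial>\<mu>)"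
    proof (rule nn_integral_cong)
      fix z
      have "(\<lambda>n. ennreal (norm (trunc n f z * g z))) \<longlonglongrightarrow> ennreal (norm (f z * g z))"
        by (intro tendsto_ennrealI tendsto_norm tendsto_mult tendsto_const) (rule trunc_tendsto)
      then show "ennreal (norm (f z * g z)) = liminf (\<lambda>n. ennreal (norm (trunc n f z * g z)))"
        by (rule lim_imp_Liminf[OF sequentially_bot, symmetric])
    qed
    also have "\<dots> \<le> liminf (\<lambda>n. \<integral>\<^sup>+z. ennreal (norm (trunc n f z * g z)) \<partial>\<mu>)"
      by (intro nn_integral_liminf) measurable
    also have "\<dots> \<le> ennreal C * p f" using le by (intro Liminf_le) auto
    finally show "(\<integral>\<^sup>+z. ennreal (norm (f z * g z)) \<partial>\<mu>) \<le> ennreal C * p f" .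
  qed measurable
  have "\<phi> f = (LINT z|\<mu>. f z * g z)" if f: "f \<in> L_space \<alpha>" for f
  proof -
    \<comment> \<open>One \<open>C * e\<close> comes from the bound on \<open>\<phi>\<close>, the
      other from the Koethe bound on the integral.\<close>
    have "norm (\<phi> f - (LINT z|\<mu>. f z * g z)) \<le> 2 * C * e" if e: "0 < e" for e
    proof -
      obtain b where b: "b \<in> Linfty" "p (\<lambda>z. f z - b z) < ennreal e"
        using seminorm_closureD(2)[OF f[unfolded L_space_def] e] by auto
      have fb: "(\<lambda>z. f z - b z) \<in> L_space \<alpha>" by (intro L_diff f Linfty_L b)
      have "enn2real (p (\<lambda>z. f z - b z)) \<le> e"
        using b(2) e by (auto intro: enn2real_leI less_imp_le)
      then have Ce: "C * enn2real (p (\<lambda>z. f z - b z)) \<le> C * e" using C(1) by (rule mult_left_mono)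
      have "\<phi> f - (LINT z|\<mu>. f z * g z) = \<phi> (\<lambda>z. f z - b z) - (LINT z|\<mu>. (f z - b z) * g z)"
        using koethe_integrable[OF kg L_cL[OF f]] koethe_integrable[OF kg Linfty_cL[OF b(1)]] bounded[OF b(1)]
        by (simp add: left_diff_distrib \<phi>_diff[OF f Linfty_L[OF b(1)]])
      then have "norm (\<phi> f - (LINT z|\<mu>. f z * g z)) \<le> norm (\<phi> (\<lambda>z. f z - b z)) + norm (LINT z|\<mu>. (f z - b z) * g z)"
        by (simp only: norm_triangle_ineq4)
      also have "norm (\<phi> (\<lambda>z. f z - b z)) \<le> C * e" using C(2)[OF fb] Ce by linarith
      also have "norm (LINT z|\<mu>. (f z - b z) * g z) \<le> C * e"
        using integral_norm_bound[of \<mu> "\<lambda>z. (f z - b z) * g z"] koethe_integral_le[OF kg C(1) L_cL[OF fb]] Ce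
        by linarith
      finally show ?thesis by simp
    qed
    note * = this
    have "norm (\<phi> f - (LINT z|\<mu>. f z * g z)) \<le> 0"
    proof (rule field_le_epsilon)
      fix e :: real assume e: "0 < e"
      have "norm (\<phi> f - (LINT z|\<mu>. f z * g z)) \<le> 2 * C * (e / (2 * (C + 1)))"
        using e C(1) by (intro *) auto
      also have "\<dots> \<le> e" using e C(1) by (simp add: field_simps)
      finally show "norm (\<phi> f - (LINT z|\<mu>. f z * g z)) \<le> 0 + e" by simp
    qed
    then show ?thesis by simp
  qed
  with kg show ?thesis using that by blast
qed

end

section \<open>Weak limits against the Koethe dual\<close>

lemma uniform_simple_approx:
  fixes k :: "complex \<Rightarrow> complex"
  assumes k: "k \<in> circle_borel" and C: "\<And>z. norm (k z) \<le> C" and e: "0 < e"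
  obtains s where "simple_function \<mu> s" "\<And>z. norm (k z - s z) \<le> e"
proof -
  \<comment> \<open>Real and imaginary part are rounded separately to a grid of mesh
    \<open>r\<close>, each with error at most half of \<open>e\<close>.\<close>
  define r where "r = e / 2"
  have r: "0 < r" using e by (simp add: r_def)
  define q where "q x = r * of_int \<lfloor>x / r\<rfloor>" for x :: real
  have q: "\<bar>x - q x\<bar> \<le> r" for x
  proof -
    have "0 \<le> x / r - of_int \<lfloor>x / r\<rfloor>" "x / r - of_int \<lfloor>x / r\<rfloor> \<le> 1" by linarith+
    then have "0 \<le> r * (x / r - of_int \<lfloor>x / r\<rfloor>)" "r * (x / r - of_int \<lfloor>x / r\<rfloor>) \<le> r * 1"
      using r by (auto intro!: mult_left_mono)
    then show ?thesis using r by (simp add: q_def right_diff_distrib)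
  qed
  have fin: "finite (q ` {-C..C})"
  proof -
    have "q ` {-C..C} \<subseteq> (\<lambda>n. r * of_int n) ` {\<lfloor>-C / r\<rfloor>..\<lfloor>C / r\<rfloor>}"
    proof
      fix y assume "y \<in> q ` {-C..C}"
      then obtain x where x: "-C \<le> x" "x \<le> C" "y = q x" by auto
      then have "\<lfloor>-C / r\<rfloor> \<le> \<lfloor>x / r\<rfloor>" "\<lfloor>x / r\<rfloor> \<le> \<lfloor>C / r\<rfloor>"
        using r by (intro floor_mono divide_right_mono; simp)+
      then show "y \<in> (\<lambda>n. r * of_int n) ` {\<lfloor>-C / r\<rfloor>..\<lfloor>C / r\<rfloor>}"
        unfolding x(3) q_def by (intro image_eqI[of _ _ "\<lfloor>x / r\<rfloor>"]) auto
    qed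
    then show ?thesis by (rule finite_subset) simp
  qed
  define s where "s z = Complex (q (Re (k z))) (q (Im (k z)))" for z
  have ReIm: "Re (k z) \<in> {-C..C}" "Im (k z) \<in> {-C..C}" for z
    using C[of z] abs_Re_le_cmod[of "k z"] abs_Im_le_cmod[of "k z"] by auto
  show ?thesis
  proof (rule that)
    show "simple_function \<mu> s"
    proof (rule simple_function_borel_measurable)
      have qm: "q \<in> borel_measurable borel" unfolding q_def by measurable
      have "(\<lambda>z. of_real (q (Re (k z))) + \<i> * of_real (q (Im (k z)))) \<in> circle_borel"
        using k qm by measurable
      then show "s \<in> circle_borel" by (simp add: s_def[abs_def] Complex_eq)
      have "s ` space \<mu> \<subseteq> (\<lambda>(a, b). Complex a b) ` (q ` {-C..C} \<times> q ` {-C..C})"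
        using ReIm unfolding s_def by fast
      then show "finite (s ` space \<mu>)" by (rule finite_subset) (use fin in auto)
    qed
    fix z
    have "norm (k z - s z) \<le> \<bar>Re (k z - s z)\<bar> + \<bar>Im (k z - s z)\<bar>" by (rule cmod_le)
    also have "\<dots> \<le> r + r" unfolding s_def using q by (intro add_mono) auto
    finally show "norm (k z - s z) \<le> e" by (simp add: r_def)
  qed
qed

text \<open>Convergence on sets extends by linearity to simple multipliers; the L1-bound
  \<open>K\<close> then allows uniform approximation of bounded ones.\<close>

lemma weak_convergence_bounded_multiplier:
  fixes x :: "nat \<Rightarrow> complex \<Rightarrow> complex"
  assumes x: "\<And>n. integrable \<mu> (x n)" "\<And>n. (LINT z|\<mu>. norm (x n z)) \<le> K"
    and f: "integrable \<mu> f"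
    and lim: "\<And>E. E \<in> sets \<mu> \<Longrightarrow>
      (\<lambda>n. LINT z|\<mu>. indicator E z *\<^sub>R x n z) \<longlonglongrightarrow> (LINT z|\<mu>. indicator E z *\<^sub>R f z)"
    and k: "k \<in> circle_borel" "\<And>z. norm (k z) \<le> C"
  shows "(\<lambda>n. LINT z|\<mu>. x n z * k z) \<longlonglongrightarrow> (LINT z|\<mu>. f z * k z)"
proof -
  have K: "0 \<le> K" using x(2)[of 0] by (rule order_trans[rotated]) simp
  have mult: "integrable \<mu> (\<lambda>z. y z * b z)"
    if "integrable \<mu> y" "b \<in> circle_borel" "\<And>z. norm (b z) \<le> D" for y b :: "complex \<Rightarrow> complex" and D
  proof (rule Bochner_Integration.integrable_bound[where f="\<lambda>z. D * norm (y z)"])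
    show "AE z in \<mu>. norm (y z * b z) \<le> norm (D * norm (y z))"
    proof (rule AE_I2)
      fix z
      have "norm (b z) * norm (y z) \<le> D * norm (y z)" using that(3) by (rule mult_right_mono) simp
      moreover have "0 \<le> D" using order_trans[OF norm_ge_zero that(3)] .
      ultimately show "norm (y z * b z) \<le> norm (D * norm (y z))" by (simp add: norm_mult abs_mult mult.commute)
    qed
  qed (use that in auto)
  have simple: "(\<lambda>n. LINT z|\<mu>. x n z * s z) \<longlonglongrightarrow> (LINT z|\<mu>. f z * s z)"
    if s: "simple_function \<mu> s" for s
  proof -
    let ?J = "s ` space \<mu>"
    let ?E = "\<lambda>y. s -` {y} \<inter> space \<mu>"
    have E: "?E y \<in> sets \<mu>" for y using s by (rule simple_functionD)
    have rep: "(LINT z|\<mu>. h z * s z) = (\<Sum>y\<in>?J. (LINT z|\<mu>. indicator (?E y) z *\<^sub>R h z) * y)"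
      if h: "integrable \<mu> h" for h
    proof -
      have "(LINT z|\<mu>. h z * s z) = (LINT z|\<mu>. (\<Sum>y\<in>?J. (indicator (?E y) z *\<^sub>R h z) * y))"
      proof (rule Bochner_Integration.integral_cong[OF refl])
        fix z assume z: "z \<in> space \<mu>"
        have "h z * s z = h z * (\<Sum>y\<in>?J. indicator (?E y) z *\<^sub>R y)"
          by (rule arg_cong[OF simple_function_indicator_representation_banach[OF s z]])
        also have "\<dots> = (\<Sum>y\<in>?J. (indicator (?E y) z *\<^sub>R h z) * y)"
          unfolding sum_distrib_left by (rule sum.cong[OF refl]) (simp add: indicator_def)
        finally show "h z * s z = (\<Sum>y\<in>?J. (indicator (?E y) z *\<^sub>R h z) * y)" .
      qed
      also have "\<dots> = (\<Sum>y\<in>?J. LINT z|\<mu>. (indicator (?E y) z *\<^sub>R h z) * y)"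
        by (intro Bochner_Integration.integral_sum integrable_mult_left integrable_mult_indicator E h)
      finally show ?thesis by (simp only: integral_mult_left_zero)
    qed
    show ?thesis unfolding rep[OF x(1)] rep[OF f]
      by (intro tendsto_sum tendsto_mult tendsto_const lim E)
  qed
  show ?thesis
  proof (rule tendstoI)
    fix e :: real assume e: "0 < e"
    define L where "L = K + (LINT z|\<mu>. norm (f z)) + 1"
    have L: "0 < L" using K by (simp add: L_def add_nonneg_pos)
    obtain s where s: "simple_function \<mu> s" "\<And>z. norm (k z - s z) \<le> e / (2 * L)"
      using uniform_simple_approx[OF k, of "e / (2 * L)"] e L by auto
    have sB: "s \<in> circle_borel" by (rule borel_measurable_simple_function[OF s(1)])
    have sC: "norm (s z) \<le> C + e / (2 * L)" for z
      using norm_triangle_ineq2[of "s z" "k z"] s(2)[of z] k(2)[of z] by (simp add: norm_minus_commute)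
    have err: "norm ((LINT z|\<mu>. h z * k z) - (LINT z|\<mu>. h z * s z)) \<le> (LINT z|\<mu>. norm (h z)) * (e / (2 * L))"
      if h: "integrable \<mu> h" for h :: "complex \<Rightarrow> complex"
    proof -
      have ks: "integrable \<mu> (\<lambda>z. h z * (k z - s z))"
        using mult[OF h _ s(2)] k(1) sB by simp
      have "(LINT z|\<mu>. h z * k z) - (LINT z|\<mu>. h z * s z) = (LINT z|\<mu>. h z * (k z - s z))"
        unfolding right_diff_distrib
        by (rule Bochner_Integration.integral_diff[symmetric, OF mult[OF h k] mult[OF h sB sC]])
      also have "norm \<dots> \<le> (LINT z|\<mu>. norm (h z * (k z - s z)))" by (rule integral_norm_bound)
      also have "\<dots> \<le> (LINT z|\<mu>. norm (h z) * (e / (2 * L)))"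
      proof (rule integral_mono[OF integrable_norm[OF ks] integrable_mult_left[OF integrable_norm[OF h]]])
        show "norm (h z * (k z - s z)) \<le> norm (h z) * (e / (2 * L))" for z
          unfolding norm_mult by (rule mult_left_mono[OF s(2)]) simp
      qed
      also have "\<dots> = (LINT z|\<mu>. norm (h z)) * (e / (2 * L))" by simp
      finally show ?thesis .
    qed
    have ev: "\<forall>\<^sub>F n in sequentially. dist (LINT z|\<mu>. x n z * s z) (LINT z|\<mu>. f z * s z) < e/2"
      using simple[OF s(1)] e by (intro tendstoD) auto
    have "(K + (LINT z|\<mu>. norm (f z))) * (e / (2 * L)) \<le> L * (e / (2 * L))"
      using e L by (intro mult_right_mono) (auto simp: L_def)
    also have "\<dots> = e/2" using L by simp
    finally have tot: "K * (e / (2 * L)) + (LINT z|\<mu>. norm (f z)) * (e / (2 * L)) \<le> e/2"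
      by (simp only: distrib_right)
    show "\<forall>\<^sub>F n in sequentially. dist (LINT z|\<mu>. x n z * k z) (LINT z|\<mu>. f z * k z) < e"
      using ev
    proof eventually_elim
      case (elim n)
      have "norm ((LINT z|\<mu>. x n z * k z) - (LINT z|\<mu>. x n z * s z)) \<le> K * (e / (2 * L))"
        using err[OF x(1), of n] mult_right_mono[OF x(2), of "e / (2 * L)" n] e L by simp
      moreover note err[OF f] tot
      ultimately show ?case using elim unfolding dist_norm
        using norm_triangle_ineq[of "(LINT z|\<mu>. x n z * k z) - (LINT z|\<mu>. x n z * s z)"
            "(LINT z|\<mu>. x n z * s z) - (LINT z|\<mu>. f z * s z)"]
          norm_triangle_ineq4[of "(LINT z|\<mu>. x n z * k z) - (LINT z|\<mu>. f z * s z)"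
            "(LINT z|\<mu>. f z * k z) - (LINT z|\<mu>. f z * s z)"]
        by simp
    qed
  qed
qed

context rotational_seminorm
begin

lemma dual_L_representation:
  assumes "\<phi> \<in> dual_space (L_space \<alpha>) p"
  obtains C g where "0 \<le> C" "koethe C g" "\<And>f. f \<in> L_space \<alpha> \<Longrightarrow> \<phi> f = (LINT z|\<mu>. f z * g z)"
proof -
  obtain C where C: "\<And>f. f \<in> L_space \<alpha> \<Longrightarrow> norm (\<phi> f) \<le> C * enn2real (p f)"
    using assms unfolding dual_space_def by blast
  have "norm (\<phi> f) \<le> \<bar>C\<bar> * enn2real (p f)" if "f \<in> L_space \<alpha>" for f
    using C[OF that] by (rule order_trans) (intro mult_right_mono, auto)
  from dual_L_koethe[OF assms abs_ge_zero this] show ?thesis using that[of "\<bar>C\<bar>"] by auto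
qed

lemma koethe_borel [measurable_dest]: "koethe C g \<Longrightarrow> g \<in> circle_borel"
  by (simp add: koethe_def)

text \<open>A majorant in the large space becomes integrable after multiplication by
  \<open>g\<close>, so dominated convergence applies, even where convergence in \<open>p\<close>
  fails.\<close>

lemma koethe_dominated_convergence:
  assumes g: "koethe C g" and D: "D \<in> cL_space \<alpha>"
    and x: "\<And>n. x n \<in> circle_borel" "\<And>n. AE z in \<mu>. norm (x n z) \<le> norm (D z)"
    and lim: "AE z in \<mu>. (\<lambda>n. x n z) \<longlonglongrightarrow> f z" and f: "f \<in> circle_borel"
  shows "(\<lambda>n. LINT z|\<mu>. x n z * g z) \<longlonglongrightarrow> (LINT z|\<mu>. f z * g z)"
proof (rule integral_dominated_convergence[where w="\<lambda>z. norm (D z * g z)"])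
  show "integrable \<mu> (\<lambda>z. norm (D z * g z))"
    using koethe_integrable[OF g D] by (rule integrable_norm)
  show "AE z in \<mu>. norm (x n z * g z) \<le> norm (D z * g z)" for n
    using x(2)[of n] by eventually_elim (simp add: norm_mult mult_right_mono)
  show "AE z in \<mu>. (\<lambda>n. x n z * g z) \<longlonglongrightarrow> f z * g z"
    using lim by eventually_elim (rule tendsto_mult[OF _ tendsto_const])
qed (use x(1) f koethe_borel[OF g] in \<open>auto intro: borel_measurable_times\<close>)

text \<open>If \<open>p f = \<infinity>\<close>, norming functionals \<open>g\<^sub>k\<close> of truncations of \<open>f\<close> with \<open>\<integral>|f g\<^sub>k| \<ge> 4\<^sup>k\<close>
  add up to \<open>\<Sum> 2\<^sup>-\<^sup>k |g\<^sub>k|\<close> in the Koethe dual, against which \<open>f\<close> is not integrable.\<close>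

lemma koethe_bidual:
  assumes f: "f \<in> circle_borel"
    and int: "\<And>C g. 0 \<le> C \<Longrightarrow> koethe C g \<Longrightarrow> integrable \<mu> (\<lambda>z. f z * g z)"
  shows "f \<in> cL_space \<alpha>"
proof (rule cL_spaceI[OF f], rule ccontr)
  assume inf: "\<not> p f < \<infinity>"
  note [measurable] = f
  have "\<exists>g. koethe 1 g \<and> ennreal (4 ^ k) \<le> (\<integral>\<^sup>+z. ennreal (norm (f z * g z)) \<partial>\<mu>)" for k
  proof -
    \<comment> \<open>Norming functionals are available for bounded functions; by Fatou some
      truncation already exceeds any given bound.\<close>
    have "\<exists>n. \<not> p (trunc n f) \<le> ennreal (4 ^ k)"
    proof (rule ccontr)
      assume "\<nexists>n. \<not> p (trunc n f) \<le> ennreal (4 ^ k)"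
      then have le: "p (trunc n f) \<le> ennreal (4 ^ k)" for n by blast
      have "p f \<le> ennreal (4 ^ k)"
      proof (rule p_Fatou[where u="\<lambda>n. trunc n f", OF trunc_borel[OF f] le])
        show "AE z in \<mu>. (\<lambda>n. trunc n f z) \<longlonglongrightarrow> f z" by (rule AE_I2) (rule trunc_tendsto)
      qed
      then show False using inf by (simp add: less_top[symmetric] top_unique)
    qed
    then obtain n where n: "ennreal (4 ^ k) < p (trunc n f)" by (auto simp: not_le)
    define b where "b = trunc n f"
    have b: "b \<in> Linfty" unfolding b_def using f by (rule trunc_Linfty)
    obtain \<psi> where \<psi>: "\<psi> \<in> dual_space (L_space \<alpha>) p" "\<And>f. f \<in> L_space \<alpha> \<Longrightarrow> norm (\<psi> f) \<le> enn2real (p f)" "\<psi> b = \<alpha> b"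
      using norming_functional[OF b] by blast
    obtain g where g: "koethe 1 g" "\<And>f. f \<in> L_space \<alpha> \<Longrightarrow> \<psi> f = (LINT z|\<mu>. f z * g z)"
      using dual_L_koethe[OF \<psi>(1), of 1] \<psi>(2) by auto
    have "ennreal (4 ^ k) \<le> ennreal (\<alpha> b)" using n b by (simp add: b_def p_Linfty)
    also have "\<alpha> b = norm (LINT z|\<mu>. b z * g z)"
      using \<psi>(3) g(2)[OF Linfty_L[OF b]] alpha_nonneg[OF b] by (metis abs_of_nonneg norm_of_real)
    also have "ennreal \<dots> \<le> (\<integral>\<^sup>+z. ennreal (norm (b z * g z)) \<partial>\<mu>)"
      using koethe_integrable[OF g(1) Linfty_cL[OF b]] by (rule integral_norm_bound_ennreal)
    also have "\<dots> \<le> (\<integral>\<^sup>+z. ennreal (norm (f z * g z)) \<partial>\<mu>)"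
      by (intro nn_integral_mono ennreal_leI) (auto simp: b_def norm_mult intro!: mult_right_mono norm_trunc_le)
    finally show ?thesis using g(1) by auto
  qed
  then obtain g where g: "\<And>k. koethe 1 (g k)"
    "\<And>k. ennreal (4 ^ k) \<le> (\<integral>\<^sup>+z. ennreal (norm (f z * g k z)) \<partial>\<mu>)"
    by metis
  have [measurable]: "g k \<in> circle_borel" for k by (rule koethe_borel[OF g(1)])
  define G where "G z = (\<Sum>k. ennreal ((1/2) ^ k) * ennreal (norm (g k z)))" for z
  have Gm [measurable]: "G \<in> borel_measurable \<mu>" unfolding G_def by measurable
  have Gint: "(\<integral>\<^sup>+z. ennreal (norm (h z)) * G z \<partial>\<mu>)
      = (\<Sum>k. ennreal ((1/2) ^ k) * (\<integral>\<^sup>+z. ennreal (norm (h z * g k z)) \<partial>\<mu>))"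
    if h [measurable]: "h \<in> circle_borel" for h :: "complex \<Rightarrow> complex"
  proof -
    have "(\<integral>\<^sup>+z. ennreal (norm (h z)) * G z \<partial>\<mu>)
        = (\<integral>\<^sup>+z. (\<Sum>k. ennreal ((1/2) ^ k) * ennreal (norm (h z * g k z))) \<partial>\<mu>)"
      unfolding G_def ennreal_suminf_cmult[symmetric]
      by (simp add: norm_mult ennreal_mult mult.left_commute)
    also have "\<dots> = (\<Sum>k. \<integral>\<^sup>+z. ennreal ((1/2) ^ k) * ennreal (norm (h z * g k z)) \<partial>\<mu>)"
      by (intro nn_integral_suminf) measurable
    also have "\<dots> = (\<Sum>k. ennreal ((1/2) ^ k) * (\<integral>\<^sup>+z. ennreal (norm (h z * g k z)) \<partial>\<mu>))"
      by (intro suminf_cong nn_integral_cmult) measurable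
    finally show ?thesis .
  qed
  \<comment> \<open>The weights sum to 2, the Koethe constant of \<open>h\<close>; against them the
    lower bounds \<open>4 ^ k\<close> still grow like \<open>2 ^ k\<close>.\<close>
  have "(\<lambda>k. (1/2::real) ^ k) sums 2" using geometric_sums[of "1/2::real"] by simp
  then have half: "(\<Sum>k. ennreal ((1/2) ^ k)) = ennreal 2"
    by (intro suminf_ennreal_eq) simp_all
  have Gle: "(\<integral>\<^sup>+z. ennreal (norm (h z)) * G z \<partial>\<mu>) \<le> ennreal 2 * p h" if h: "h \<in> circle_borel" for h
  proof -
    have "(\<Sum>k. ennreal ((1/2) ^ k) * (\<integral>\<^sup>+z. ennreal (norm (h z * g k z)) \<partial>\<mu>)) \<le> (\<Sum>k. ennreal ((1/2) ^ k) * p h)"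
      using g(1) h by (intro suminf_le mult_left_mono) (auto simp: koethe_def)
    also have "\<dots> = ennreal 2 * p h" by (simp only: ennreal_suminf_multc half)
    finally show ?thesis by (simp only: Gint[OF h])
  qed
  \<comment> \<open>Testing with the constant 1 shows that \<open>G\<close> is finite almost
    everywhere, so replacing it by the finite-valued \<open>h\<close> changes no integral.\<close>
  have "(\<integral>\<^sup>+z. G z \<partial>\<mu>) \<le> ennreal 2 * p (\<lambda>z. 1)" using Gle[of "\<lambda>z. 1"] by simp
  also have "\<dots> < \<infinity>" using p_Linfty[OF Linfty_const, of 1] by (simp add: ennreal_mult_less_top)
  finally have fin: "AE z in \<mu>. G z \<noteq> \<infinity>" by (intro nn_integral_PInf_AE) auto
  define h where "h z = complex_of_real (enn2real (G z))" for z
  have hm: "h \<in> circle_borel" unfolding h_def by measurable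
  have hG: "(\<integral>\<^sup>+z. ennreal (norm (u z * h z)) \<partial>\<mu>) = (\<integral>\<^sup>+z. ennreal (norm (u z)) * G z \<partial>\<mu>)" for u :: "complex \<Rightarrow> complex"
    using fin by (intro nn_integral_cong_AE, eventually_elim)
      (auto simp: h_def norm_mult ennreal_mult less_top[symmetric])
  have kh: "koethe 2 h" unfolding koethe_def using hm Gle by (simp only: hG) blast
  have "(\<integral>\<^sup>+z. ennreal (norm (f z * h z)) \<partial>\<mu>) < \<infinity>"
    using int[OF _ kh] by (simp add: integrable_iff_bounded)
  then have fG: "(\<integral>\<^sup>+z. ennreal (norm (f z)) * G z \<partial>\<mu>) < \<infinity>" by (simp only: hG)
  have big: "ennreal (2 ^ k) \<le> (\<integral>\<^sup>+z. ennreal (norm (f z)) * G z \<partial>\<mu>)" for k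
  proof -
    have "ennreal (2 ^ k) = ennreal ((1/2) ^ k) * ennreal (4 ^ k)"
      by (simp add: ennreal_mult[symmetric] power_mult_distrib[symmetric])
    also have "\<dots> \<le> ennreal ((1/2) ^ k) * (\<integral>\<^sup>+z. ennreal (norm (f z * g k z)) \<partial>\<mu>)"
      by (intro mult_left_mono g) simp
    also have "\<dots> = (\<Sum>j\<in>{k}. ennreal ((1/2) ^ j) * (\<integral>\<^sup>+z. ennreal (norm (f z * g j z)) \<partial>\<mu>))"
      by simp
    also have "\<dots> \<le> (\<Sum>j. ennreal ((1/2) ^ j) * (\<integral>\<^sup>+z. ennreal (norm (f z * g j z)) \<partial>\<mu>))"
      by (rule sum_le_suminf) auto
    finally show ?thesis by (simp only: Gint[OF f])
  qed
  obtain r where r: "0 \<le> r" "(\<integral>\<^sup>+z. ennreal (norm (f z)) * G z \<partial>\<mu>) = ennreal r"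
    using fG by (cases "\<integral>\<^sup>+z. ennreal (norm (f z)) * G z \<partial>\<mu>") auto
  obtain k where "r < 2 ^ k" using real_arch_pow[of 2 r] by auto
  moreover have "(2::real) ^ k \<le> r" using big[of k] r by simp
  ultimately show False by simp
qed

text \<open>Restricting a Koethe function to a set keeps it Koethe, so every sequence of products
  with a fixed \<open>g\<close> converges weakly in L1. The limit for the constant 1 is
  \<open>f\<close>; the limit for general \<open>g\<close> is identified as the product of
  \<open>f\<close> and \<open>g\<close>. Integrability of all these products puts \<open>f\<close>
  into the large space by \<open>koethe_bidual\<close>.\<close>

lemma koethe_weak_limit:
  assumes x: "\<And>n. x n \<in> cL_space \<alpha>"
    and C: "\<And>C g. 0 \<le> C \<Longrightarrow> koethe C g \<Longrightarrow> Cauchy (\<lambda>n. LINT z|\<mu>. x n z * g z)"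
  obtains f where "f \<in> cL_space \<alpha>"
    "\<And>C g. 0 \<le> C \<Longrightarrow> koethe C g \<Longrightarrow>
      (\<lambda>n. LINT z|\<mu>. x n z * g z) \<longlonglongrightarrow> (LINT z|\<mu>. f z * g z)"
proof -
  have lim: "\<exists>h K. integrable \<mu> h \<and>
      (\<forall>E\<in>sets \<mu>. (\<lambda>n. LINT z|\<mu>. indicator E z *\<^sub>R (x n z * g z)) \<longlonglongrightarrow> (LINT z|\<mu>. indicator E z *\<^sub>R h z)) \<and>
      (\<forall>n. (LINT z|\<mu>. norm (x n z * g z)) \<le> K)"
    if D: "0 \<le> D" and g: "koethe D g" for D g
  proof -
    have int: "integrable \<mu> (\<lambda>z. x n z * g z)" for n by (rule koethe_integrable[OF g x])
    have Cau: "Cauchy (\<lambda>n. LINT z|\<mu>. indicator E z *\<^sub>R (x n z * g z))" if E: "E \<in> sets \<mu>" for E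
    proof -
      have "koethe D (\<lambda>z. indicator E z *\<^sub>R g z)"
        using E koethe_borel[OF g] by (intro koethe_norm_mono[OF g]) (auto simp: indicator_def)
      from C[OF D this] show ?thesis by simp
    qed
    show ?thesis
      by (rule circle.L1_weakly_sequentially_complete[OF circle_cover int Cau]) blast+
  qed
  have one: "koethe 1 (\<lambda>z. 1)"
    unfolding koethe_def using nn_integral_le_p by auto
  obtain f K where f: "integrable \<mu> f"
    "\<And>E. E \<in> sets \<mu> \<Longrightarrow> (\<lambda>n. LINT z|\<mu>. indicator E z *\<^sub>R x n z) \<longlonglongrightarrow> (LINT z|\<mu>. indicator E z *\<^sub>R f z)"
    "\<And>n. (LINT z|\<mu>. norm (x n z)) \<le> K"
    using lim[OF _ one] by auto
  have fB [measurable]: "f \<in> circle_borel" using f(1) by simp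
  have main: "integrable \<mu> (\<lambda>z. f z * g z) \<and>
      (\<lambda>n. LINT z|\<mu>. x n z * g z) \<longlonglongrightarrow> (LINT z|\<mu>. f z * g z)"
    if D: "0 \<le> D" and g: "koethe D g" for D g
  proof -
    note gB [measurable] = koethe_borel[OF g]
    obtain h where h: "integrable \<mu> h"
      "\<And>E. E \<in> sets \<mu> \<Longrightarrow> (\<lambda>n. LINT z|\<mu>. indicator E z *\<^sub>R (x n z * g z)) \<longlonglongrightarrow> (LINT z|\<mu>. indicator E z *\<^sub>R h z)"
      using lim[OF D g] by blast
    \<comment> \<open>Where \<open>norm (g z) \<le> real N\<close> the multiplier is bounded, so
      weak L1-convergence of \<open>x n\<close> to \<open>f\<close> determines \<open>h\<close>
      there; these sets exhaust the circle as \<open>N\<close> grows.\<close>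
    have "AE z in \<mu>. indicator {z\<in>space \<mu>. norm (g z) \<le> real N} z *\<^sub>R h z = f z * trunc N g z" for N
    proof -
      let ?A = "{z\<in>space \<mu>. norm (g z) \<le> real N}"
      have A: "?A \<in> sets \<mu>" by measurable
      have kb: "norm (indicator E z *\<^sub>R trunc N g z) \<le> real N" for E z
        using norm_trunc_le(2)[of N g z] by (simp add: indicator_def)
      show ?thesis
      proof (rule circle.density_unique_banach)
        show "integrable \<mu> (\<lambda>z. indicator ?A z *\<^sub>R h z)"
          by (rule integrable_mult_indicator[OF A h(1)])
        show "integrable \<mu> (\<lambda>z. f z * trunc N g z)"
        proof (rule Bochner_Integration.integrable_bound[where f="\<lambda>z. real N * norm (f z)"])
          show "AE z in \<mu>. norm (f z * trunc N g z) \<le> norm (real N * norm (f z))"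
          proof (rule AE_I2)
            fix z
            have "norm (trunc N g z) * norm (f z) \<le> real N * norm (f z)"
              by (rule mult_right_mono[OF norm_trunc_le(2)]) simp
            then show "norm (f z * trunc N g z) \<le> norm (real N * norm (f z))" by (simp add: norm_mult mult.commute)
          qed
        qed (use f(1) in \<open>auto intro!: borel_measurable_times trunc_borel gB\<close>)
        fix E assume E: "E \<in> sets \<mu>"
        have "(\<lambda>n. LINT z|\<mu>. x n z * (indicator E z *\<^sub>R trunc N g z)) \<longlonglongrightarrow> (LINT z|\<mu>. f z * (indicator E z *\<^sub>R trunc N g z))"
        proof (rule weak_convergence_bounded_multiplier[OF cL_integrable[OF x] f(3) f(1) f(2) _ kb])
          show "(\<lambda>z. indicator E z *\<^sub>R trunc N g z) \<in> circle_borel"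
            using E by (intro borel_measurable_scaleR borel_measurable_indicator trunc_borel gB)
        qed
        moreover have "(LINT z|\<mu>. x n z * (indicator E z *\<^sub>R trunc N g z))
            = (LINT z|\<mu>. indicator (E \<inter> ?A) z *\<^sub>R (x n z * g z))" for n
          by (rule Bochner_Integration.integral_cong) (auto simp: indicator_def trunc_def)
        ultimately have "(LINT z|\<mu>. f z * (indicator E z *\<^sub>R trunc N g z)) = (LINT z|\<mu>. indicator (E \<inter> ?A) z *\<^sub>R h z)"
          using h(2)[OF sets.Int[OF E A]] by (simp only:) (rule LIMSEQ_unique)
        then show "set_lebesgue_integral \<mu> E (\<lambda>z. indicator ?A z *\<^sub>R h z) = set_lebesgue_integral \<mu> E (\<lambda>z. f z * trunc N g z)"
          unfolding set_lebesgue_integral_def by (simp add: indicator_inter_arith mult.left_commute mult_scaleR_right)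
      qed
    qed
    then have "AE z in \<mu>. \<forall>N. indicator {z\<in>space \<mu>. norm (g z) \<le> real N} z *\<^sub>R h z = f z * trunc N g z"
      unfolding AE_all_countable by (rule allI)
    then have eq: "AE z in \<mu>. h z = f z * g z"
      using AE_space
    proof eventually_elim
      case (elim z)
      obtain N :: nat where "norm (g z) \<le> real N" using real_arch_simple by blast
      then show ?case using elim(1)[rule_format, of N] elim(2) by (simp add: trunc_def indicator_def)
    qed
    have fgB: "(\<lambda>z. f z * g z) \<in> circle_borel" by (rule borel_measurable_times[OF fB gB])
    have hB: "h \<in> circle_borel" using h(1) by simp
    have "integrable \<mu> (\<lambda>z. f z * g z)"
      using integrable_cong_AE[OF hB fgB eq] h(1) by simp
    moreover have sp: "(LINT z|\<mu>. indicator (space \<mu>) z *\<^sub>R u z) = (LINT z|\<mu>. u z)"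
      for u :: "complex \<Rightarrow> complex"
      by (rule Bochner_Integration.integral_cong[OF refl]) (simp add: indicator_def)
    moreover have "(LINT z|\<mu>. h z) = (LINT z|\<mu>. f z * g z)"
      by (rule integral_cong_AE[OF hB fgB eq])
    ultimately show ?thesis using h(2)[OF sets.top] by (simp only:)
  qed
  have "f \<in> cL_space \<alpha>" by (rule koethe_bidual[OF fB]) (use main in blast)
  then show ?thesis using main that by blast
qed

section \<open>Weak sequential completeness and the large space\<close>

lemma weakly_Cauchy_koethe:
  assumes x: "weakly_Cauchy X p x" and X: "X \<subseteq> cL_space \<alpha>" and g: "0 \<le> C" "koethe C g"
  shows "Cauchy (\<lambda>n. LINT z|\<mu>. x n z * g z)"
  using bspec[OF x[unfolded weakly_Cauchy_def] koethe_dual[OF g(2,1) X]] .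

text \<open>\<open>koethe_weak_limit\<close> places the limit only in the large space;
  \<open>eq\<close> brings it back.\<close>

lemma weakly_seq_complete_L:
  assumes eq: "L_space \<alpha> = cL_space \<alpha>"
  shows "weakly_seq_complete (L_space \<alpha>) p"
  unfolding weakly_seq_complete_def
proof (intro allI impI, elim conjE)
  fix x :: "nat \<Rightarrow> complex \<Rightarrow> complex"
  assume x: "\<forall>n. x n \<in> L_space \<alpha>" "weakly_Cauchy (L_space \<alpha>) p x"
  obtain f where f: "f \<in> cL_space \<alpha>"
    "\<And>C g. 0 \<le> C \<Longrightarrow> koethe C g \<Longrightarrow>
      (\<lambda>n. LINT z|\<mu>. x n z * g z) \<longlonglongrightarrow> (LINT z|\<mu>. f z * g z)"
    by (rule koethe_weak_limit[of x])
       (use x(1) eq weakly_Cauchy_koethe[OF x(2) eq_refl[OF eq]] in auto)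
  have "weakly_convergent_to (L_space \<alpha>) p x f"
    unfolding weakly_convergent_to_def
  proof
    fix \<phi> assume "\<phi> \<in> dual_space (L_space \<alpha>) p"
    then obtain C g where g: "0 \<le> C" "koethe C g" "\<And>f. f \<in> L_space \<alpha> \<Longrightarrow> \<phi> f = (LINT z|\<mu>. f z * g z)"
      using dual_L_representation by blast
    then show "(\<lambda>n. \<phi> (x n)) \<longlonglongrightarrow> \<phi> f" using f x(1) eq by simp
  qed
  then show "\<exists>f\<in>L_space \<alpha>. weakly_convergent_to (L_space \<alpha>) p x f" using f(1) eq by blast
qed

text \<open>Indicators belong to the Koethe dual and determine an integrable function up to a null
  set.\<close>

lemma AE_eq_of_koethe_limits:
  assumes X: "X \<subseteq> cL_space \<alpha>" and x: "weakly_convergent_to X p x k" and k: "k \<in> X"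
    and f: "f \<in> cL_space \<alpha>"
    and lim: "\<And>C g. 0 \<le> C \<Longrightarrow> koethe C g \<Longrightarrow>
      (\<lambda>n. LINT z|\<mu>. x n z * g z) \<longlonglongrightarrow> (LINT z|\<mu>. f z * g z)"
  shows "AE z in \<mu>. f z = k z"
proof (rule circle.density_unique_banach)
  show "integrable \<mu> f" "integrable \<mu> k"
    using f k X by (auto intro: cL_integrable)
  fix E assume E: "E \<in> sets \<mu>"
  note kE = koethe_indicator[OF E]
  have "(\<lambda>n. LINT z|\<mu>. x n z * of_real (indicator E z)) \<longlonglongrightarrow> (LINT z|\<mu>. k z * of_real (indicator E z))"
    using x koethe_dual[OF kE _ X] unfolding weakly_convergent_to_def by auto
  then have "(LINT z|\<mu>. f z * of_real (indicator E z)) = (LINT z|\<mu>. k z * of_real (indicator E z))"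
    using lim[OF _ kE] by (intro LIMSEQ_unique) auto
  then show "set_lebesgue_integral \<mu> E f = set_lebesgue_integral \<mu> E k"
    unfolding set_lebesgue_integral_def by (simp add: scaleR_conv_of_real mult.commute)
qed

lemma L_eq_cL_of_weakly_seq_complete:
  assumes wsc: "weakly_seq_complete (L_space \<alpha>) p"
  shows "L_space \<alpha> = cL_space \<alpha>"
proof (intro equalityI subsetI)
  fix f assume f: "f \<in> cL_space \<alpha>"
  define x where "x n = trunc n f" for n
  have xL: "x n \<in> L_space \<alpha>" for n unfolding x_def by (intro Linfty_L trunc_Linfty cL_borel f)
  have lim: "(\<lambda>n. LINT z|\<mu>. x n z * g z) \<longlonglongrightarrow> (LINT z|\<mu>. f z * g z)"
    if "koethe C g" for C g
  proof (rule koethe_dominated_convergence[OF that f])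
    show "AE z in \<mu>. norm (x n z) \<le> norm (f z)" for n by (simp add: x_def norm_trunc_le)
    show "AE z in \<mu>. (\<lambda>n. x n z) \<longlonglongrightarrow> f z"
      unfolding x_def by (rule AE_I2) (rule trunc_tendsto)
  qed (use xL f in \<open>auto intro: L_borel cL_borel\<close>)
  have "weakly_Cauchy (L_space \<alpha>) p x"
    unfolding weakly_Cauchy_def
  proof
    fix \<phi> assume "\<phi> \<in> dual_space (L_space \<alpha>) p"
    then obtain C g where "koethe C g" "\<And>f. f \<in> L_space \<alpha> \<Longrightarrow> \<phi> f = (LINT z|\<mu>. f z * g z)"
      using dual_L_representation by blast
    then show "Cauchy (\<lambda>n. \<phi> (x n))" using LIMSEQ_imp_Cauchy[OF lim, of C g] xL by simp
  qed
  then obtain k where k: "k \<in> L_space \<alpha>" "weakly_convergent_to (L_space \<alpha>) p x k"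
    using wsc xL unfolding weakly_seq_complete_def by blast
  have "AE z in \<mu>. f z = k z"
    by (rule AE_eq_of_koethe_limits[OF _ k(2,1) f]) (use L_cL lim in auto)
  then have "AE z in \<mu>. norm (f z) \<le> norm (k z)" by eventually_elim simp
  then show "f \<in> L_space \<alpha>" by (rule L_ideal[OF k(1) cL_borel[OF f]])
qed (rule L_cL)

end

section \<open>Hardy spaces and Fejer means\<close>

lemma analytic_polys_iff: "f \<in> analytic_polys \<longleftrightarrow> (\<exists>P. f = poly P)"
proof
  assume "f \<in> analytic_polys"
  then obtain n :: nat and c where f: "f = (\<lambda>z. \<Sum>k\<le>n. c k * z ^ k)" by (auto simp: analytic_polys_def)
  have "f = poly (\<Sum>k\<le>n. monom (c k) k)" unfolding f by (rule ext) (simp add: poly_sum poly_monom)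
  then show "\<exists>P. f = poly P" ..
next
  assume "\<exists>P. f = poly P"
  then obtain P where "f = poly P" ..
  then have "f = (\<lambda>z. \<Sum>k\<le>degree P. coeff P k * z ^ k)" by (simp add: poly_altdef fun_eq_iff)
  then show "f \<in> analytic_polys" unfolding analytic_polys_def by blast
qed

lemma poly_Linfty: "poly P \<in> Linfty"
  by (intro Linfty_continuous continuous_intros)

lemma analytic_polys_Linfty: "analytic_polys \<subseteq> Linfty"
  by (auto simp: analytic_polys_iff intro: poly_Linfty)

text \<open>Reduces \<open>H1\<close>, defined by the general closure construction, to ordinary
  integrals.\<close>

lemma ext_seminorm_L1:
  assumes f: "f \<in> circle_borel"
  shows "ext_seminorm (\<lambda>f. LINT z|\<mu>. norm (f z)) f = (\<integral>\<^sup>+z. ennreal (norm (f z)) \<partial>\<mu>)"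
    (is "ext_seminorm ?N f = _")
proof (rule antisym)
  have int: "ennreal (LINT z|\<mu>. norm (s z)) = (\<integral>\<^sup>+z. ennreal (norm (s z)) \<partial>\<mu>)"
    if s: "simple_function \<mu> s" for s :: "complex \<Rightarrow> complex"
    using Linfty_integrable[OF Linfty_simple[OF s]] by (intro nn_integral_eq_integral[symmetric]) auto
  show "ext_seminorm ?N f \<le> (\<integral>\<^sup>+z. ennreal (norm (f z)) \<partial>\<mu>)"
    unfolding ext_seminorm_def
  proof (rule SUP_least)
    fix s :: "complex \<Rightarrow> complex"
    assume "s \<in> {s. simple_function \<mu> s \<and> (AE z in \<mu>. norm (s z) \<le> norm (f z))}"
    then have s: "simple_function \<mu> s" "AE z in \<mu>. norm (s z) \<le> norm (f z)" by auto
    have "(\<integral>\<^sup>+z. ennreal (norm (s z)) \<partial>\<mu>) \<le> (\<integral>\<^sup>+z. ennreal (norm (f z)) \<partial>\<mu>)"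
      using s(2) by (intro nn_integral_mono_AE, eventually_elim) (rule ennreal_leI)
    then show "ennreal (LINT z|\<mu>. norm (s z)) \<le> (\<integral>\<^sup>+z. ennreal (norm (f z)) \<partial>\<mu>)"
      by (simp only: int[OF s(1)])
  qed
  obtain s :: "nat \<Rightarrow> complex \<Rightarrow> complex" where
    s: "\<And>n. simple_function \<mu> (s n)" "\<And>n z. norm (s n z) \<le> norm (f z)"
    "\<And>z. (\<lambda>n. s n z) \<longlonglongrightarrow> of_real (norm (f z))"
    using simple_approx_norm[OF f] by blast
  have sB: "s n \<in> circle_borel" for n by (rule borel_measurable_simple_function[OF s(1)])
  have "(\<integral>\<^sup>+z. ennreal (norm (f z)) \<partial>\<mu>)
      = (\<integral>\<^sup>+z. liminf (\<lambda>n. ennreal (norm (s n z))) \<partial>\<mu>)"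
  proof (rule nn_integral_cong)
    fix z
    have "(\<lambda>n. ennreal (norm (s n z))) \<longlonglongrightarrow> ennreal (norm (complex_of_real (norm (f z))))"
      by (rule tendsto_ennrealI[OF tendsto_norm[OF s(3)]])
    then have "(\<lambda>n. ennreal (norm (s n z))) \<longlonglongrightarrow> ennreal (norm (f z))" by simp
    then show "ennreal (norm (f z)) = liminf (\<lambda>n. ennreal (norm (s n z)))"
      by (rule lim_imp_Liminf[OF sequentially_bot, symmetric])
  qed
  also have "\<dots> \<le> liminf (\<lambda>n. \<integral>\<^sup>+z. ennreal (norm (s n z)) \<partial>\<mu>)"
    using sB by (intro nn_integral_liminf) measurable
  also have "\<dots> \<le> ext_seminorm ?N f"
  proof (rule Liminf_le[OF sequentially_bot always_eventually], rule allI)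
    fix n
    show "(\<integral>\<^sup>+z. ennreal (norm (s n z)) \<partial>\<mu>) \<le> ext_seminorm ?N f"
      unfolding int[OF s(1), symmetric] ext_seminorm_def by (rule SUP_upper) (simp add: s)
  qed
  finally show "(\<integral>\<^sup>+z. ennreal (norm (f z)) \<partial>\<mu>) \<le> ext_seminorm ?N f" .
qed

lemma H1_iff:
  "f \<in> H1 \<longleftrightarrow> integrable \<mu> f \<and> (\<forall>e>0. \<exists>P. (LINT z|\<mu>. norm (f z - poly P z)) < e)"
proof -
  let ?N = "\<lambda>f::complex \<Rightarrow> complex. LINT z|\<mu>. norm (f z)"
  have cL: "f \<in> cL_space ?N \<longleftrightarrow> integrable \<mu> f"
    unfolding cL_space_def integrable_iff_bounded by (auto simp: ext_seminorm_L1)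
  have ext: "ext_seminorm ?N (\<lambda>z. f z - poly P z) = ennreal (LINT z|\<mu>. norm (f z - poly P z))"
    if f: "integrable \<mu> f" for P
  proof -
    have i: "integrable \<mu> (\<lambda>z. f z - poly P z)"
      by (rule Bochner_Integration.integrable_diff[OF f Linfty_integrable[OF poly_Linfty]])
    show ?thesis
      by (subst ext_seminorm_L1[OF borel_measurable_integrable[OF i]])
         (rule nn_integral_eq_integral[OF integrable_norm[OF i]], simp)
  qed
  show ?thesis
  proof
    assume "f \<in> H1"
    then have *: "f \<in> cL_space ?N" "\<And>e. 0 < e \<Longrightarrow> \<exists>g\<in>analytic_polys. ext_seminorm ?N (\<lambda>z. f z - g z) < e"
      unfolding H1_def H_space_def seminorm_closure_def by blast+
    have i: "integrable \<mu> f" using *(1) cL by blast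
    have "\<exists>P. (LINT z|\<mu>. norm (f z - poly P z)) < e" if e: "0 < e" for e
    proof -
      obtain P where "ext_seminorm ?N (\<lambda>z. f z - poly P z) < ennreal e"
        using *(2)[of "ennreal e"] e by (auto simp: analytic_polys_iff)
      then show ?thesis unfolding ext[OF i] using ennreal_less_iff by (auto intro!: exI[of _ P] simp: ennreal_less_iff)
    qed
    with i show "integrable \<mu> f \<and> (\<forall>e>0. \<exists>P. (LINT z|\<mu>. norm (f z - poly P z)) < e)" by blast
  next
    assume *: "integrable \<mu> f \<and> (\<forall>e>0. \<exists>P. (LINT z|\<mu>. norm (f z - poly P z)) < e)"
    then have i: "integrable \<mu> f" by blast
    show "f \<in> H1"
      unfolding H1_def H_space_def seminorm_closure_def
    proof (intro CollectI conjI allI impI)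
      show "f \<in> cL_space ?N" using i cL by blast
      fix e :: ennreal assume "0 < e"
      then obtain r :: real where r: "0 < r" "ennreal r \<le> e"
        by (cases e) (auto intro: that[of 1])
      obtain P where "(LINT z|\<mu>. norm (f z - poly P z)) < r" using * r(1) by blast
      then have "ext_seminorm ?N (\<lambda>z. f z - poly P z) < ennreal r"
        unfolding ext[OF i] using r(1) by (intro ennreal_lessI)
      then show "\<exists>g\<in>analytic_polys. ext_seminorm ?N (\<lambda>z. f z - g z) < e"
        using r(2) by (intro bexI[of _ "poly P"]) (auto simp: analytic_polys_iff)
    qed
  qed
qed

lemma integral_poly_power_eq_0:
  assumes "0 < k" shows "(LINT z|\<mu>. poly P z * z ^ k) = 0"
  using integral_circle_trig_poly[of 0 P 0 k] assms by simp

lemma integrable_mult_power: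
  fixes f :: "complex \<Rightarrow> complex"
  assumes f: "integrable \<mu> f"
  shows "integrable \<mu> (\<lambda>z. f z * z ^ k)"
    "(LINT z|\<mu>. norm (f z * z ^ k)) = (LINT z|\<mu>. norm (f z))"
proof -
  have z: "(\<lambda>z::complex. z ^ k) \<in> circle_borel" by (intro circle_borel_continuous continuous_intros)
  show "integrable \<mu> (\<lambda>z. f z * z ^ k)"
  proof (rule Bochner_Integration.integrable_bound[OF f])
    show "(\<lambda>z. f z * z ^ k) \<in> circle_borel"
      by (rule borel_measurable_times[OF borel_measurable_integrable[OF f] z])
    show "AE z in \<mu>. norm (f z * z ^ k) \<le> norm (f z)"
      using AE_circle by eventually_elim (simp add: norm_mult norm_power)
  qed
  show "(LINT z|\<mu>. norm (f z * z ^ k)) = (LINT z|\<mu>. norm (f z))"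
    by (rule Bochner_Integration.integral_cong[OF refl]) (simp add: norm_mult norm_power)
qed

text \<open>The integral is the Fourier coefficient of index -k; it vanishes on analytic polynomials
  and is continuous in L1.\<close>

lemma H1_moment_eq_0:
  assumes f: "f \<in> H1" and k: "0 < k"
  shows "(LINT z|\<mu>. f z * z ^ k) = 0"
proof -
  have i: "integrable \<mu> f" using f H1_iff by blast
  have "norm (LINT z|\<mu>. f z * z ^ k) \<le> 0"
  proof (rule field_le_epsilon)
    fix e :: real assume "0 < e"
    then obtain P where P: "(LINT z|\<mu>. norm (f z - poly P z)) < e" using f H1_iff by blast
    have iP: "integrable \<mu> (poly P)" by (rule Linfty_integrable[OF poly_Linfty])
    have "(LINT z|\<mu>. f z * z ^ k) = (LINT z|\<mu>. (f z - poly P z) * z ^ k)"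
      using Bochner_Integration.integral_diff[OF integrable_mult_power(1)[OF i] integrable_mult_power(1)[OF iP], of k k]
        integral_poly_power_eq_0[OF k, of P]
      by (simp add: left_diff_distrib)
    also have "norm \<dots> \<le> (LINT z|\<mu>. norm ((f z - poly P z) * z ^ k))" by (rule integral_norm_bound)
    also have "\<dots> = (LINT z|\<mu>. norm (f z - poly P z))"
      by (rule integrable_mult_power(2)[OF Bochner_Integration.integrable_diff[OF i iP]])
    finally show "norm (LINT z|\<mu>. f z * z ^ k) \<le> 0 + e" using P by simp
  qed
  then show ?thesis by simp
qed

section \<open>Fejer means and the analytic part\<close>

lemma coeff_fejer_poly: "coeff (fejer_poly n N P) i = of_real (fejer_coeff n N i) * coeff P i"
proof -
  have "coeff (fejer_poly n N P) i = (\<Sum>j\<le>degree P. if j = i then of_real (fejer_coeff n N j) * coeff P j else 0)"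
    unfolding fejer_poly_def coeff_sum by (intro sum.cong refl) simp
  also have "\<dots> = of_real (fejer_coeff n N i) * coeff P i" by (auto simp: coeff_eq_0)
  finally show ?thesis .
qed

lemma fejer_poly_diff: "fejer_poly n N (P - Q) = fejer_poly n N P - fejer_poly n N Q"
  by (rule poly_eqI) (simp add: coeff_fejer_poly right_diff_distrib)

lemma fejer_coeff_shift: "fejer_coeff n (N + K) (i + K) = fejer_coeff n N i"
  by (simp add: fejer_coeff_def flip: add.assoc)

text \<open>A trigonometric polynomial has many representations \<open>cnj z ^ N * poly P z\<close>.
  Fejer means do not depend on the choice, so two polynomials can be brought over a common power of
  \<open>cnj z\<close>.\<close>

lemma fejer_poly_shift: "fejer_poly n (N + K) (monom 1 K * P) = monom 1 K * fejer_poly n N P"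
proof (rule poly_eqI)
  fix i
  show "coeff (fejer_poly n (N + K) (monom 1 K * P)) i = coeff (monom 1 K * fejer_poly n N P) i"
    using fejer_coeff_shift[of n N K "i - K"] by (auto simp: coeff_fejer_poly coeff_monom_mult)
qed

lemma trig_poly_shift:
  assumes "z \<in> sphere 0 1"
  shows "cnj z ^ (N + K) * poly (monom 1 K * P) z = cnj z ^ N * poly P z"
  using cnj_power_cancel[OF assms, of N K] by (simp add: poly_monom flip: mult.assoc)

context rotational_seminorm
begin

lemma H_cL: "f \<in> H_space \<alpha> \<Longrightarrow> f \<in> cL_space \<alpha>"
  unfolding H_space_def by (rule seminorm_closureD)

lemma H_subset_L: "H_space \<alpha> \<subseteq> L_space \<alpha>"
  unfolding H_space_def L_space_def by (rule seminorm_closure_mono[OF analytic_polys_Linfty])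

lemma poly_H: "poly P \<in> H_space \<alpha>"
  unfolding H_space_def
  by (rule seminorm_closure_base[OF Linfty_cL[OF poly_Linfty]]) (auto simp: analytic_polys_iff)

lemma H_subspace: "function_subspace (H_space \<alpha>)"
  unfolding function_subspace_def
proof (intro conjI ballI allI)
  have B: "analytic_polys \<subseteq> circle_borel" using analytic_polys_Linfty Linfty_borel by blast
  show "(\<lambda>z. 0) \<in> H_space \<alpha>" 
  proof -
    have "(\<lambda>z. 0) = poly (0 :: complex poly)" by auto
    then show ?thesis using poly_H[of 0] by (simp only:)
  qed
  show "(\<lambda>z. f z + g z) \<in> H_space \<alpha>" if "f \<in> H_space \<alpha>" "g \<in> H_space \<alpha>" for f g
    unfolding H_space_def
  proof (rule seminorm_closure_add[OF B _ that[unfolded H_space_def]])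
    show "(\<lambda>z. u z + v z) \<in> analytic_polys" if uv: "u \<in> analytic_polys" "v \<in> analytic_polys" for u v
    proof -
      obtain P Q where "u = poly P" "v = poly Q" using uv analytic_polys_iff by auto
      then have "(\<lambda>z. u z + v z) = poly (P + Q)" by auto
      then show ?thesis using analytic_polys_iff by blast
    qed
  qed
  show "(\<lambda>z. c * f z) \<in> H_space \<alpha>" if "f \<in> H_space \<alpha>" for c f
    unfolding H_space_def
  proof (rule seminorm_closure_cmult[OF B _ that[unfolded H_space_def]])
    show "(\<lambda>z. c * u z) \<in> analytic_polys" if u: "u \<in> analytic_polys" for u
    proof -
      obtain P where "u = poly P" using u analytic_polys_iff by auto
      then have "(\<lambda>z. c * u z) = poly (smult c P)" by auto
      then show ?thesis using analytic_polys_iff by blast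
    qed
  qed
qed

lemma H_subset_H1: "H_space \<alpha> \<subseteq> H1"
proof
  fix f assume f: "f \<in> H_space \<alpha>"
  show "f \<in> H1" unfolding H1_iff
  proof (intro conjI allI impI)
    show "integrable \<mu> f" by (rule cL_integrable[OF H_cL[OF f]])
    fix e :: real assume e: "0 < e"
    obtain P where P: "p (\<lambda>z. f z - poly P z) < ennreal e"
      using seminorm_closureD(2)[OF f[unfolded H_space_def] e] by (auto simp: analytic_polys_iff)
    have d: "(\<lambda>z. f z - poly P z) \<in> cL_space \<alpha>" by (rule cL_diff[OF H_cL[OF f] Linfty_cL[OF poly_Linfty]])
    have "enn2real (p (\<lambda>z. f z - poly P z)) < e"
      using P e by (metis enn2real_less_iff ennreal_less_top order_less_trans ennreal_enn2real ennreal_less_iff enn2real_nonneg)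
    then show "\<exists>P. (LINT z|\<mu>. norm (f z - poly P z)) < e"
      using integral_norm_le_p[OF d] by (intro exI[of _ P]) linarith
  qed
qed

text \<open>\<open>alpha_small\<close> upgrades L1-density with a uniform bound to density in
  \<open>p\<close>.\<close>

lemma trig_polys_dense_L:
  assumes f: "f \<in> L_space \<alpha>" and e: "0 < e"
  obtains N P where "p (\<lambda>z. f z - cnj z ^ N * poly P z) < ennreal e"
proof -
  obtain b where b: "b \<in> Linfty" "p (\<lambda>z. f z - b z) < ennreal (e/2)"
    using seminorm_closureD(2)[OF f[unfolded L_space_def], of "e/2"] e by auto
  obtain C where C: "b \<in> circle_borel" "0 \<le> C" "AE z in \<mu>. norm (b z) \<le> C"
    using LinftyD[OF b(1)] .
  obtain d where d: "0 < d"
    "\<And>f. f \<in> circle_borel \<Longrightarrow> AE z in \<mu>. norm (f z) \<le> 2 * C + 1 \<Longrightarrow>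
       (LINT z|\<mu>. norm (f z)) < d \<Longrightarrow> \<alpha> f < e/2"
    using alpha_small[of "e/2" "2 * C + 1"] e C by auto
  obtain t where t: "t \<in> trig_polys" "\<And>z. z \<in> sphere 0 1 \<Longrightarrow> norm (t z) \<le> C + 1"
    "(LINT z|\<mu>. norm (b z - t z)) < d"
    using trig_polys_dense_bounded[OF C(1,3,2) d(1)] by blast
  obtain N P where NP: "\<And>z. z \<in> sphere 0 1 \<Longrightarrow> t z = cnj z ^ N * poly P z"
    using t(1) unfolding trig_polys_def by blast
  have tL: "t \<in> Linfty" by (intro Linfty_continuous trig_polys_continuous t)
  have "\<alpha> (\<lambda>z. b z - t z) < e/2"
  proof (rule d(2)[OF _ _ t(3)])
    show "(\<lambda>z. b z - t z) \<in> circle_borel" by (rule Linfty_borel[OF Linfty_diff[OF b(1) tL]])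
    show "AE z in \<mu>. norm (b z - t z) \<le> 2 * C + 1"
      using C(3) AE_circle
    proof eventually_elim
      case (elim z) then show ?case using norm_triangle_ineq4[of "b z" "t z"] t(2)[OF elim(2)] by simp
    qed
  qed
  then have bt: "p (\<lambda>z. b z - t z) < ennreal (e/2)"
    unfolding p_Linfty[OF Linfty_diff[OF b(1) tL]] using e by (intro ennreal_lessI) auto
  have "p (\<lambda>z. f z - cnj z ^ N * poly P z) = p (\<lambda>z. f z - t z)"
    by (rule p_cong, rule AE_mp[OF AE_circle], rule AE_I2) (simp add: NP)
  also have "\<dots> \<le> p (\<lambda>z. f z - b z) + p (\<lambda>z. b z - t z)"
    by (rule p_triangle[OF L_borel[OF f] C(1) Linfty_borel[OF tL]])
  also have "\<dots> < ennreal (e/2) + ennreal (e/2)" by (rule add_strict_mono[OF b(2) bt])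
  also have "\<dots> = ennreal e" using e by (simp flip: ennreal_plus)
  finally show ?thesis by (rule that)
qed

text \<open>Finitely many coefficients are multiplied by weights tending to 1, so the error is even
  uniformly small on the circle.\<close>

lemma fejer_poly_converges:
  assumes e: "0 < e"
  obtains n where "0 < n" "\<alpha> (\<lambda>z. cnj z ^ N * poly P z - cnj z ^ N * poly (fejer_poly n N P) z) \<le> e"
proof -
  have "(\<lambda>n. \<Sum>i\<le>degree P. (1 - fejer_coeff n N i) * norm (coeff P i)) \<longlonglongrightarrow> (\<Sum>i\<le>degree P. (1 - 1) * norm (coeff P i))"
    by (intro tendsto_intros fejer_coeff_tendsto)
  then have "\<forall>\<^sub>F n in sequentially. (\<Sum>i\<le>degree P. (1 - fejer_coeff n N i) * norm (coeff P i)) < e"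
    using e by (intro order_tendstoD) auto
  then have "\<forall>\<^sub>F n in sequentially. 0 < n \<and> (\<Sum>i\<le>degree P. (1 - fejer_coeff n N i) * norm (coeff P i)) < e"
    using eventually_gt_at_top[of 0] by (simp add: eventually_conj_iff)
  then obtain n where n: "0 < n" "(\<Sum>i\<le>degree P. (1 - fejer_coeff n N i) * norm (coeff P i)) < e"
    by (auto simp: eventually_sequentially)
  show ?thesis
  proof (rule that[OF n(1)])
    have "\<alpha> (\<lambda>z. cnj z ^ N * poly P z - cnj z ^ N * poly (fejer_poly n N P) z) \<le> (\<Sum>i\<le>degree P. (1 - fejer_coeff n N i) * norm (coeff P i))"
    proof (rule alpha_le)
      show "(\<lambda>z. cnj z ^ N * poly P z - cnj z ^ N * poly (fejer_poly n N P) z) \<in> circle_borel"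
        by (intro circle_borel_continuous continuous_intros)
      show "0 \<le> (\<Sum>i\<le>degree P. (1 - fejer_coeff n N i) * norm (coeff P i))"
        by (intro sum_nonneg mult_nonneg_nonneg) (auto simp: fejer_coeff_le_1)
      show "AE z in \<mu>. norm (cnj z ^ N * poly P z - cnj z ^ N * poly (fejer_poly n N P) z)
          \<le> (\<Sum>i\<le>degree P. (1 - fejer_coeff n N i) * norm (coeff P i))"
        using AE_circle
      proof eventually_elim
        case (elim z)
        then have nz: "norm z = 1" by simp
        have "cnj z ^ N * poly P z - cnj z ^ N * poly (fejer_poly n N P) z
            = cnj z ^ N * (\<Sum>i\<le>degree P. of_real (1 - fejer_coeff n N i) * coeff P i * z ^ i)"
          unfolding poly_fejer_poly poly_altdef[of P] right_diff_distrib[symmetric] sum_subtractf[symmetric]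
          by (simp add: left_diff_distrib)
        also have "norm \<dots> = norm (\<Sum>i\<le>degree P. of_real (1 - fejer_coeff n N i) * coeff P i * z ^ i)"
          using nz by (simp add: norm_mult norm_power)
        also have "\<dots> \<le> (\<Sum>i\<le>degree P. norm (of_real (1 - fejer_coeff n N i) * coeff P i * z ^ i))"
          by (rule norm_sum)
        also have "\<dots> = (\<Sum>i\<le>degree P. (1 - fejer_coeff n N i) * norm (coeff P i))"
          using nz fejer_coeff_le_1[of n N] by (intro sum.cong refl) (simp add: norm_mult norm_power del: of_real_diff)
        finally show ?case .
      qed
    qed
    then show "\<alpha> (\<lambda>z. cnj z ^ N * poly P z - cnj z ^ N * poly (fejer_poly n N P) z) \<le> e" using n(2) by simp
  qed
qed

text \<open>A Fejer mean has fewer than \<open>n\<close> coefficients of negative index, and those of a trigonometric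
  polynomial close to \<open>f\<close> are small, so they can be discarded.\<close>

lemma fejer_poly_analytic_part:
  assumes d: "0 \<le> d" and small: "\<And>i. i < N \<Longrightarrow> norm (coeff P i) \<le> d"
  obtains Q where "\<alpha> (\<lambda>z. cnj z ^ N * poly (fejer_poly n N P) z - poly Q z) \<le> real n * d"
proof -
  let ?c = "\<lambda>i. of_real (fejer_coeff n N i) * coeff P i"
  define I where "I = {..degree P}"
  define Q where "Q = (\<Sum>i\<in>I - {..<N}. monom (?c i) (i - N))"
  have eq: "cnj z ^ N * poly (fejer_poly n N P) z - poly Q z = (\<Sum>i\<in>I \<inter> {..<N}. cnj z ^ N * (?c i * z ^ i))"
    if z: "z \<in> sphere 0 1" for z
  proof -
    have "cnj z ^ N * poly (fejer_poly n N P) z = (\<Sum>i\<in>I. cnj z ^ N * (?c i * z ^ i))"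
      by (simp add: poly_fejer_poly sum_distrib_left I_def)
    also have "\<dots> = (\<Sum>i\<in>I \<inter> {..<N}. cnj z ^ N * (?c i * z ^ i)) + (\<Sum>i\<in>I - {..<N}. cnj z ^ N * (?c i * z ^ i))"
      by (rule sum.Int_Diff) (simp add: I_def)
    also have "(\<Sum>i\<in>I - {..<N}. cnj z ^ N * (?c i * z ^ i)) = poly Q z"
      unfolding Q_def poly_sum poly_monom
    proof (rule sum.cong[OF refl])
      fix i assume "i \<in> I - {..<N}"
      then obtain k where k: "i = N + k" using le_Suc_ex by (auto simp: not_less)
      have "cnj z ^ N * z ^ i = z ^ k"
        using cnj_power_cancel[OF z, of 0 N] by (simp add: k power_add flip: mult.assoc)
      then show "cnj z ^ N * (?c i * z ^ i) = ?c i * z ^ (i - N)"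
        by (simp add: k mult.left_commute)
    qed
    finally show ?thesis by simp
  qed
  show ?thesis
  proof (rule that)
    have nd: "0 \<le> real n * d" using d by simp
    show "\<alpha> (\<lambda>z. cnj z ^ N * poly (fejer_poly n N P) z - poly Q z) \<le> real n * d"
    proof (rule alpha_le[OF _ _ nd])
      show "(\<lambda>z. cnj z ^ N * poly (fejer_poly n N P) z - poly Q z) \<in> circle_borel"
        by (intro circle_borel_continuous continuous_intros)
      show "AE z in \<mu>. norm (cnj z ^ N * poly (fejer_poly n N P) z - poly Q z) \<le> real n * d"
        using AE_circle
      proof eventually_elim
        case (elim z)
        then have nz: "norm z = 1" by simp
        have "norm (cnj z ^ N * poly (fejer_poly n N P) z - poly Q z) \<le> (\<Sum>i\<in>I \<inter> {..<N}. norm (cnj z ^ N * (?c i * z ^ i)))"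
          unfolding eq[OF elim] by (rule norm_sum)
        also have "\<dots> = (\<Sum>i\<in>I \<inter> {..<N}. fejer_coeff n N i * norm (coeff P i))"
          using nz by (intro sum.cong refl) (simp add: norm_mult norm_power fejer_coeff_nonneg)
        \<comment> \<open>The weight vanishes below index \<open>N - n\<close>, so at most
          \<open>n\<close> terms remain; the truncated subtraction is also right when
          \<open>N < n\<close>.\<close>
        also have "\<dots> = (\<Sum>i\<in>I \<inter> {..<N} \<inter> {N-n..<N}. fejer_coeff n N i * norm (coeff P i))"
        proof (rule sum.mono_neutral_right)
          have "fejer_coeff n N i = 0" if "i < N - n" for i using that by (intro fejer_coeff_eq_0) auto
          then show "\<forall>i\<in>I \<inter> {..<N} - I \<inter> {..<N} \<inter> {N-n..<N}. fejer_coeff n N i * norm (coeff P i) = 0"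
            by (auto simp: not_le)
        qed (auto simp: I_def)
        also have "\<dots> \<le> (\<Sum>i\<in>I \<inter> {..<N} \<inter> {N-n..<N}. 1 * d)"
          using small by (intro sum_mono mult_mono fejer_coeff_le_1) auto
        also have "\<dots> = real (card (I \<inter> {..<N} \<inter> {N-n..<N})) * d" by simp
        also have "\<dots> \<le> real n * d"
        proof (rule mult_right_mono[OF _ d])
          have "card (I \<inter> {..<N} \<inter> {N-n..<N}) \<le> card {N-n..<N}" by (intro card_mono) auto
          then show "real (card (I \<inter> {..<N} \<inter> {N-n..<N})) \<le> real n" by simp
        qed
        finally show ?case .
      qed
    qed
  qed
qed

text \<open>Two successive approximations avoid a circle. The first trigonometric polynomial fixes
  the order \<open>n\<close> of the Fejer mean; only then is the second taken so close to
  \<open>f\<close> that its coefficients of negative index are at most \<open>d / n\<close>.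
  Discarding at most \<open>n\<close> of them costs \<open>d\<close>.\<close>

lemma H_spaceI:
  assumes f: "f \<in> L_space \<alpha>"
    and mom: "\<And>k. 0 < k \<Longrightarrow> (LINT z|\<mu>. f z * z ^ k) = 0"
  shows "f \<in> H_space \<alpha>"
  unfolding H_space_def
proof (rule seminorm_closureI[OF L_cL[OF f]])
  fix e :: real assume e: "0 < e"
  \<comment> \<open>The errors are \<open>d\<close> between \<open>f\<close> and \<open>R\<close>,
    \<open>d\<close> for the Fejer mean of \<open>R\<close>, \<open>2 * d\<close> for passing to the
    mean of \<open>S\<close>, and \<open>d\<close> for the discarded part; the sixth share makes the
    inequality strict.\<close>
  define d where "d = e / 6"
  have d: "0 < d" using e by (simp add: d_def)
  obtain N P where NP: "p (\<lambda>z. f z - cnj z ^ N * poly P z) < ennreal d"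
    using trig_polys_dense_L[OF f d] .
  obtain n where n: "0 < n" "\<alpha> (\<lambda>z. cnj z ^ N * poly P z - cnj z ^ N * poly (fejer_poly n N P) z) \<le> d"
    using fejer_poly_converges[OF d] .
  have dn: "0 < d / n" "d / n \<le> d" using d n(1) by (auto simp: divide_le_eq)
  obtain N' P' where NP': "p (\<lambda>z. f z - cnj z ^ N' * poly P' z) < ennreal (d / n)"
    using trig_polys_dense_L[OF f dn(1)] .
  define L where "L = N + N'"
  define R where "R = monom 1 N' * P"
  define S where "S = monom 1 N * P'"
  define t where "t Q z = cnj z ^ L * poly Q z" for Q z
  have tL: "t Q \<in> Linfty" for Q unfolding t_def by (rule Linfty_trig_poly)
  have tR: "t R z = cnj z ^ N * poly P z" if "z \<in> sphere 0 1" for z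
    unfolding t_def R_def L_def by (rule trig_poly_shift[OF that])
  have tS: "t S z = cnj z ^ N' * poly P' z" if "z \<in> sphere 0 1" for z
    unfolding t_def S_def L_def add.commute[of N] by (rule trig_poly_shift[OF that])
  have tFR: "t (fejer_poly n L R) z = cnj z ^ N * poly (fejer_poly n N P) z" if "z \<in> sphere 0 1" for z
    unfolding t_def R_def L_def fejer_poly_shift by (rule trig_poly_shift[OF that])
  have pR: "p (\<lambda>z. f z - t R z) < ennreal d"
  proof -
    have "p (\<lambda>z. f z - t R z) = p (\<lambda>z. f z - cnj z ^ N * poly P z)"
      by (rule p_cong, rule AE_mp[OF AE_circle], rule AE_I2) (simp add: tR)
    then show ?thesis using NP by (simp only:)
  qed
  have pS: "p (\<lambda>z. f z - t S z) < ennreal (d / n)"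
  proof -
    have "p (\<lambda>z. f z - t S z) = p (\<lambda>z. f z - cnj z ^ N' * poly P' z)"
      by (rule p_cong, rule AE_mp[OF AE_circle], rule AE_I2) (simp add: tS)
    then show ?thesis using NP' by (simp only:)
  qed
  have a1: "\<alpha> (\<lambda>z. t R z - t (fejer_poly n L R) z) \<le> d"
  proof -
    have "\<alpha> (\<lambda>z. t R z - t (fejer_poly n L R) z) = \<alpha> (\<lambda>z. cnj z ^ N * poly P z - cnj z ^ N * poly (fejer_poly n N P) z)"
      by (rule alpha_cong[OF Linfty_diff[OF tL tL] Linfty_diff[OF Linfty_trig_poly Linfty_trig_poly]],
          rule AE_mp[OF AE_circle], rule AE_I2) (simp add: tR tFR)
    then show ?thesis using n(2) by simp
  qed
  have RS: "\<alpha> (\<lambda>z. t R z - t S z) \<le> 2 * d"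
  proof -
    have "ennreal (\<alpha> (\<lambda>z. t R z - t S z)) = p (\<lambda>z. t R z - t S z)" by (rule p_Linfty[OF Linfty_diff[OF tL tL], symmetric])
    also have "\<dots> \<le> p (\<lambda>z. t R z - f z) + p (\<lambda>z. f z - t S z)"
      by (rule p_triangle[OF Linfty_borel[OF tL] L_borel[OF f] Linfty_borel[OF tL]])
    also have "\<dots> \<le> ennreal d + ennreal (d / n)"
      unfolding p_minus_commute[of "t R" f] by (intro add_mono less_imp_le pR pS)
    also have "\<dots> = ennreal (d + d / n)" using d dn by (simp flip: ennreal_plus)
    finally have "ennreal (\<alpha> (\<lambda>z. t R z - t S z)) \<le> ennreal (d + d / n)" .
    then have "\<alpha> (\<lambda>z. t R z - t S z) \<le> d + d / n" using d dn by (subst (asm) ennreal_le_iff) auto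
    then show ?thesis using dn by simp
  qed
  have a2: "\<alpha> (\<lambda>z. t (fejer_poly n L R) z - t (fejer_poly n L S) z) \<le> 2 * d"
  proof -
    have "\<alpha> (\<lambda>z. t (fejer_poly n L R) z - t (fejer_poly n L S) z) = \<alpha> (\<lambda>z. cnj z ^ L * poly (fejer_poly n L (R - S)) z)"
      by (simp add: t_def fejer_poly_diff right_diff_distrib)
    also have "\<dots> \<le> \<alpha> (\<lambda>z. cnj z ^ L * poly (R - S) z)" by (rule alpha_fejer[OF n(1)])
    also have "\<dots> = \<alpha> (\<lambda>z. t R z - t S z)" by (simp add: t_def right_diff_distrib)
    finally show ?thesis using RS by simp
  qed
  have fS: "(\<lambda>z. f z - t S z) \<in> cL_space \<alpha>" by (rule cL_diff[OF L_cL[OF f] Linfty_cL[OF tL]])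
  have intS: "(LINT z|\<mu>. norm (f z - t S z)) \<le> d / n"
  proof -
    have "enn2real (p (\<lambda>z. f z - t S z)) \<le> d / n"
      using pS dn(1) by (intro enn2real_leI less_imp_le)
    then show ?thesis using integral_norm_le_p[OF fS] by simp
  qed
  have small: "norm (coeff S i) \<le> d / n" if i: "i < L" for i
  proof -
    \<comment> \<open>Index \<open>i < L\<close> is the frequency i - L. The corresponding moment of
      \<open>f\<close> is 0, so the coefficient measures only the error of the approximation by
      \<open>S\<close>.\<close>
    have "coeff S i = (LINT z|\<mu>. t S z * z ^ (L - i))"
      using integral_circle_trig_poly[of L S 0 "L - i"] i by (simp add: t_def)
    also have "\<dots> = - (LINT z|\<mu>. (f z - t S z) * z ^ (L - i))"
      using Bochner_Integration.integral_diff[OF integrable_mult_power(1)[OF cL_integrable[OF L_cL[OF f]]]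
          integrable_mult_power(1)[OF Linfty_integrable[OF tL]], of "L - i" S "L - i"] mom[of "L - i"] i
      by (simp add: left_diff_distrib)
    finally have "norm (coeff S i) = norm (LINT z|\<mu>. (f z - t S z) * z ^ (L - i))" by simp
    also have "\<dots> \<le> (LINT z|\<mu>. norm ((f z - t S z) * z ^ (L - i)))" by (rule integral_norm_bound)
    also have "\<dots> = (LINT z|\<mu>. norm (f z - t S z))"
      by (rule integrable_mult_power(2)[OF cL_integrable[OF fS]])
    finally show ?thesis using intS by simp
  qed
  obtain Q where Q: "\<alpha> (\<lambda>z. t (fejer_poly n L S) z - poly Q z) \<le> real n * (d / n)"
    unfolding t_def by (rule fejer_poly_analytic_part[OF less_imp_le[OF dn(1)] small])
  have "p (\<lambda>z. f z - poly Q z) \<le> p (\<lambda>z. f z - t R z) + p (\<lambda>z. t R z - poly Q z)"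
    by (rule p_triangle[OF L_borel[OF f] Linfty_borel[OF tL] Linfty_borel[OF poly_Linfty]])
  also have "p (\<lambda>z. t R z - poly Q z) \<le> ennreal (4 * d)"
  proof -
    have "\<alpha> (\<lambda>z. t R z - poly Q z) \<le> \<alpha> (\<lambda>z. t R z - t (fejer_poly n L R) z) + \<alpha> (\<lambda>z. t (fejer_poly n L R) z - poly Q z)"
      using alpha_add[OF Linfty_diff[OF tL tL] Linfty_diff[OF tL poly_Linfty], of R "fejer_poly n L R" "fejer_poly n L R" Q] by simp
    also have "\<alpha> (\<lambda>z. t (fejer_poly n L R) z - poly Q z) \<le> \<alpha> (\<lambda>z. t (fejer_poly n L R) z - t (fejer_poly n L S) z) + \<alpha> (\<lambda>z. t (fejer_poly n L S) z - poly Q z)"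
      using alpha_add[OF Linfty_diff[OF tL tL] Linfty_diff[OF tL poly_Linfty], of "fejer_poly n L R" "fejer_poly n L S" "fejer_poly n L S" Q] by simp
    finally have "\<alpha> (\<lambda>z. t R z - poly Q z) \<le> 4 * d" using a1 a2 Q n(1) by simp
    then show ?thesis unfolding p_Linfty[OF Linfty_diff[OF tL poly_Linfty]] by (rule ennreal_leI)
  qed
  also have "p (\<lambda>z. f z - t R z) + ennreal (4 * d) \<le> ennreal d + ennreal (4 * d)"
    using pR by (intro add_right_mono less_imp_le)
  also have "\<dots> = ennreal (5 * d)" using d by (simp flip: ennreal_plus)
  also have "\<dots> < ennreal e" using e by (intro ennreal_lessI) (auto simp: d_def)
  finally show "\<exists>g\<in>analytic_polys. p (\<lambda>z. f z - g z) < ennreal e"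
    by (intro bexI[of _ "poly Q"]) (auto simp: analytic_polys_iff add_left_mono)
qed

lemma H_space_eq: "H_space \<alpha> = L_space \<alpha> \<inter> H1"
  using H_subset_L H_subset_H1 H_spaceI H1_moment_eq_0 by blast

end

section \<open>Outer functions\<close>

text \<open>The mean of the squared polynomial is the square of its constant term, here nonnegative,
  while its real part is the difference of the two integrals. This replaces the mean-square theory
  of conjugate functions.\<close>

lemma integral_Im_poly_le:
  assumes "Im (coeff P 0) = 0"
  shows "(LINT z|\<mu>. (Im (poly P z))\<^sup>2) \<le> (LINT z|\<mu>. (Re (poly P z))\<^sup>2)"
proof -
  have i: "integrable \<mu> (\<lambda>z. (poly P z)\<^sup>2)"
    by (intro integrable_continuous_circle continuous_intros)
  have iR: "integrable \<mu> (\<lambda>z. (Re (poly P z))\<^sup>2)" "integrable \<mu> (\<lambda>z. (Im (poly P z))\<^sup>2)"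
  proof -
    have *: "integrable \<mu> u" if "continuous_on (sphere 0 1) u" for u :: "complex \<Rightarrow> real"
    proof -
      have "integrable \<mu> (\<lambda>z. complex_of_real (u z))"
        using that by (intro integrable_continuous_circle continuous_on_of_real)
      then have "integrable \<mu> (\<lambda>z. Re (complex_of_real (u z)))" by (rule integrable_Re)
      then show ?thesis by simp
    qed
    show "integrable \<mu> (\<lambda>z. (Re (poly P z))\<^sup>2)" "integrable \<mu> (\<lambda>z. (Im (poly P z))\<^sup>2)"
      by (intro * continuous_intros)+
  qed
  have "(LINT z|\<mu>. (poly P z)\<^sup>2) = (coeff P 0)\<^sup>2"
    using integral_circle_trig_poly[of 0 "P * P" 0 0] by (simp add: power2_eq_square coeff_mult)
  then have "(LINT z|\<mu>. Re ((poly P z)\<^sup>2)) = Re ((coeff P 0)\<^sup>2)"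
    using integral_Re[OF i] by simp
  also have "\<dots> \<ge> 0" using assms by (simp add: power2_eq_square)
  finally have "0 \<le> (LINT z|\<mu>. (Re (poly P z))\<^sup>2 - (Im (poly P z))\<^sup>2)"
    by (simp add: power2_eq_square)
  then show ?thesis using iR by simp
qed

text \<open>Conjugating the terms of negative frequency makes them analytic without changing their
  real parts; subtracting an imaginary constant then meets the hypothesis of
  \<open>integral_Im_poly_le\<close>.\<close>

lemma trig_poly_Re_analytic:
  assumes "t \<in> trig_polys"
  obtains Q where "Im (coeff Q 0) = 0" "\<And>z. z \<in> sphere 0 1 \<Longrightarrow> Re (poly Q z) = Re (t z)"
proof -
  obtain N P where t: "\<And>z. z \<in> sphere 0 1 \<Longrightarrow> t z = cnj z ^ N * poly P z"
    using assms unfolding trig_polys_def by blast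
  define Q0 where "Q0 = (\<Sum>i\<le>degree P. if N \<le> i then monom (coeff P i) (i - N) else monom (cnj (coeff P i)) (N - i))"
  have Q0: "Re (poly Q0 z) = Re (t z)" if z: "z \<in> sphere 0 1" for z
  proof -
    have "t z = (\<Sum>i\<le>degree P. cnj z ^ N * (coeff P i * z ^ i))"
      unfolding t[OF z] poly_altdef by (rule sum_distrib_left)
    then have "Re (t z) = (\<Sum>i\<le>degree P. Re (cnj z ^ N * (coeff P i * z ^ i)))" by simp
    also have "\<dots> = (\<Sum>i\<le>degree P. Re (poly (if N \<le> i then monom (coeff P i) (i - N) else monom (cnj (coeff P i)) (N - i)) z))"
    proof (rule sum.cong[OF refl])
      fix i
      show "Re (cnj z ^ N * (coeff P i * z ^ i)) = Re (poly (if N \<le> i then monom (coeff P i) (i - N) else monom (cnj (coeff P i)) (N - i)) z)"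
      proof (cases "N \<le> i")
        case True
        then obtain k where k: "i = N + k" using le_Suc_ex by blast
        have "cnj z ^ N * z ^ i = z ^ k"
          using cnj_power_cancel[OF z, of 0 N] by (simp add: k power_add flip: mult.assoc)
        then have e: "cnj z ^ N * (coeff P i * z ^ i) = coeff P i * z ^ k"
          by (simp only: mult.left_commute[of "cnj z ^ N"])
        show ?thesis using True unfolding e by (simp add: k poly_monom)
      next
        case False
        then obtain k where k: "N = i + k" using le_Suc_ex[of i N] by auto
        have "cnj z ^ N * z ^ i = cnj z ^ k"
          using cnj_power_cancel[OF z, of k i] by (simp add: k add.commute)
        then have "cnj z ^ N * (coeff P i * z ^ i) = cnj (cnj (coeff P i) * z ^ k)"
          by (simp add: mult.left_commute)
        then have "Re (cnj z ^ N * (coeff P i * z ^ i)) = Re (cnj (coeff P i) * z ^ k)"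
          by (simp only: cnj.sel)
        then show ?thesis using False k by (simp add: poly_monom)
      qed
    qed
    also have "\<dots> = Re (poly Q0 z)" by (simp add: Q0_def poly_sum)
    finally show ?thesis by simp
  qed
  show ?thesis
  proof (rule that[of "Q0 - [:\<i> * of_real (Im (coeff Q0 0)):]"])
    show "Re (poly (Q0 - [:\<i> * of_real (Im (coeff Q0 0)):]) z) = Re (t z)" if "z \<in> sphere 0 1" for z
      using Q0[OF that] by simp
  qed simp
qed

lemma Re_poly_approx:
  fixes u :: "complex \<Rightarrow> real"
  assumes u: "u \<in> circle_borel" "\<And>z. 0 \<le> u z" "\<And>z. u z \<le> real n" and e: "0 < e"
  obtains Q where "Im (coeff Q 0) = 0" "\<And>z. z \<in> sphere 0 1 \<Longrightarrow> Re (poly Q z) \<le> real n + 1"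
    "(LINT z|\<mu>. (Re (poly Q z) - u z)\<^sup>2) < e"
proof -
  \<comment> \<open>\<open>2 * real n + 1\<close> bounds the difference between \<open>u\<close> and
    the approximant, which converts an L1-error into a mean-square error.\<close>
  have "0 < e / (2 * real n + 1)" using e by simp
  moreover have "AE z in \<mu>. norm (complex_of_real (u z)) \<le> real n" using u(2,3) by simp
  ultimately obtain t where t: "t \<in> trig_polys" "\<And>z. z \<in> sphere 0 1 \<Longrightarrow> norm (t z) \<le> real n + 1"
    "(LINT z|\<mu>. norm (of_real (u z) - t z)) < e / (2 * real n + 1)"
    using trig_polys_dense_bounded[of "\<lambda>z. of_real (u z)" "real n" "e / (2 * real n + 1)"] u(1) by auto
  obtain Q where Q: "Im (coeff Q 0) = 0" "\<And>z. z \<in> sphere 0 1 \<Longrightarrow> Re (poly Q z) = Re (t z)"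
    using trig_poly_Re_analytic[OF t(1)] by blast
  have tL: "t \<in> Linfty" by (intro Linfty_continuous trig_polys_continuous t)
  have uL: "(\<lambda>z. complex_of_real (u z)) \<in> Linfty" using u by (intro LinftyI[of _ "real n"]) auto
  show ?thesis
  proof (rule that[OF Q(1)])
    show "Re (poly Q z) \<le> real n + 1" if "z \<in> sphere 0 1" for z
      using Q(2)[OF that] t(2)[OF that] complex_Re_le_cmod[of "t z"] by simp
    have i: "integrable \<mu> (\<lambda>z. norm (complex_of_real (u z) - t z) * (2 * real n + 1))"
      by (intro integrable_mult_left integrable_norm Linfty_integrable Linfty_diff uL tL)
    have le: "(Re (poly Q z) - u z)\<^sup>2 \<le> norm (complex_of_real (u z) - t z) * (2 * real n + 1)" if z: "z \<in> sphere 0 1" for z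
    proof -
      have a: "\<bar>Re (poly Q z) - u z\<bar> \<le> norm (complex_of_real (u z) - t z)"
        using abs_Re_le_cmod[of "complex_of_real (u z) - t z"] Q(2)[OF z] by simp
      have b: "\<bar>Re (poly Q z) - u z\<bar> \<le> 2 * real n + 1"
        using abs_Re_le_cmod[of "t z"] t(2)[OF z] u(2)[of z] u(3)[of z] unfolding Q(2)[OF z] by linarith
      have "(Re (poly Q z) - u z)\<^sup>2 = \<bar>Re (poly Q z) - u z\<bar> * \<bar>Re (poly Q z) - u z\<bar>"
        by (simp add: power2_eq_square)
      also have "\<dots> \<le> norm (complex_of_real (u z) - t z) * (2 * real n + 1)"
        using a b by (intro mult_mono) auto
      finally show ?thesis .
    qed
    have "(LINT z|\<mu>. (Re (poly Q z) - u z)\<^sup>2) \<le> (LINT z|\<mu>. norm (complex_of_real (u z) - t z) * (2 * real n + 1))"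
      using le by (intro integral_mono'[OF i]) auto
    also have "\<dots> = (LINT z|\<mu>. norm (complex_of_real (u z) - t z)) * (2 * real n + 1)" by simp
    also have "\<dots> < e" using t(3) by (simp add: pos_less_divide_eq)
    finally show "(LINT z|\<mu>. (Re (poly Q z) - u z)\<^sup>2) < e" .
  qed
qed

text \<open>A Taylor polynomial of the exponential, evaluated at \<open>Q\<close>, is again an
  analytic polynomial; \<open>Q\<close> is bounded on the circle, so the remainder is uniformly
  small.\<close>

lemma exp_poly_approx:
  fixes Q :: "complex poly"
  assumes e: "0 < e"
  obtains X where "\<And>z. z \<in> sphere 0 1 \<Longrightarrow> norm (poly X z - exp (poly Q z)) \<le> e"
proof -
  have "bounded (poly Q ` sphere 0 1)"
    by (intro compact_imp_bounded compact_continuous_image continuous_intros compact_sphere)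
  then obtain R where R: "0 < R" "\<And>z. z \<in> sphere 0 1 \<Longrightarrow> norm (poly Q z) \<le> R"
    unfolding bounded_pos by blast
  have "(\<lambda>n. exp R * R * (R ^ n / fact n)) \<longlonglongrightarrow> exp R * R * 0"
    by (intro tendsto_mult tendsto_const) (use summable_LIMSEQ_zero[OF summable_exp[of R]] in \<open>simp add: field_simps\<close>)
  then have "\<forall>\<^sub>F n in sequentially. exp R * R * (R ^ n / fact n) < e"
    using e by (intro order_tendstoD) auto
  then obtain n where n: "exp R * R * (R ^ n / fact n) < e" by (auto simp: eventually_sequentially)
  define X where "X = (\<Sum>i\<le>n. smult (1 / fact i) (Q ^ i))"
  show ?thesis
  proof (rule that[of X])
    fix z :: complex assume z: "z \<in> sphere 0 1"
    let ?w = "poly Q z"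
    have "poly X z = (\<Sum>i\<le>n. ?w ^ i / fact i)" by (simp add: X_def poly_sum poly_power)
    then have "norm (poly X z - exp ?w) \<le> exp \<bar>Re ?w\<bar> * norm ?w ^ Suc n / fact n"
      using Taylor_exp[of ?w n] by (simp add: norm_minus_commute)
    also have "\<dots> \<le> exp R * R ^ Suc n / fact n"
      using R(1) R(2)[OF z] abs_Re_le_cmod[of ?w]
      by (intro divide_right_mono mult_mono power_mono) auto
    also have "\<dots> \<le> e" using n by (simp add: mult_ac)
    finally show "norm (poly X z - exp ?w) \<le> e" .
  qed
qed

lemma AE_summable_of_integral_le:
  fixes f :: "nat \<Rightarrow> 'a \<Rightarrow> real"
  assumes f: "\<And>j. integrable M (f j)" "\<And>j x. 0 \<le> f j x"
    and le: "\<And>j. (LINT x|M. f j x) \<le> c * (1/2) ^ j"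
  shows "AE x in M. summable (\<lambda>j. f j x)"
proof -
  have c0: "0 \<le> c * (1/2) ^ j" for j
    by (rule order_trans[OF Bochner_Integration.integral_nonneg le]) (rule f(2))
  have fm [measurable]: "f j \<in> borel_measurable M" for j using f(1) by simp
  have "(\<integral>\<^sup>+x. (\<Sum>j. ennreal (f j x)) \<partial>M) = (\<Sum>j. \<integral>\<^sup>+x. ennreal (f j x) \<partial>M)"
    by (rule nn_integral_suminf) measurable
  also have "\<dots> = (\<Sum>j. ennreal (LINT x|M. f j x))"
    using f by (intro suminf_cong nn_integral_eq_integral) auto
  also have "\<dots> \<le> (\<Sum>j. ennreal (c * (1/2) ^ j))"
    using le by (intro suminf_le ennreal_leI) auto
  also have "\<dots> = ennreal (c * 2)"
  proof (rule suminf_ennreal_eq[OF c0])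
    have "(\<lambda>j. (1/2::real) ^ j) sums 2" using geometric_sums[of "1/2::real"] by simp
    then show "(\<lambda>j. c * (1/2) ^ j) sums (c * 2)" by (rule sums_mult)
  qed
  also have "\<dots> < \<infinity>" by simp
  finally have "AE x in M. (\<Sum>j. ennreal (f j x)) \<noteq> \<infinity>" by (intro nn_integral_PInf_AE) auto
  then show ?thesis
    by eventually_elim (rule summable_suminf_not_top, use f(2) in auto)
qed

text \<open>The weight turns mean squares of order \<open>(1/4)^j\<close> into L1-norms of order
  \<open>(1/2)^j\<close>, which are summable.\<close>

lemma abs_le_scaled_square:
  fixes a :: real shows "\<bar>a\<bar> \<le> (2 ^ j * a\<^sup>2 + (1/2) ^ j) / 2"
proof -
  have "0 \<le> 2 ^ j * (\<bar>a\<bar> - (1/2) ^ j)\<^sup>2" by simp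
  also have "\<dots> = 2 ^ j * a\<^sup>2 - 2 * \<bar>a\<bar> * (2 ^ j * (1/2) ^ j) + (2 ^ j * (1/2) ^ j) * (1/2) ^ j"
    by (simp only: power2_diff power2_abs) (simp add: power2_eq_square algebra_simps)
  also have "2 ^ j * (1/2) ^ j = (1::real)" by (simp flip: power_mult_distrib)
  finally show ?thesis by simp
qed

context rotational_seminorm
begin

text \<open>The outer function \<open>h\<close> with \<open>|h| = F\<close> is \<open>exp\<close> of the \<open>L\<^sup>2\<close>-limit \<open>q\<close> of analytic polynomials \<open>Q\<^sub>j\<close>
  whose real parts tend to \<open>ln F\<close>; the imaginary parts converge because \<open>\<integral> (Im Q)\<^sup>2 \<le> \<integral> (Re Q)\<^sup>2\<close> when
  \<open>Q 0\<close> is real. The real part of \<open>Q\<^sub>j\<close> exceeds \<open>ln F + 1\<close> only on a set \<open>A\<^sub>j\<close> on which \<open>|exp Q\<^sub>j|\<close> has seminorm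
  at most \<open>2\<^sup>-\<^sup>j\<close>, so the \<open>exp Q\<^sub>j\<close> have a common majorant.\<close>

lemma outer_approx_step:
  fixes u :: "complex \<Rightarrow> real"
  assumes u: "u \<in> circle_borel" "\<And>z. 0 \<le> u z" and u2: "integrable \<mu> (\<lambda>z. (u z)\<^sup>2)"
  obtains n :: nat and Q X where "Im (coeff Q 0) = 0"
    "\<And>z. z \<in> sphere 0 1 \<Longrightarrow> Re (poly Q z) \<le> real n + 1"
    "(LINT z|\<mu>. (Re (poly Q z) - u z)\<^sup>2) \<le> 4 * (1/4) ^ j"
    "exp (real n + 1) * \<alpha> (indicator {z\<in>space \<mu>. u z + 1 < Re (poly Q z)}) \<le> (1/2) ^ j"
    "\<And>z. z \<in> sphere 0 1 \<Longrightarrow> norm (poly X z - exp (poly Q z)) \<le> (1/2) ^ j"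
proof -
  note [measurable] = u(1)
  have "(\<lambda>n. LINT z|\<mu>. (u z - min (u z) (real n))\<^sup>2) \<longlonglongrightarrow> (LINT z|\<mu>. 0)"
  proof (rule integral_dominated_convergence[OF _ _ u2])
    show "AE z in \<mu>. (\<lambda>n. (u z - min (u z) (real n))\<^sup>2) \<longlonglongrightarrow> 0"
    proof (rule AE_I2, rule tendsto_eventually)
      fix z
      show "\<forall>\<^sub>F n in sequentially. (u z - min (u z) (real n))\<^sup>2 = 0"
        using eventually_ge_at_top[of "nat \<lceil>u z\<rceil>"]
        by eventually_elim (auto simp: min_def nat_le_iff ceiling_le_iff)
    qed
    show "AE z in \<mu>. norm ((u z - min (u z) (real n))\<^sup>2) \<le> (u z)\<^sup>2" for n
      using u(2) by (intro AE_I2) (auto simp: min_def intro!: power_mono)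
  qed measurable
  then have "\<forall>\<^sub>F n in sequentially. (LINT z|\<mu>. (u z - min (u z) (real n))\<^sup>2) < (1/4) ^ j"
    by (intro order_tendstoD) auto
  then obtain n where n: "(LINT z|\<mu>. (u z - min (u z) (real n))\<^sup>2) < (1/4) ^ j"
    by (auto simp: eventually_sequentially)
  define v where "v z = min (u z) (real n)" for z
  have vm [measurable]: "v \<in> circle_borel" unfolding v_def by measurable
  \<comment> \<open>The height \<open>n\<close> is fixed first and the threshold \<open>d\<close>
    depends on it, so that a set of measure below \<open>d\<close> stays negligible after
    multiplication by \<open>exp (real n + 1)\<close>.\<close>
  have "0 < (1/2) ^ j / exp (real n + 1)" by simp
  then obtain d where d: "0 < d" "\<And>E. E \<in> sets \<mu> \<Longrightarrow> measure \<mu> E < d \<Longrightarrow> \<alpha> (indicator E) < (1/2) ^ j / exp (real n + 1)"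
    using alpha_indicator_small by blast
  have v: "0 \<le> v z" "v z \<le> real n" for z using u(2)[of z] by (auto simp: v_def)
  have "0 < min d ((1/4) ^ j)" using d(1) by simp
  then obtain Q where Q: "Im (coeff Q 0) = 0" "\<And>z. z \<in> sphere 0 1 \<Longrightarrow> Re (poly Q z) \<le> real n + 1"
    "(LINT z|\<mu>. (Re (poly Q z) - v z)\<^sup>2) < min d ((1/4) ^ j)"
    using Re_poly_approx[OF vm v] by blast
  have Qm [measurable]: "(\<lambda>z. Re (poly Q z)) \<in> circle_borel"
    by (intro circle_borel_continuous continuous_intros)
  have RQv: "integrable \<mu> (\<lambda>z. (Re (poly Q z) - v z)\<^sup>2)"
  proof -
    obtain C where C: "\<And>z. z \<in> sphere 0 1 \<Longrightarrow> norm (poly Q z) \<le> C"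
    proof -
      have "bounded (poly Q ` sphere 0 1)"
        by (intro compact_imp_bounded compact_continuous_image continuous_intros compact_sphere)
      then obtain C where "\<forall>w\<in>poly Q ` sphere 0 1. norm w \<le> C" unfolding bounded_iff by blast
      then show ?thesis using that by blast
    qed
    show ?thesis
    proof (rule integrable_bounded_circle)
      show "AE z in \<mu>. norm ((Re (poly Q z) - v z)\<^sup>2) \<le> (C + real n)\<^sup>2"
        using AE_circle
      proof eventually_elim
        case (elim z)
        have "\<bar>Re (poly Q z) - v z\<bar> \<le> C + real n"
          using abs_Re_le_cmod[of "poly Q z"] C[OF elim] u(2)[of z] by (auto simp: v_def)
        then have "\<bar>Re (poly Q z) - v z\<bar>\<^sup>2 \<le> (C + real n)\<^sup>2" by (rule power_mono) simp
        then show ?case by simp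
      qed
    qed measurable
  qed
  have uv: "integrable \<mu> (\<lambda>z. (u z - v z)\<^sup>2)"
    by (rule Bochner_Integration.integrable_bound[OF u2]) (use u(2) in \<open>auto simp: v_def min_def intro!: power_mono\<close>)
  let ?A = "{z\<in>space \<mu>. u z + 1 < Re (poly Q z)}"
  let ?B = "{z\<in>space \<mu>. 1 \<le> (Re (poly Q z) - v z)\<^sup>2}"
  have A: "?A \<in> sets \<mu>" and B: "?B \<in> sets \<mu>" by measurable
  \<comment> \<open>On \<open>?A\<close> the real part exceeds \<open>v\<close> by at least 1,
    because \<open>v \<le> u\<close>; Markov's inequality for the square then bounds the
    measure.\<close>
  have "?A \<subseteq> ?B"
  proof
    fix z assume z: "z \<in> ?A"
    then have "1 \<le> Re (poly Q z) - v z" by (simp add: v_def min_def)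
    then have "1\<^sup>2 \<le> (Re (poly Q z) - v z)\<^sup>2" by (rule power_mono) simp
    then show "z \<in> ?B" using z by simp
  qed
  then have "measure \<mu> ?A \<le> measure \<mu> ?B" using B by (rule circle.finite_measure_mono)
  also have "\<dots> \<le> (LINT z|\<mu>. (Re (poly Q z) - v z)\<^sup>2) / 1"
    by (rule integral_Markov_inequality_measure[OF RQv, where A="{}"]) auto
  also have "\<dots> < d" using Q(3) by simp
  finally have aA: "\<alpha> (indicator ?A) < (1/2) ^ j / exp (real n + 1)" by (rule d(2)[OF A])
  have "0 < (1/2::real) ^ j" by simp
  then obtain X where X: "\<And>z. z \<in> sphere 0 1 \<Longrightarrow> norm (poly X z - exp (poly Q z)) \<le> (1/2) ^ j"
    using exp_poly_approx[of "(1/2) ^ j" Q] by blast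
  show ?thesis
  proof (rule that[OF Q(1,2) _ _ X])
    have "(LINT z|\<mu>. (Re (poly Q z) - u z)\<^sup>2) \<le> (LINT z|\<mu>. 2 * (Re (poly Q z) - v z)\<^sup>2 + 2 * (u z - v z)\<^sup>2)"
    proof (rule integral_mono')
      show "integrable \<mu> (\<lambda>z. 2 * (Re (poly Q z) - v z)\<^sup>2 + 2 * (u z - v z)\<^sup>2)"
        using RQv uv by simp
      fix z
      have "0 \<le> ((Re (poly Q z) - v z) + (u z - v z))\<^sup>2" by simp
      then show "(Re (poly Q z) - u z)\<^sup>2 \<le> 2 * (Re (poly Q z) - v z)\<^sup>2 + 2 * (u z - v z)\<^sup>2"
        by (simp add: power2_eq_square algebra_simps)
    qed simp
    also have "\<dots> = 2 * (LINT z|\<mu>. (Re (poly Q z) - v z)\<^sup>2) + 2 * (LINT z|\<mu>. (u z - v z)\<^sup>2)"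
      using RQv uv by simp
    also have "\<dots> \<le> 4 * (1/4) ^ j" using Q(3) n by (simp add: v_def)
    finally show "(LINT z|\<mu>. (Re (poly Q z) - u z)\<^sup>2) \<le> 4 * (1/4) ^ j" .
    show "exp (real n + 1) * \<alpha> (indicator ?A) \<le> (1/2) ^ j"
      using aA by (simp add: pos_less_divide_eq mult.commute)
  qed
qed


lemma outer_function:
  fixes F :: "complex \<Rightarrow> real"
  assumes F: "F \<in> circle_borel" "\<And>z. 1 \<le> F z" and FcL: "(\<lambda>z. of_real (F z)) \<in> cL_space \<alpha>"
  obtains X :: "nat \<Rightarrow> complex poly" and D h where "D \<in> cL_space \<alpha>" "h \<in> circle_borel"
    "\<And>j. AE z in \<mu>. norm (poly (X j) z) \<le> norm (D z)"
    "AE z in \<mu>. (\<lambda>j. poly (X j) z) \<longlonglongrightarrow> h z"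
    "AE z in \<mu>. norm (h z) = F z"
proof -
  note [measurable] = F(1)
  define u where "u z = ln (F z)" for z
  have um [measurable]: "u \<in> circle_borel" unfolding u_def by measurable
  have u0: "0 \<le> u z" for z using F(2)[of z] by (simp add: u_def)
  have eu: "exp (u z) = F z" for z using F(2)[of z] by (simp add: u_def)
  \<comment> \<open>From ln x <= x - 1 at the square root of \<open>F z\<close>; thus integrability
    of \<open>F\<close> gives square integrability of \<open>u\<close>.\<close>
  have uF: "(u z)\<^sup>2 \<le> 4 * F z" for z
  proof -
    have "0 < sqrt (F z)" using F(2)[of z] by (simp add: less_le_trans[OF zero_less_one])
    then have "ln (sqrt (F z)) \<le> sqrt (F z) - 1" by (rule ln_le_minus_one)
    moreover have "ln (sqrt (F z)) = u z / 2" using F(2)[of z] by (simp add: u_def ln_sqrt)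
    ultimately have "u z \<le> 2 * sqrt (F z)" by simp
    then have "(u z)\<^sup>2 \<le> (2 * sqrt (F z))\<^sup>2" using u0 by (rule power_mono)
    then show ?thesis using F(2)[of z] by (simp add: power_mult_distrib)
  qed
  have "integrable \<mu> (\<lambda>z. norm (complex_of_real (F z)))"
    by (rule integrable_norm[OF cL_integrable[OF FcL]])
  then have iF: "integrable \<mu> (\<lambda>z. 4 * \<bar>F z\<bar>)" by simp
  have u2: "integrable \<mu> (\<lambda>z. (u z)\<^sup>2)"
  proof (rule Bochner_Integration.integrable_bound[OF iF])
    show "AE z in \<mu>. norm ((u z)\<^sup>2) \<le> norm (4 * \<bar>F z\<bar>)"
    proof (rule AE_I2)
      fix z show "norm ((u z)\<^sup>2) \<le> norm (4 * \<bar>F z\<bar>)" using uF[of z] F(2)[of z] by simp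
    qed
  qed measurable
  have "\<forall>j. \<exists>n Q X. Im (coeff Q 0) = 0 \<and> (\<forall>z\<in>sphere 0 1. Re (poly Q z) \<le> real n + 1) \<and>
    (LINT z|\<mu>. (Re (poly Q z) - u z)\<^sup>2) \<le> 4 * (1/4) ^ j \<and>
    exp (real n + 1) * \<alpha> (indicator {z\<in>space \<mu>. u z + 1 < Re (poly Q z)}) \<le> (1/2) ^ j \<and>
    (\<forall>z\<in>sphere 0 1. norm (poly X z - exp (poly Q z)) \<le> (1/2) ^ j)"
  proof
    fix j
    show "\<exists>n Q X. Im (coeff Q 0) = 0 \<and> (\<forall>z\<in>sphere 0 1. Re (poly Q z) \<le> real n + 1) \<and>
      (LINT z|\<mu>. (Re (poly Q z) - u z)\<^sup>2) \<le> 4 * (1/4) ^ j \<and>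
      exp (real n + 1) * \<alpha> (indicator {z\<in>space \<mu>. u z + 1 < Re (poly Q z)}) \<le> (1/2) ^ j \<and>
      (\<forall>z\<in>sphere 0 1. norm (poly X z - exp (poly Q z)) \<le> (1/2) ^ j)"
      by (rule outer_approx_step[OF um u0 u2, of j]) blast
  qed
  then obtain n Q X where Q0: "\<And>j. Im (coeff (Q j) 0) = 0"
    and Qn: "\<And>j z. z \<in> sphere 0 1 \<Longrightarrow> Re (poly (Q j) z) \<le> real (n j) + 1"
    and Qu: "\<And>j. (LINT z|\<mu>. (Re (poly (Q j) z) - u z)\<^sup>2) \<le> 4 * (1/4) ^ j"
    and QA: "\<And>j. exp (real (n j) + 1) * \<alpha> (indicator {z\<in>space \<mu>. u z + 1 < Re (poly (Q j) z)}) \<le> (1/2) ^ j"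
    and XQ: "\<And>j z. z \<in> sphere 0 1 \<Longrightarrow> norm (poly (X j) z - exp (poly (Q j) z)) \<le> (1/2) ^ j"
    unfolding choice_iff by blast
  have Qm [measurable]: "poly P \<in> circle_borel" for P :: "complex poly" by (rule Linfty_borel[OF poly_Linfty])
  have Rm [measurable]: "(\<lambda>z. Re (poly P z)) \<in> circle_borel" for P by measurable
  have Pi: "integrable \<mu> (\<lambda>z. (Re (poly P z))\<^sup>2)" "integrable \<mu> (\<lambda>z. (Im (poly P z))\<^sup>2)" for P
  proof -
    have i: "integrable \<mu> (\<lambda>z. (norm (poly P z))\<^sup>2)"
      using integrable_norm[OF Linfty_integrable[OF Linfty_mult[OF poly_Linfty poly_Linfty]], of P P]
      by (simp add: norm_mult power2_eq_square)
    show "integrable \<mu> (\<lambda>z. (Re (poly P z))\<^sup>2)"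
      by (rule Bochner_Integration.integrable_bound[OF i]) (auto simp: cmod_power2)
    show "integrable \<mu> (\<lambda>z. (Im (poly P z))\<^sup>2)"
      by (rule Bochner_Integration.integrable_bound[OF i]) (auto simp: cmod_power2)
  qed
  have iQu: "integrable \<mu> (\<lambda>z. (Re (poly P z) - u z)\<^sup>2)" for P
  proof (rule Bochner_Integration.integrable_bound[where f="\<lambda>z. 2 * (Re (poly P z))\<^sup>2 + 2 * (u z)\<^sup>2"])
    show "integrable \<mu> (\<lambda>z. 2 * (Re (poly P z))\<^sup>2 + 2 * (u z)\<^sup>2)" using Pi u2 by simp
    show "AE z in \<mu>. norm ((Re (poly P z) - u z)\<^sup>2) \<le> norm (2 * (Re (poly P z))\<^sup>2 + 2 * (u z)\<^sup>2)"
    proof (rule AE_I2)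
      fix z
      have "0 \<le> (Re (poly P z) + u z)\<^sup>2" by simp
      then have "(Re (poly P z) - u z)\<^sup>2 \<le> 2 * (Re (poly P z))\<^sup>2 + 2 * (u z)\<^sup>2"
        by (simp add: power2_eq_square algebra_simps)
      then show "norm ((Re (poly P z) - u z)\<^sup>2) \<le> norm (2 * (Re (poly P z))\<^sup>2 + 2 * (u z)\<^sup>2)" by simp
    qed
  qed measurable
  have pw: "2 ^ j * (1/4) ^ j = ((1/2) ^ j :: real)" for j
    by (simp flip: power_mult_distrib)
  have conv_Re: "AE z in \<mu>. summable (\<lambda>j. \<bar>Re (poly (Q j) z) - u z\<bar>)"
  \<comment> \<open>The constant is (4 + 1) / 2: the mean-square bound \<open>4 * (1/4)^j\<close>
    enters \<open>abs_le_scaled_square\<close>.\<close>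
  proof (rule AE_summable_of_integral_le[where c="5/2"])
    fix j
    show i: "integrable \<mu> (\<lambda>z. \<bar>Re (poly (Q j) z) - u z\<bar>)"
    proof (rule Bochner_Integration.integrable_bound[where f="\<lambda>z. (2 ^ j * (Re (poly (Q j) z) - u z)\<^sup>2 + (1/2) ^ j) / 2"])
      show "integrable \<mu> (\<lambda>z. (2 ^ j * (Re (poly (Q j) z) - u z)\<^sup>2 + (1/2) ^ j) / 2)" using iQu by simp
      show "AE z in \<mu>. norm \<bar>Re (poly (Q j) z) - u z\<bar> \<le> norm ((2 ^ j * (Re (poly (Q j) z) - u z)\<^sup>2 + (1/2) ^ j) / 2)"
      proof (rule AE_I2)
        fix z show "norm \<bar>Re (poly (Q j) z) - u z\<bar> \<le> norm ((2 ^ j * (Re (poly (Q j) z) - u z)\<^sup>2 + (1/2) ^ j) / 2)"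
          using abs_le_scaled_square[of "Re (poly (Q j) z) - u z" j] by simp
      qed
    qed measurable
    have "(LINT z|\<mu>. \<bar>Re (poly (Q j) z) - u z\<bar>) \<le> (LINT z|\<mu>. (2 ^ j * (Re (poly (Q j) z) - u z)\<^sup>2 + (1/2) ^ j) / 2)"
      using iQu by (intro integral_mono i abs_le_scaled_square) simp
    also have "\<dots> = (2 ^ j * (LINT z|\<mu>. (Re (poly (Q j) z) - u z)\<^sup>2) + (1/2) ^ j) / 2"
      using iQu by simp
    also have "\<dots> \<le> (2 ^ j * (4 * (1/4) ^ j) + (1/2) ^ j) / 2"
      by (intro divide_right_mono add_right_mono mult_left_mono Qu) auto
    also have "\<dots> = 5/2 * (1/2) ^ j" using pw[of j] by simp
    finally show "(LINT z|\<mu>. \<bar>Re (poly (Q j) z) - u z\<bar>) \<le> 5/2 * (1/2) ^ j" .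
  qed simp
  have conv_Q: "AE z in \<mu>. summable (\<lambda>j. norm (poly (Q (Suc j)) z - poly (Q j) z))"
  \<comment> \<open>Consecutive real parts differ in mean square by at most 2 + 8 = 10 times
    \<open>(1/4)^j\<close>, and so do the imaginary parts; the two scaled squares contribute (10 +
    1) / 2 each.\<close>
  proof (rule AE_summable_of_integral_le[where c=11])
    fix j
    let ?P = "Q (Suc j) - Q j"
    show i: "integrable \<mu> (\<lambda>z. norm (poly (Q (Suc j)) z - poly (Q j) z))"
      by (intro integrable_norm Linfty_integrable Linfty_diff poly_Linfty)
    have R: "(LINT z|\<mu>. (Re (poly ?P z))\<^sup>2) \<le> 10 * (1/4) ^ j"
    proof -
      have "(LINT z|\<mu>. (Re (poly ?P z))\<^sup>2)
          \<le> (LINT z|\<mu>. 2 * (Re (poly (Q (Suc j)) z) - u z)\<^sup>2 + 2 * (Re (poly (Q j) z) - u z)\<^sup>2)"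
      proof (rule integral_mono[OF Pi(1)])
        show "integrable \<mu> (\<lambda>z. 2 * (Re (poly (Q (Suc j)) z) - u z)\<^sup>2 + 2 * (Re (poly (Q j) z) - u z)\<^sup>2)"
          using iQu by simp
        fix z
        have "0 \<le> ((Re (poly (Q (Suc j)) z) - u z) + (Re (poly (Q j) z) - u z))\<^sup>2" by simp
        then show "(Re (poly ?P z))\<^sup>2 \<le> 2 * (Re (poly (Q (Suc j)) z) - u z)\<^sup>2 + 2 * (Re (poly (Q j) z) - u z)\<^sup>2"
          by (simp add: power2_eq_square algebra_simps)
      qed
      also have "\<dots> = 2 * (LINT z|\<mu>. (Re (poly (Q (Suc j)) z) - u z)\<^sup>2) + 2 * (LINT z|\<mu>. (Re (poly (Q j) z) - u z)\<^sup>2)"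
        using iQu by simp
      also have "\<dots> \<le> 2 * (4 * (1/4) ^ Suc j) + 2 * (4 * (1/4) ^ j)"
        by (intro add_mono mult_left_mono Qu) auto
      finally show ?thesis by simp
    qed
    have I: "(LINT z|\<mu>. (Im (poly ?P z))\<^sup>2) \<le> 10 * (1/4) ^ j"
      using integral_Im_poly_le[of ?P] Q0 R by simp
    have "(LINT z|\<mu>. norm (poly (Q (Suc j)) z - poly (Q j) z))
        \<le> (LINT z|\<mu>. (2 ^ j * (Re (poly ?P z))\<^sup>2 + (1/2) ^ j) / 2 + (2 ^ j * (Im (poly ?P z))\<^sup>2 + (1/2) ^ j) / 2)"
    proof (rule integral_mono[OF i])
      show "integrable \<mu> (\<lambda>z. (2 ^ j * (Re (poly ?P z))\<^sup>2 + (1/2) ^ j) / 2 + (2 ^ j * (Im (poly ?P z))\<^sup>2 + (1/2) ^ j) / 2)"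
        using Pi[of ?P] by simp
      fix z
      have "norm (poly ?P z) \<le> \<bar>Re (poly ?P z)\<bar> + \<bar>Im (poly ?P z)\<bar>" by (rule cmod_le)
      also have "\<dots> \<le> (2 ^ j * (Re (poly ?P z))\<^sup>2 + (1/2) ^ j) / 2 + (2 ^ j * (Im (poly ?P z))\<^sup>2 + (1/2) ^ j) / 2"
        by (intro add_mono abs_le_scaled_square)
      finally show "norm (poly (Q (Suc j)) z - poly (Q j) z)
          \<le> (2 ^ j * (Re (poly ?P z))\<^sup>2 + (1/2) ^ j) / 2 + (2 ^ j * (Im (poly ?P z))\<^sup>2 + (1/2) ^ j) / 2" by simp
    qed
    also have "\<dots> = (2 ^ j * (LINT z|\<mu>. (Re (poly ?P z))\<^sup>2) + (1/2) ^ j) / 2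
        + (2 ^ j * (LINT z|\<mu>. (Im (poly ?P z))\<^sup>2) + (1/2) ^ j) / 2"
      using Pi[of ?P] by simp
    also have "\<dots> \<le> (2 ^ j * (10 * (1/4) ^ j) + (1/2) ^ j) / 2 + (2 ^ j * (10 * (1/4) ^ j) + (1/2) ^ j) / 2"
      by (intro add_mono divide_right_mono mult_left_mono R I order_refl) auto
    also have "\<dots> = 11 * (1/2) ^ j" using pw[of j] by simp
    finally show "(LINT z|\<mu>. norm (poly (Q (Suc j)) z - poly (Q j) z)) \<le> 11 * (1/2) ^ j" .
  qed simp
  define q where "q z = lim (\<lambda>j. poly (Q j) z)" for z
  have qm [measurable]: "q \<in> circle_borel"
    unfolding q_def by (rule borel_measurable_lim_metric) (rule Qm)
  have Qq: "AE z in \<mu>. (\<lambda>j. poly (Q j) z) \<longlonglongrightarrow> q z"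
    using conv_Q
  proof eventually_elim
    case (elim z)
    then have "summable (\<lambda>j. poly (Q (Suc j)) z - poly (Q j) z)" by (rule summable_norm_cancel)
    then have "convergent (\<lambda>j. \<Sum>i<j. poly (Q (Suc i)) z - poly (Q i) z)" by (simp add: summable_iff_convergent)
    then have "convergent (\<lambda>j. poly (Q j) z - poly (Q 0) z)" by (simp only: sum_lessThan_telescope[of "\<lambda>j. poly (Q j) z"])
    then obtain l where "(\<lambda>j. poly (Q j) z - poly (Q 0) z) \<longlonglongrightarrow> l" by (auto simp: convergent_def)
    from tendsto_add[OF this tendsto_const[of "poly (Q 0) z"]]
    have "(\<lambda>j. poly (Q j) z) \<longlonglongrightarrow> l + poly (Q 0) z" by simp
    then have "convergent (\<lambda>j. poly (Q j) z)" by (auto simp: convergent_def)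
    then show ?case by (simp add: q_def convergent_LIMSEQ_iff)
  qed
  have Req: "AE z in \<mu>. Re (q z) = u z"
    using Qq conv_Re
  proof eventually_elim
    case (elim z)
    have "(\<lambda>j. Re (poly (Q j) z) - u z) \<longlonglongrightarrow> 0"
      using summable_LIMSEQ_zero[OF elim(2)] by (rule tendsto_rabs_zero_cancel)
    then have "(\<lambda>j. Re (poly (Q j) z)) \<longlonglongrightarrow> u z" by (rule LIM_zero_cancel)
    moreover have "(\<lambda>j. Re (poly (Q j) z)) \<longlonglongrightarrow> Re (q z)" using elim(1) by (rule tendsto_Re)
    ultimately show ?case by (rule LIMSEQ_unique[rotated])
  qed
  define h where "h z = exp (q z)" for z
  have hm: "h \<in> circle_borel"
    unfolding h_def by (rule measurable_compose[OF qm borel_measurable_continuous_onI[OF continuous_on_exp[OF continuous_on_id]]])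
  have Xh: "AE z in \<mu>. (\<lambda>j. poly (X j) z) \<longlonglongrightarrow> h z"
    using Qq AE_circle
  proof eventually_elim
    case (elim z)
    have "(\<lambda>j. (1/2::real) ^ j) \<longlonglongrightarrow> 0" by (rule LIMSEQ_power_zero) simp
    then have "(\<lambda>j. poly (X j) z - exp (poly (Q j) z)) \<longlonglongrightarrow> 0"
      by (rule Lim_null_comparison[OF always_eventually[OF allI[OF XQ[OF elim(2)]]]])
    from tendsto_add[OF this tendsto_exp[OF elim(1)]] show ?case by (simp add: h_def)
  qed
  have hF: "AE z in \<mu>. norm (h z) = F z"
    using Req by eventually_elim (simp add: h_def eu)
  define A where "A j = {z\<in>space \<mu>. u z + 1 < Re (poly (Q j) z)}" for j
  have AM [measurable]: "A j \<in> sets \<mu>" for j unfolding A_def by measurable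
  \<comment> \<open>On the exceptional set \<open>A j\<close> this majorizes the modulus of
    \<open>exp (poly (Q j) z)\<close>, and its seminorms are summable.\<close>
  define b where "b j z = exp (real (n j) + 1) * indicator (A j) z" for j and z :: complex
  have b0: "0 \<le> b j z" for j z by (simp add: b_def)
  have bm [measurable]: "b j \<in> circle_borel" for j unfolding b_def by measurable
  have bL: "(\<lambda>z. complex_of_real (b j z)) \<in> Linfty" for j
    by (rule LinftyI[of _ "exp (real (n j) + 1)"]) (auto simp: b_def indicator_def)
  have ab: "\<alpha> (\<lambda>z. complex_of_real (b j z)) \<le> (1/2) ^ j" for j
  proof -
    have "(\<lambda>z. complex_of_real (b j z)) = (\<lambda>z. of_real (exp (real (n j) + 1)) * indicator (A j) z)"
      by (rule ext) (simp add: b_def indicator_def)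
    then show ?thesis
      using QA[of j] alpha_cmult[OF Linfty_indicator[OF AM], of "of_real (exp (real (n j) + 1))" j] by (simp add: A_def)
  qed
  have sb: "AE z in \<mu>. summable (\<lambda>j. b j z)"
  proof (rule AE_summable_of_integral_le[where c=1])
    fix j
    have "integrable \<mu> (\<lambda>z. norm (complex_of_real (b j z)))"
      by (rule integrable_norm[OF Linfty_integrable[OF bL]])
    then show "integrable \<mu> (b j)" using b0 by simp
    show "(LINT z|\<mu>. b j z) \<le> 1 * (1/2) ^ j"
      using alpha_ge_L1[OF bL, of j] ab[of j] b0 by simp
  qed (rule b0)
  define G where "G z = (\<Sum>j. b j z)" for z
  have Gm [measurable]: "G \<in> circle_borel" unfolding G_def by measurable
  have GcL: "(\<lambda>z. complex_of_real (G z)) \<in> cL_space \<alpha>"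
  proof (rule cL_spaceI)
    \<comment> \<open>Fatou puts the sum of the majorants into the large space; 2 is the sum of the
      bounds \<open>(1/2)^j\<close>.\<close>
    have "p (\<lambda>z. complex_of_real (G z)) \<le> ennreal 2"
    proof (rule p_Fatou[where u="\<lambda>m z. \<Sum>j<m. complex_of_real (b j z)"])
      fix m
      have S: "(\<lambda>z. \<Sum>j<m. complex_of_real (b j z)) \<in> Linfty"
        "\<alpha> (\<lambda>z. \<Sum>j<m. complex_of_real (b j z)) \<le> (\<Sum>j<m. \<alpha> (\<lambda>z. complex_of_real (b j z)))"
        using alpha_sum[of "{..<m}" "\<lambda>j z. complex_of_real (b j z)"] bL by auto
      show "(\<lambda>z. \<Sum>j<m. complex_of_real (b j z)) \<in> circle_borel" by (rule Linfty_borel[OF S(1)])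
      note S(2)
      also have "(\<Sum>j<m. \<alpha> (\<lambda>z. complex_of_real (b j z))) \<le> (\<Sum>j<m. (1/2) ^ j)" by (intro sum_mono ab)
      also have "\<dots> \<le> 2" by (subst geometric_sum) auto
      finally show "p (\<lambda>z. \<Sum>j<m. complex_of_real (b j z)) \<le> ennreal 2"
        unfolding p_Linfty[OF S(1)] by (rule ennreal_leI)
      show "AE z in \<mu>. (\<lambda>m. \<Sum>j<m. complex_of_real (b j z)) \<longlonglongrightarrow> complex_of_real (G z)"
        using sb
      proof eventually_elim
        case (elim z)
        then have "(\<lambda>m. \<Sum>j<m. b j z) \<longlonglongrightarrow> G z" unfolding G_def by (rule summable_LIMSEQ)
        then have "(\<lambda>m. complex_of_real (\<Sum>j<m. b j z)) \<longlonglongrightarrow> complex_of_real (G z)" by (rule tendsto_of_real)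
        then show ?case by simp
      qed
    qed
    also have "\<dots> < \<infinity>" by simp
    finally show "p (\<lambda>z. complex_of_real (G z)) < \<infinity>" .
  qed measurable
  \<comment> \<open>\<open>exp 1 * F z\<close> covers the points off \<open>A j\<close>, where the
    real part is at most \<open>u z + 1\<close>; \<open>G\<close> covers the points of
    \<open>A j\<close>, and 1 covers the error \<open>(1/2)^j\<close> of the Taylor
    polynomials.\<close>
  define D where "D z = of_real (exp 1) * complex_of_real (F z) + (complex_of_real (G z) + 1)" for z
  have "D \<in> cL_space \<alpha>"
    unfolding D_def by (intro cL_add cL_cmult FcL GcL Linfty_cL Linfty_const)
  moreover have "AE z in \<mu>. norm (poly (X j) z) \<le> norm (D z)" for j
    using sb AE_space
  proof eventually_elim
    case (elim z)
    then have z: "z \<in> sphere 0 1" by simp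
    have bG: "b j z \<le> G z" unfolding G_def
      using sum_le_suminf[OF elim(1), of "{j}"] b0 by simp
    have "norm (poly (X j) z) \<le> norm (exp (poly (Q j) z)) + (1/2) ^ j"
      using norm_triangle_sub[of "poly (X j) z" "exp (poly (Q j) z)"] XQ[OF z, of j] by linarith
    also have "norm (exp (poly (Q j) z)) = exp (Re (poly (Q j) z))" by simp
    also have "exp (Re (poly (Q j) z)) \<le> exp 1 * F z + b j z"
    proof (cases "z \<in> A j")
      case True
      then have "exp (Re (poly (Q j) z)) \<le> b j z" using Qn[OF z, of j] by (simp add: b_def)
      then show ?thesis using F(2)[of z] by (smt (verit) exp_gt_zero mult_nonneg_nonneg)
    next
      case False
      then have "Re (poly (Q j) z) \<le> u z + 1" using elim(2) by (auto simp: A_def)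
      then have "exp (Re (poly (Q j) z)) \<le> exp (u z + 1)" by simp
      also have "\<dots> = exp 1 * F z" by (simp add: exp_add eu)
      finally show ?thesis using b0[of j z] by simp
    qed
    also have "(1/2::real) ^ j \<le> 1" by (rule power_le_one) auto
    also have "exp 1 * F z + b j z + 1 \<le> exp 1 * F z + (G z + 1)" using bG by simp
    also have "\<dots> = norm (D z)"
    proof -
      have "D z = of_real (exp 1 * F z + (G z + 1))" by (simp add: D_def)
      moreover have "0 \<le> exp 1 * F z + (G z + 1)" using F(2)[of z] b0[of j z] bG by simp
      ultimately show ?thesis by (simp only: norm_of_real abs_of_nonneg)
    qed
    finally show ?case by simp
  qed
  ultimately show ?thesis using hm Xh hF that by blast
qed

text \<open>Common core of the two implications from the analytic conditions: each \<open>f\<close>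
  of the large space is dominated by an outer function \<open>h\<close>, so \<open>L_ideal\<close>
  leaves only limits of dominated analytic polynomials to be treated.\<close>

lemma L_eq_cL_I:
  assumes outer: "\<And>X D h. D \<in> cL_space \<alpha> \<Longrightarrow> h \<in> cL_space \<alpha> \<Longrightarrow>
    (\<And>j. AE z in \<mu>. norm (poly (X j) z) \<le> norm (D z)) \<Longrightarrow>
    AE z in \<mu>. (\<lambda>j::nat. poly (X j) z) \<longlonglongrightarrow> h z \<Longrightarrow> h \<in> L_space \<alpha>"
  shows "L_space \<alpha> = cL_space \<alpha>"
proof (intro equalityI subsetI)
  fix f assume f: "f \<in> cL_space \<alpha>"
  note [measurable] = cL_borel[OF f]
  define F where "F z = norm (f z) + 1" for z
  have Fm: "F \<in> circle_borel" unfolding F_def by measurable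
  have "(\<lambda>z. complex_of_real (norm (f z))) \<in> cL_space \<alpha>"
    by (rule cL_mono[OF f]) auto
  then have "(\<lambda>z. complex_of_real (norm (f z)) + 1) \<in> cL_space \<alpha>"
    by (rule cL_add[OF _ Linfty_cL[OF Linfty_const]])
  then have FcL: "(\<lambda>z. complex_of_real (F z)) \<in> cL_space \<alpha>" by (simp add: F_def)
  have F1: "1 \<le> F z" for z by (simp add: F_def)
  obtain X D h where X: "D \<in> cL_space \<alpha>" "h \<in> circle_borel"
    "\<And>j. AE z in \<mu>. norm (poly (X j) z) \<le> norm (D z)"
    "AE z in \<mu>. (\<lambda>j::nat. poly (X j) z) \<longlonglongrightarrow> h z"
    "AE z in \<mu>. norm (h z) = F z"
    by (rule outer_function[OF Fm F1 FcL]) (rule that; assumption)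
  have "h \<in> cL_space \<alpha>"
  proof (rule cL_mono[OF FcL X(2)])
    show "AE z in \<mu>. norm (h z) \<le> norm (complex_of_real (F z))"
      using X(5) by eventually_elim simp
  qed
  then have hL: "h \<in> L_space \<alpha>" by (rule outer[OF X(1) _ X(3,4)])
  show "f \<in> L_space \<alpha>"
  proof (rule L_ideal[OF hL cL_borel[OF f]])
    show "AE z in \<mu>. norm (f z) \<le> norm (h z)"
      using X(5) by eventually_elim (simp add: F_def)
  qed
qed (rule L_cL)

text \<open>The majorant is integrable, so the polynomials converge to \<open>h\<close> in L1 and
  \<open>h\<close> lies in \<open>H1\<close>; \<open>eq\<close> then puts it into the
  closure.\<close>

lemma L_eq_cL_of_H_eq_cH:
  assumes eq: "H_space \<alpha> = cH_space \<alpha>"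
  shows "L_space \<alpha> = cL_space \<alpha>"
proof (rule L_eq_cL_I)
  fix X D h
  assume D: "D \<in> cL_space \<alpha>" and h: "h \<in> cL_space \<alpha>"
    and le: "\<And>j. AE z in \<mu>. norm (poly (X j) z) \<le> norm (D z)"
    and lim: "AE z in \<mu>. (\<lambda>j::nat. poly (X j) z) \<longlonglongrightarrow> h z"
  note [measurable] = cL_borel[OF D] cL_borel[OF h] Linfty_borel[OF poly_Linfty]
  have "(\<lambda>j. LINT z|\<mu>. norm (h z - poly (X j) z)) \<longlonglongrightarrow> (LINT z|\<mu>. 0)"
  proof (rule integral_dominated_convergence[where w="\<lambda>z. norm (h z) + norm (D z)"])
    show "integrable \<mu> (\<lambda>z. norm (h z) + norm (D z))"
      using cL_integrable[OF D] cL_integrable[OF h] by simp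
    show "AE z in \<mu>. (\<lambda>j. norm (h z - poly (X j) z)) \<longlonglongrightarrow> 0"
      using lim
    proof eventually_elim
      case (elim z)
      from tendsto_norm[OF tendsto_diff[OF tendsto_const[of "h z"] elim]] show ?case by simp
    qed
    show "AE z in \<mu>. norm (norm (h z - poly (X j) z)) \<le> norm (h z) + norm (D z)" for j
      using le[of j]
    proof eventually_elim
      case (elim z) then show ?case using norm_triangle_ineq4[of "h z" "poly (X j) z"] by simp
    qed
  qed measurable
  then have lim0: "(\<lambda>j. LINT z|\<mu>. norm (h z - poly (X j) z)) \<longlonglongrightarrow> 0" by simp
  have "h \<in> H1" unfolding H1_iff
  proof (intro conjI allI impI cL_integrable[OF h])
    fix e :: real assume "0 < e"
    then have "\<forall>\<^sub>F j in sequentially. (LINT z|\<mu>. norm (h z - poly (X j) z)) < e"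
      using lim0 by (intro order_tendstoD)
    then show "\<exists>P. (LINT z|\<mu>. norm (h z - poly P z)) < e"
      by (auto simp: eventually_sequentially)
  qed
  then show "h \<in> L_space \<alpha>" using h eq H_subset_L unfolding cH_space_def by blast
qed

lemma dual_H_representation:
  assumes "\<phi> \<in> dual_space (H_space \<alpha>) p"
  obtains C g where "0 \<le> C" "koethe C g" "\<And>f. f \<in> H_space \<alpha> \<Longrightarrow> \<phi> f = (LINT z|\<mu>. f z * g z)"
proof -
  obtain \<psi> where \<psi>: "\<psi> \<in> dual_space (L_space \<alpha>) p" "\<And>f. f \<in> H_space \<alpha> \<Longrightarrow> \<psi> f = \<phi> f"
    using dual_extension[OF H_subset_L H_subspace assms] by blast
  obtain C g where "0 \<le> C" "koethe C g" "\<And>f. f \<in> L_space \<alpha> \<Longrightarrow> \<psi> f = (LINT z|\<mu>. f z * g z)"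
    using dual_L_representation[OF \<psi>(1)] by blast
  then show ?thesis using \<psi>(2) H_subset_L that by (metis subsetD)
qed

text \<open>The dominated polynomials converge to \<open>h\<close> against the Koethe dual, hence
  are weakly Cauchy in the Hardy space; their weak limit there agrees with \<open>h\<close> almost
  everywhere.\<close>

lemma L_eq_cL_of_weakly_seq_complete_H:
  assumes wsc: "weakly_seq_complete (H_space \<alpha>) p"
  shows "L_space \<alpha> = cL_space \<alpha>"
proof (rule L_eq_cL_I)
  fix X D h
  assume D: "D \<in> cL_space \<alpha>" and h: "h \<in> cL_space \<alpha>"
    and le: "\<And>j. AE z in \<mu>. norm (poly (X j) z) \<le> norm (D z)"
    and lim: "AE z in \<mu>. (\<lambda>j::nat. poly (X j) z) \<longlonglongrightarrow> h z"
  have conv: "(\<lambda>j. LINT z|\<mu>. poly (X j) z * g z) \<longlonglongrightarrow> (LINT z|\<mu>. h z * g z)"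
    if "koethe C g" for C g
    by (rule koethe_dominated_convergence[OF that D Linfty_borel[OF poly_Linfty] le lim cL_borel[OF h]])
  have "weakly_Cauchy (H_space \<alpha>) p (\<lambda>j. poly (X j))"
    unfolding weakly_Cauchy_def
  proof
    fix \<phi> assume "\<phi> \<in> dual_space (H_space \<alpha>) p"
    then obtain C g where g: "koethe C g" "\<And>f. f \<in> H_space \<alpha> \<Longrightarrow> \<phi> f = (LINT z|\<mu>. f z * g z)"
      using dual_H_representation by blast
    show "Cauchy (\<lambda>j. \<phi> (poly (X j)))"
      unfolding g(2)[OF poly_H] by (rule LIMSEQ_imp_Cauchy[OF conv[OF g(1)]])
  qed
  then have "\<exists>k\<in>H_space \<alpha>. weakly_convergent_to (H_space \<alpha>) p (\<lambda>j. poly (X j)) k"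
    using poly_H by (intro wsc[unfolded weakly_seq_complete_def, rule_format] conjI allI)
  then obtain k where k: "k \<in> H_space \<alpha>" "weakly_convergent_to (H_space \<alpha>) p (\<lambda>j. poly (X j)) k" ..
  have HcL: "H_space \<alpha> \<subseteq> cL_space \<alpha>" using H_cL by blast
  have "AE z in \<mu>. h z = k z"
    by (rule AE_eq_of_koethe_limits[OF HcL k(2,1) h conv])
  then have "AE z in \<mu>. norm (h z) \<le> norm (k z)" by eventually_elim simp
  moreover have "k \<in> L_space \<alpha>" using k(1) H_subset_L by blast
  ultimately show "h \<in> L_space \<alpha>" using L_ideal[OF _ cL_borel[OF h]] by blast
qed

text \<open>Moments against \<open>z ^ k\<close> are Koethe pairings, so the vanishing of the
  coefficients of negative index survives the weak limit and \<open>H_spaceI\<close>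
  applies.\<close>

lemma weakly_seq_complete_H:
  assumes eq: "L_space \<alpha> = cL_space \<alpha>"
  shows "weakly_seq_complete (H_space \<alpha>) p"
  unfolding weakly_seq_complete_def
proof (intro allI impI, elim conjE)
  fix x :: "nat \<Rightarrow> complex \<Rightarrow> complex"
  assume x: "\<forall>n. x n \<in> H_space \<alpha>" "weakly_Cauchy (H_space \<alpha>) p x"
  have HcL: "H_space \<alpha> \<subseteq> cL_space \<alpha>" using H_cL by blast
  have xcL: "x n \<in> cL_space \<alpha>" for n using x(1) HcL by blast
  have Cau: "Cauchy (\<lambda>n. LINT z|\<mu>. x n z * g z)" if "0 \<le> C" "koethe C g" for C g
    by (rule weakly_Cauchy_koethe[OF x(2) HcL that])
  obtain f where f: "f \<in> cL_space \<alpha>"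
    and lim: "\<And>C g. 0 \<le> C \<Longrightarrow> koethe C g \<Longrightarrow>
      (\<lambda>n. LINT z|\<mu>. x n z * g z) \<longlonglongrightarrow> (LINT z|\<mu>. f z * g z)"
    by (rule koethe_weak_limit[OF xcL], erule (1) Cau, rule that; assumption)
  have "f \<in> H_space \<alpha>"
  proof (rule H_spaceI)
    show "f \<in> L_space \<alpha>" using f eq by blast
    fix k :: nat assume k: "0 < k"
    have "koethe 1 (\<lambda>z. z ^ k)"
      unfolding koethe_def
    proof (intro conjI ballI)
      show "(\<lambda>z. z ^ k) \<in> circle_borel" by (intro circle_borel_continuous continuous_intros)
      fix f :: "complex \<Rightarrow> complex" assume "f \<in> circle_borel"
      moreover have "(\<integral>\<^sup>+z. ennreal (norm (f z * z ^ k)) \<partial>\<mu>) = (\<integral>\<^sup>+z. ennreal (norm (f z)) \<partial>\<mu>)"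
        by (rule nn_integral_cong) (simp add: norm_mult norm_power)
      ultimately show "(\<integral>\<^sup>+z. ennreal (norm (f z * z ^ k)) \<partial>\<mu>) \<le> ennreal 1 * p f"
        using nn_integral_le_p by simp
    qed
    then have "(\<lambda>n. LINT z|\<mu>. x n z * z ^ k) \<longlonglongrightarrow> (LINT z|\<mu>. f z * z ^ k)"
      by (rule lim[rotated]) simp
    moreover have "(LINT z|\<mu>. x n z * z ^ k) = 0" for n
      using x(1) H_subset_H1 by (intro H1_moment_eq_0[OF _ k]) blast
    ultimately show "(LINT z|\<mu>. f z * z ^ k) = 0" by (simp add: LIMSEQ_const_iff)
  qed
  moreover have "weakly_convergent_to (H_space \<alpha>) p x f"
    unfolding weakly_convergent_to_def
  proof
    fix \<phi> assume "\<phi> \<in> dual_space (H_space \<alpha>) p"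
    then obtain C g where g: "0 \<le> C" "koethe C g" "\<And>f. f \<in> H_space \<alpha> \<Longrightarrow> \<phi> f = (LINT z|\<mu>. f z * g z)"
      using dual_H_representation by blast
    then show "(\<lambda>n. \<phi> (x n)) \<longlonglongrightarrow> \<phi> f"
      using lim[OF g(1,2)] x(1) \<open>f \<in> H_space \<alpha>\<close> by simp
  qed
  ultimately show "\<exists>f\<in>H_space \<alpha>. weakly_convergent_to (H_space \<alpha>) p x f" by blast
qed

end

theorem theorem9p10:
  fixes \<alpha> :: "(complex \<Rightarrow> complex) \<Rightarrow> real"
  assumes "\<alpha> \<in> Rc"
  shows "(L_space \<alpha> = cL_space \<alpha> \<longleftrightarrow> H_space \<alpha> = cH_space \<alpha>) \<and>
         (H_space \<alpha> = cH_space \<alpha> \<longleftrightarrow> weakly_seq_complete (H_space \<alpha>) (ext_seminorm \<alpha>)) \<and>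
         (weakly_seq_complete (H_space \<alpha>) (ext_seminorm \<alpha>) \<longleftrightarrow>
          weakly_seq_complete (L_space \<alpha>) (ext_seminorm \<alpha>))"
proof -
  interpret rotational_seminorm \<alpha> by standard (rule assms)
  have "H_space \<alpha> = cH_space \<alpha>" if "L_space \<alpha> = cL_space \<alpha>"
    using that H_space_eq by (simp add: cH_space_def)
  then show ?thesis
    using L_eq_cL_of_H_eq_cH weakly_seq_complete_H L_eq_cL_of_weakly_seq_complete_H
      weakly_seq_complete_L L_eq_cL_of_weakly_seq_complete by blast
qed

end
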